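(* Let $G=\prod_{i=1}^s G_i$ be a direct product of finite cyclic groups $G_i=\langle a_i\mid a_i^{o_i}=1\rangle$ of orders $o_i$, let $R=\mathbb{Z}G$, let $\mathbb{S}$ be the normalized standard resolution of the trivial $G$-module $\mathbb{Z}$, and let $\mathbb{P}$ be the polynomial resolution of $\mathbb{Z}$ (both described in the context). There is a quasi-isomorphism of complexes of $R$-modules $\sigma:\mathbb{S}\to\mathbb{P}$ such that, for all exponents $0\le k_i<o_i$, $0\le l_i<o_i$: $$\sigma_0=\mathrm{id},$$ $$\sigma_1[a_1^{k_1}a_2^{k_2}\cdots a_s^{k_s}]=\sum_{i=1}^s\Big(\prod_{j=1}^{i-1}a_j^{k_j}\Big)a_i^{\{k_i\}}x_i,$$ $$\sigma_2[a_1^{k_1}\cdots a_s^{k_s},\,a_1^{l_1}\cdots a_s^{l_s}]=\sum_{i=1}^s\sum_{j=1}^i\Big(\prod_{q=1}^{i-1}a_q^{k_q}\prod_{r=1}^{j-1}a_r^{l_r}\Big)\,\sigma_2[a_i^{k_i},a_j^{l_j}],$$ where, for $0\le k<o_i$ and $0\le l<o_j$, $$\sigma_2[a_i^k,a_j^l]=\begin{cases}\lfloor (k+l)/o_i\rfloor\, x_i^2 & \text{if } i=j,\\ 0 & \text{if } i<j,\\ -\,a_j^{\{l\}}a_i^{\{k\}}x_jx_i & \text{if } i>j.\end{cases}$$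
   Context: For an element $a\in G$ and an integer $m\ge 0$, $a^{\{m\}}=1+a+a^2+\dots+a^{m-1}\in R$ (so $a^{\{0\}}=0$). The complex $\mathbb{P}$: $\mathbb{P}_n$ is the $R$-module of homogeneous polynomials of degree $n$ (including $0$) in $R[x_1,\dots,x_s]$, and $d_n:\mathbb{P}_n\to\mathbb{P}_{n-1}$ ($n\ge1$) is the $R$-linear map with $$d_n(x_1^{k_1}\cdots x_s^{k_s})=\sum_{i=1}^s(-1)^{K_i}C_i\,x_1^{k_1}\cdots x_i^{k_i-1}\cdots x_s^{k_s},\qquad K_i=\sum_{j=1}^{i-1}k_j,$$ where $C_i=a_i-1$ if $k_i$ is odd, $C_i=\sum_{t=0}^{o_i-1}a_i^t$ if $k_i>0$ is even, and $C_i=0$ if $k_i=0$. It is a free resolution of the trivial $G$-module $\mathbb{Z}$, with augmentation $\mathbb{P}_0=R\to\mathbb{Z}$, $g\mapsto1$. The complex $\mathbb{S}$: $\mathbb{S}_n$ is the free $R$-module with basis the symbols $[g_1,\dots,g_n]$, $g_i\in G\setminus\{1\}$, with the convention that $[g_1,\dots,g_n]=0$ if some $g_i=1$; $\mathbb{S}_0=R$; and the differential is the $R$-linear map $$d^{\mathrm{s}}_n[g_1,\dots,g_n]=g_1[g_2,\dots,g_n]+\sum_{i=1}^{n-1}(-1)^i[g_1,\dots,g_ig_{i+1},\dots,g_n]+(-1)^n[g_1,\dots,g_{n-1}].$$ The map $\sigma_0$ is the identity of $\mathbb{S}_0=\mathbb{P}_0=R$. *)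

theory Defs
  imports "HOL-Algebra.Module" "HOL-Algebra.Free_Abelian_Groups"
begin

text \<open>
  Elements of the integral group ring are finitely supported functions
  \<open>'g \<Rightarrow>\<^sub>0 int\<close>; the library's \<open>frag_of g\<close> is the group element \<open>g\<close> seen in the
  group ring. Addition is that of \<open>'g \<Rightarrow>\<^sub>0 int\<close>. Multiplication has to be defined here
  because \<open>G\<close> is a group with a carrier rather than a type of class \<open>monoid_add\<close>.
\<close>

definition group_ring :: "('g, 'x) monoid_scheme \<Rightarrow> ('g \<Rightarrow>\<^sub>0 int) ring" where
  "group_ring G =
     \<lparr>carrier = {r. Poly_Mapping.keys r \<subseteq> carrier G},
      mult = (\<lambda>p q. \<Sum>g\<in>Poly_Mapping.keys p. \<Sum>h\<in>Poly_Mapping.keys q.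
                Poly_Mapping.single (g \<otimes>\<^bsub>G\<^esub> h) (Poly_Mapping.lookup p g * Poly_Mapping.lookup q h)),
      one = frag_of \<one>\<^bsub>G\<^esub>,
      ring.zero = 0,
      ring.add = (+)\<rparr>"

definition gr_int :: "('g, 'x) monoid_scheme \<Rightarrow> int \<Rightarrow> ('g \<Rightarrow>\<^sub>0 int)" where
  "gr_int G c = Poly_Mapping.single \<one>\<^bsub>G\<^esub> c"

text \<open>\<open>gr_geom G g m\<close> is \<open>1 + g + \<dots> + g ^ (m - 1)\<close>, written \<open>g\<^bsup>{m}\<^esup>\<close> in the literature.\<close>

definition gr_geom :: "('g, 'x) monoid_scheme \<Rightarrow> 'g \<Rightarrow> nat \<Rightarrow> ('g \<Rightarrow>\<^sub>0 int)" where
  "gr_geom G g m = (\<Sum>t<m. frag_of (g [^]\<^bsub>G\<^esub> t))"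

definition gr_scale ::
    "('g, 'x) monoid_scheme \<Rightarrow> ('g \<Rightarrow>\<^sub>0 int) \<Rightarrow> ('b \<Rightarrow>\<^sub>0 'g \<Rightarrow>\<^sub>0 int) \<Rightarrow> ('b \<Rightarrow>\<^sub>0 'g \<Rightarrow>\<^sub>0 int)" where
  "gr_scale G r f = Poly_Mapping.map (\<lambda>c. r \<otimes>\<^bsub>group_ring G\<^esub> c) f"

text \<open>
  The free module over the group ring with basis \<open>B\<close>. The record type \<open>module\<close> extends
  \<open>ring\<close>, but the locale \<open>module\<close> ignores the fields \<open>mult\<close> and \<open>one\<close>.
\<close>

definition free_mod ::
    "('g, 'x) monoid_scheme \<Rightarrow> 'b set \<Rightarrow> ('g \<Rightarrow>\<^sub>0 int, 'b \<Rightarrow>\<^sub>0 'g \<Rightarrow>\<^sub>0 int) module" where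
  "free_mod G B =
     \<lparr>carrier = {f. Poly_Mapping.keys f \<subseteq> B \<and>
                    (\<forall>b. Poly_Mapping.lookup f b \<in> carrier (group_ring G))},
      mult = undefined, one = undefined,
      ring.zero = 0, ring.add = (+), smult = gr_scale G\<rparr>"

definition gr_basis :: "('g, 'x) monoid_scheme \<Rightarrow> 'b \<Rightarrow> ('b \<Rightarrow>\<^sub>0 'g \<Rightarrow>\<^sub>0 int)" where
  "gr_basis G b = Poly_Mapping.single b \<one>\<^bsub>group_ring G\<^esub>"


subsection \<open>Complexes of modules, homology, quasi-isomorphisms\<close>

text \<open>
  A complex is given by modules \<open>M n\<close> and differentials \<open>d n : M n \<rightarrow> M (n - 1)\<close> for \<open>n \<ge> 1\<close>.
  The value \<open>d 0\<close> is irrelevant: every element of \<open>M 0\<close> is a cycle.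
\<close>

definition module_map ::
    "('r, 'x) ring_scheme \<Rightarrow> ('r, 'm, 'y) module_scheme \<Rightarrow> ('r, 'n, 'z) module_scheme
      \<Rightarrow> ('m \<Rightarrow> 'n) \<Rightarrow> bool" where
  "module_map R M N f \<longleftrightarrow>
     f \<in> hom (add_monoid M) (add_monoid N) \<and>
     (\<forall>r\<in>carrier R. \<forall>x\<in>carrier M. f (r \<odot>\<^bsub>M\<^esub> x) = r \<odot>\<^bsub>N\<^esub> f x)"

definition chain_complex ::
    "('r, 'x) ring_scheme \<Rightarrow> (nat \<Rightarrow> ('r, 'm, 'y) module_scheme) \<Rightarrow> (nat \<Rightarrow> 'm \<Rightarrow> 'm) \<Rightarrow> bool" where
  "chain_complex R M d \<longleftrightarrow>
     (\<forall>n. module R (M n)) \<and>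
     (\<forall>n. module_map R (M (Suc n)) (M n) (d (Suc n))) \<and>
     (\<forall>n. \<forall>x\<in>carrier (M (Suc (Suc n))). d (Suc n) (d (Suc (Suc n)) x) = \<zero>\<^bsub>M n\<^esub>)"

definition cycles ::
    "(nat \<Rightarrow> ('r, 'm, 'y) module_scheme) \<Rightarrow> (nat \<Rightarrow> 'm \<Rightarrow> 'm) \<Rightarrow> nat \<Rightarrow> 'm set" where
  "cycles M d n = {x \<in> carrier (M n). n = 0 \<or> d n x = \<zero>\<^bsub>M (n - 1)\<^esub>}"

definition boundaries ::
    "(nat \<Rightarrow> ('r, 'm, 'y) module_scheme) \<Rightarrow> (nat \<Rightarrow> 'm \<Rightarrow> 'm) \<Rightarrow> nat \<Rightarrow> 'm set" where
  "boundaries M d n = d (Suc n) ` carrier (M (Suc n))"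

definition homology ::
    "(nat \<Rightarrow> ('r, 'm, 'y) module_scheme) \<Rightarrow> (nat \<Rightarrow> 'm \<Rightarrow> 'm) \<Rightarrow> nat \<Rightarrow> 'm set monoid" where
  "homology M d n = (add_monoid (M n)\<lparr>carrier := cycles M d n\<rparr>) Mod boundaries M d n"

text \<open>
  The map induced on homology by a chain map \<open>\<sigma>\<close> into \<open>(N, e)\<close>: the class \<open>z + B\<close> is sent to
  \<open>\<sigma> z + B'\<close>, which is the sum of the set \<open>B'\<close> and the image of \<open>z + B\<close>.
\<close>

definition homology_map ::
    "(nat \<Rightarrow> ('r, 'n, 'y) module_scheme) \<Rightarrow> (nat \<Rightarrow> 'n \<Rightarrow> 'n) \<Rightarrow> (nat \<Rightarrow> 'm \<Rightarrow> 'n)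
      \<Rightarrow> nat \<Rightarrow> 'm set \<Rightarrow> 'n set" where
  "homology_map N e \<sigma> n C = boundaries N e n <#>\<^bsub>add_monoid (N n)\<^esub> (\<sigma> n ` C)"

definition chain_map ::
    "('r, 'x) ring_scheme
      \<Rightarrow> (nat \<Rightarrow> ('r, 'm, 'y) module_scheme) \<Rightarrow> (nat \<Rightarrow> 'm \<Rightarrow> 'm)
      \<Rightarrow> (nat \<Rightarrow> ('r, 'n, 'z) module_scheme) \<Rightarrow> (nat \<Rightarrow> 'n \<Rightarrow> 'n)
      \<Rightarrow> (nat \<Rightarrow> 'm \<Rightarrow> 'n) \<Rightarrow> bool" where
  "chain_map R M d N e \<sigma> \<longleftrightarrow>
     chain_complex R M d \<and> chain_complex R N e \<and>
     (\<forall>n. module_map R (M n) (N n) (\<sigma> n)) \<and>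
     (\<forall>n. \<forall>x\<in>carrier (M (Suc n)). e (Suc n) (\<sigma> (Suc n) x) = \<sigma> n (d (Suc n) x))"

text \<open>
  The induced maps commute with the action of \<open>R\<close> because the \<open>\<sigma> n\<close> do, so that bijectivity
  is all that is needed for them to be isomorphisms of \<open>R\<close>-modules.
\<close>

definition quasi_isomorphism ::
    "('r, 'x) ring_scheme
      \<Rightarrow> (nat \<Rightarrow> ('r, 'm, 'y) module_scheme) \<Rightarrow> (nat \<Rightarrow> 'm \<Rightarrow> 'm)
      \<Rightarrow> (nat \<Rightarrow> ('r, 'n, 'z) module_scheme) \<Rightarrow> (nat \<Rightarrow> 'n \<Rightarrow> 'n)
      \<Rightarrow> (nat \<Rightarrow> 'm \<Rightarrow> 'n) \<Rightarrow> bool" where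
  "quasi_isomorphism R M d N e \<sigma> \<longleftrightarrow>
     chain_map R M d N e \<sigma> \<and>
     (\<forall>n. homology_map N e \<sigma> n \<in> iso (homology M d n) (homology N e n))"


subsection \<open>The normalized standard resolution\<close>

definition std_mod ::
    "('g, 'x) monoid_scheme \<Rightarrow> nat \<Rightarrow> ('g \<Rightarrow>\<^sub>0 int, 'g list \<Rightarrow>\<^sub>0 'g \<Rightarrow>\<^sub>0 int) module" where
  "std_mod G n = free_mod G {gs. length gs = n \<and> set gs \<subseteq> carrier G - {\<one>\<^bsub>G\<^esub>}}"

definition std_sym :: "('g, 'x) monoid_scheme \<Rightarrow> 'g list \<Rightarrow> ('g list \<Rightarrow>\<^sub>0 'g \<Rightarrow>\<^sub>0 int)" where
  "std_sym G gs = (if \<one>\<^bsub>G\<^esub> \<in> set gs then 0 else gr_basis G gs)"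

text \<open>
  List positions count from 0, so that the entries \<open>g\<^sub>i\<close> and \<open>g\<^bsub>i+1\<^esub>\<close> are
  \<open>gs ! (i - 1)\<close> and \<open>gs ! i\<close>.
\<close>

definition std_diff_sym :: "('g, 'x) monoid_scheme \<Rightarrow> 'g list \<Rightarrow> ('g list \<Rightarrow>\<^sub>0 'g \<Rightarrow>\<^sub>0 int)" where
  "std_diff_sym G gs =
     gr_scale G (frag_of (hd gs)) (std_sym G (tl gs))
     + (\<Sum>i\<in>{1..<length gs}. gr_scale G (gr_int G ((-1) ^ i))
          (std_sym G (take (i - 1) gs @ [gs ! (i - 1) \<otimes>\<^bsub>G\<^esub> gs ! i] @ drop (i + 1) gs)))
     + gr_scale G (gr_int G ((-1) ^ length gs)) (std_sym G (butlast gs))"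

text \<open>
  The degree \<open>n\<close> only matters through the domain: on \<open>std_mod G n\<close> with \<open>n \<ge> 1\<close> this is the
  differential \<open>d\<^sub>n\<close>.
\<close>

definition std_diff ::
    "('g, 'x) monoid_scheme \<Rightarrow> nat \<Rightarrow> ('g list \<Rightarrow>\<^sub>0 'g \<Rightarrow>\<^sub>0 int) \<Rightarrow> ('g list \<Rightarrow>\<^sub>0 'g \<Rightarrow>\<^sub>0 int)" where
  "std_diff G n f =
     (\<Sum>gs\<in>Poly_Mapping.keys f. gr_scale G (Poly_Mapping.lookup f gs) (std_diff_sym G gs))"


subsection \<open>The polynomial resolution\<close>

text \<open>
  The monomial \<open>x\<^sub>1 ^ k\<^sub>1 \<cdots> x\<^sub>s ^ k\<^sub>s\<close> is represented by its exponent function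
  \<open>k :: nat \<Rightarrow>\<^sub>0 nat\<close>, supported in \<open>{1..s}\<close>, and a polynomial by its finitely supported
  coefficient function on monomials.
\<close>

definition poly_mod ::
    "('g, 'x) monoid_scheme \<Rightarrow> nat \<Rightarrow> nat
      \<Rightarrow> ('g \<Rightarrow>\<^sub>0 int, (nat \<Rightarrow>\<^sub>0 nat) \<Rightarrow>\<^sub>0 'g \<Rightarrow>\<^sub>0 int) module" where
  "poly_mod G s n =
     free_mod G {k. Poly_Mapping.keys k \<subseteq> {1..s} \<and> (\<Sum>i\<in>{1..s}. Poly_Mapping.lookup k i) = n}"

definition poly_var :: "('g, 'x) monoid_scheme \<Rightarrow> nat \<Rightarrow> ((nat \<Rightarrow>\<^sub>0 nat) \<Rightarrow>\<^sub>0 'g \<Rightarrow>\<^sub>0 int)" where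
  "poly_var G i = gr_basis G (Poly_Mapping.single i 1)"

text \<open>The monomial \<open>x\<^sub>i x\<^sub>j\<close>, which is \<open>x\<^sub>i ^ 2\<close> when \<open>i = j\<close>.\<close>

definition poly_var2 :: "('g, 'x) monoid_scheme \<Rightarrow> nat \<Rightarrow> nat \<Rightarrow> ((nat \<Rightarrow>\<^sub>0 nat) \<Rightarrow>\<^sub>0 'g \<Rightarrow>\<^sub>0 int)" where
  "poly_var2 G i j = gr_basis G (Poly_Mapping.single i 1 + Poly_Mapping.single j 1)"

definition poly_coeff :: "('g, 'x) monoid_scheme \<Rightarrow> 'g \<Rightarrow> nat \<Rightarrow> nat \<Rightarrow> ('g \<Rightarrow>\<^sub>0 int)" where
  "poly_coeff G g m k =
     (if k = 0 then 0
      else if odd k then frag_of g - \<one>\<^bsub>group_ring G\<^esub>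
      else gr_geom G g m)"

text \<open>
  The truncated difference \<open>k - single i 1\<close> lowers the exponent of \<open>x\<^sub>i\<close> by one; when that
  exponent is \<open>0\<close> the coefficient \<open>C\<^sub>i\<close> vanishes.
\<close>

definition poly_diff_mono ::
    "('g, 'x) monoid_scheme \<Rightarrow> nat \<Rightarrow> (nat \<Rightarrow> 'g) \<Rightarrow> (nat \<Rightarrow> nat) \<Rightarrow> (nat \<Rightarrow>\<^sub>0 nat)
      \<Rightarrow> ((nat \<Rightarrow>\<^sub>0 nat) \<Rightarrow>\<^sub>0 'g \<Rightarrow>\<^sub>0 int)" where
  "poly_diff_mono G s a ord k =
     (\<Sum>i\<in>{1..s}.
        gr_scale G (gr_int G ((-1) ^ (\<Sum>j\<in>{1..<i}. Poly_Mapping.lookup k j)))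
          (gr_scale G (poly_coeff G (a i) (ord i) (Poly_Mapping.lookup k i))
            (gr_basis G (k - Poly_Mapping.single i 1))))"

definition poly_diff ::
    "('g, 'x) monoid_scheme \<Rightarrow> nat \<Rightarrow> (nat \<Rightarrow> 'g) \<Rightarrow> (nat \<Rightarrow> nat) \<Rightarrow> nat
      \<Rightarrow> ((nat \<Rightarrow>\<^sub>0 nat) \<Rightarrow>\<^sub>0 'g \<Rightarrow>\<^sub>0 int) \<Rightarrow> ((nat \<Rightarrow>\<^sub>0 nat) \<Rightarrow>\<^sub>0 'g \<Rightarrow>\<^sub>0 int)" where
  "poly_diff G s a ord n f =
     (\<Sum>k\<in>Poly_Mapping.keys f. gr_scale G (Poly_Mapping.lookup f k) (poly_diff_mono G s a ord k))"

end

theory Submission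
  imports "HOL.Modules" "HOL-Algebra.Multiplicative_Group" Defs
begin

text \<open>
  Both complexes are exact in positive degrees because they have additive (not \<open>R\<close>-linear)
  contracting homotopies. For the standard resolution it is
  \<open>g[g\<^sub>1, \<dots>, g\<^sub>n] \<mapsto> [g, g\<^sub>1, \<dots>, g\<^sub>n]\<close>. The polynomial resolution is a
  tensor product over the factors, so its differential is a sum of anticommuting partial
  differentials \<open>d\<^sub>i\<close>, one for each variable. The contracting homotopy \<open>h\<^sub>i\<close> of the
  resolution of the \<open>i\<close>-th factor anticommutes with \<open>d\<^sub>j\<close> for \<open>j \<noteq> i\<close>, and
  \<open>d h\<^sub>i + h\<^sub>i d = 1 - p\<^sub>i\<close>, where \<open>p\<^sub>i\<close> kills all monomials containing \<open>x\<^sub>i\<close>.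
  Hence a cycle of positive degree can be freed of one variable after another, modulo
  boundaries, until nothing is left.

  The given formulas define \<open>\<sigma>\<close> in degrees at most 2; that they commute with the
  differentials is a computation with telescoping sums. As \<open>S\<close> is free and \<open>P\<close> is
  exact, \<open>\<sigma>\<close> extends to all degrees. It is a quasi-isomorphism since all homology in positive
  degrees vanishes, and since in degree 0 it is the identity of \<open>R\<close> and the boundaries
  agree: \<open>d (r x\<^sub>i) = r (a\<^sub>i - 1) = d (r [a\<^sub>i])\<close>.
\<close>

section \<open>Additive maps on finitely supported functions\<close>

text \<open>For nontrivial G the homotopies cannot be R-linear, as the trivial module Z is not
  projective. Identities that involve them must therefore be checked on all elements g b with g in G
  and b in the basis, not on the basis alone; the extensionality principles below serve this
  purpose.

  Origin of the formulas: \<sigma>_1 has to satisfy d \<sigma>_1[x] = x - 1. Telescope x - 1 along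
  the partial products of x; each step is a partial product times (a_i - 1) times a geometric sum in
  a_i. In degree 2 the target is x \<sigma>_1[y] - \<sigma>_1[x y] + \<sigma>_1[x], and two defects
  have to be repaired. Exponents of x y are reduced modulo o_i, so every carry costs one norm
  element times x_i, which is d(x_i^2). And the factors of x have to pass the earlier factors of y,
  which is paid for by the monomials x_j x_i with j < i.

  Since degree 2 is prescribed, free choices begin in degree 3. Each choice must leave the next
  lifting problem solvable, so the recursion carries along the condition that the elements to be
  lifted are cycles.\<close>

definition pm_ext :: "('b \<Rightarrow> 'c::zero \<Rightarrow> 'd::comm_monoid_add) \<Rightarrow> ('b \<Rightarrow>\<^sub>0 'c) \<Rightarrow> 'd" where
  "pm_ext \<phi> f = (\<Sum>b\<in>Poly_Mapping.keys f. \<phi> b (Poly_Mapping.lookup f b))"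

text \<open>Supports shrink under cancellation, so sums over the \<open>keys\<close> of different
  functions cannot be compared directly. As coefficient 0 contributes nothing, a common index set
  may be used instead.\<close>

lemma pm_ext_superset:
  assumes "finite A" "Poly_Mapping.keys f \<subseteq> A" "\<And>b. \<phi> b 0 = 0"
  shows "pm_ext \<phi> f = (\<Sum>b\<in>A. \<phi> b (Poly_Mapping.lookup f b))"
  unfolding pm_ext_def
  by (rule sum.mono_neutral_left) (use assms in \<open>auto simp: in_keys_iff\<close>)

lemma additive_pm_ext:
  fixes \<phi> :: "'b \<Rightarrow> 'c::ab_group_add \<Rightarrow> 'd::ab_group_add"
  assumes "\<And>b. additive (\<phi> b)"
  shows "additive (pm_ext \<phi>)"
proof
  fix f g :: "'b \<Rightarrow>\<^sub>0 'c"
  let ?A = "Poly_Mapping.keys f \<union> Poly_Mapping.keys g"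
  have z: "\<phi> b 0 = 0" for b
    using additive.zero[OF assms] .
  have "pm_ext \<phi> (f + g) = (\<Sum>b\<in>?A. \<phi> b (Poly_Mapping.lookup (f + g) b))"
    by (rule pm_ext_superset) (auto simp: z dest: subsetD[OF keys_add])
  also have "\<dots> = (\<Sum>b\<in>?A. \<phi> b (Poly_Mapping.lookup f b))
      + (\<Sum>b\<in>?A. \<phi> b (Poly_Mapping.lookup g b))"
    by (simp add: lookup_add additive.add[OF assms] sum.distrib)
  also have "\<dots> = pm_ext \<phi> f + pm_ext \<phi> g"
    by (subst (1 2) pm_ext_superset[where A = ?A]) (auto simp: z)
  finally show "pm_ext \<phi> (f + g) = pm_ext \<phi> f + pm_ext \<phi> g" .
qed

lemma pm_ext_single:
  assumes "\<phi> b 0 = 0"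
  shows "pm_ext \<phi> (Poly_Mapping.single b c) = \<phi> b c"
  by (cases "c = 0") (auto simp: pm_ext_def assms)

lemma additive_comp:
  "additive F \<Longrightarrow> additive H \<Longrightarrow> additive (\<lambda>x. F (H x))"
  by (simp add: additive_def)

lemma additive_plus:
  "additive F \<Longrightarrow> additive H \<Longrightarrow> additive (\<lambda>x. F x + H x)"
  by (simp add: additive_def algebra_simps)

lemma additive_diff:
  "additive F \<Longrightarrow> additive H \<Longrightarrow> additive (\<lambda>x. F x - H x)"
  by (simp add: additive_def algebra_simps)

lemma additive_uminus: "additive F \<Longrightarrow> additive (\<lambda>x. - F x)"
  by (simp add: additive_def)

lemma additive_id: "additive (\<lambda>x. x)"
  by (simp add: additive_def)

lemma additive_0: "additive (\<lambda>x. 0)"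
  by (simp add: additive_def)

lemma additive_sum_fun:
  "(\<And>i. i \<in> A \<Longrightarrow> additive (F i)) \<Longrightarrow> additive (\<lambda>x. \<Sum>i\<in>A. F i x)"
  by (simp add: additive_def sum.distrib)

lemma additive_single: "additive (Poly_Mapping.single b)"
  by (simp add: additive_def single_add)

lemma additive_frag_cmul: "additive (frag_cmul c)"
  by (simp add: additive_def frag_cmul_distrib2)

lemma poly_mapping_expansion:
  "f = (\<Sum>b\<in>Poly_Mapping.keys f. Poly_Mapping.single b (Poly_Mapping.lookup f b))"
proof (rule poly_mapping_eqI)
  fix k
  show "Poly_Mapping.lookup f k = Poly_Mapping.lookup
      (\<Sum>b\<in>Poly_Mapping.keys f. Poly_Mapping.single b (Poly_Mapping.lookup f b)) k"
    by (cases "k \<in> Poly_Mapping.keys f") (auto simp: lookup_sum lookup_single when_def in_keys_iff)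
qed

lemma additive_eqI_single:
  assumes "additive F" "additive H"
    and "\<And>b. b \<in> Poly_Mapping.keys f \<Longrightarrow>
      F (Poly_Mapping.single b (Poly_Mapping.lookup f b)) = H (Poly_Mapping.single b (Poly_Mapping.lookup f b))"
  shows "F f = H f"
proof -
  have "F f = (\<Sum>b\<in>Poly_Mapping.keys f. F (Poly_Mapping.single b (Poly_Mapping.lookup f b)))"
    by (subst poly_mapping_expansion) (simp add: additive.sum[OF assms(1)])
  also have "\<dots> = (\<Sum>b\<in>Poly_Mapping.keys f. H (Poly_Mapping.single b (Poly_Mapping.lookup f b)))"
    by (simp add: assms(3))
  also have "\<dots> = H f"
    by (subst (2) poly_mapping_expansion) (simp add: additive.sum[OF assms(2)])
  finally show ?thesis .
qed

text \<open>Every element is an integer combination of the group elements in its support. The set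
  \<open>S\<close> keeps these inside \<open>carrier G\<close>, where the group laws hold; with
  \<open>S = {\<one>}\<close> the principle covers integer multiples of the unit.\<close>

lemma additive_eqI_frag:
  fixes r :: "'g \<Rightarrow>\<^sub>0 int"
  assumes "Poly_Mapping.keys r \<subseteq> S" "additive F" "additive H"
    and "\<And>g. g \<in> S \<Longrightarrow> F (frag_of g) = H (frag_of g)"
  shows "F r = H r"
  using assms(1)
proof (induction r rule: frag_induction)
  case zero
  then show ?case by (simp add: additive.zero[OF assms(2)] additive.zero[OF assms(3)])
next
  case (diff p q)
  then show ?case by (simp add: additive.diff[OF assms(2)] additive.diff[OF assms(3)])
qed (use assms in simp)

lemma additive_eq_0I_frag:
  fixes r :: "'g \<Rightarrow>\<^sub>0 int"
  assumes "Poly_Mapping.keys r \<subseteq> S" "additive F" "\<And>g. g \<in> S \<Longrightarrow> F (frag_of g) = 0"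
  shows "F r = 0"
  using additive_eqI_frag[OF assms(1,2) additive_0] assms(3) by simp


section \<open>The integral group ring of an abelian group\<close>

context
  fixes G :: "('g, 'x) monoid_scheme" (structure)
begin

lemma carrier_group_ring: "carrier (group_ring G) = {r. Poly_Mapping.keys r \<subseteq> carrier G}"
  by (simp add: group_ring_def)

lemma group_ring_sel [simp]:
  "\<zero>\<^bsub>group_ring G\<^esub> = 0" "p \<oplus>\<^bsub>group_ring G\<^esub> q = p + q" "\<one>\<^bsub>group_ring G\<^esub> = frag_of \<one>\<^bsub>G\<^esub>"
  by (simp_all add: group_ring_def)

lemma group_ring_zero_closed [simp]: "0 \<in> carrier (group_ring G)"
  by (simp add: carrier_group_ring)

lemma group_ring_add_closed [simp]:
  "\<lbrakk>p \<in> carrier (group_ring G); q \<in> carrier (group_ring G)\<rbrakk> \<Longrightarrow> p + q \<in> carrier (group_ring G)"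
  using keys_add[of p q] by (auto simp: carrier_group_ring)

lemma group_ring_uminus_closed [simp]:
  "p \<in> carrier (group_ring G) \<Longrightarrow> - p \<in> carrier (group_ring G)"
  by (auto simp: carrier_group_ring)

lemma group_ring_diff_closed [simp]:
  "\<lbrakk>p \<in> carrier (group_ring G); q \<in> carrier (group_ring G)\<rbrakk> \<Longrightarrow> p - q \<in> carrier (group_ring G)"
  using keys_diff[of p q] by (auto simp: carrier_group_ring)

lemma group_ring_sum_closed [intro]:
  "(\<And>i. i \<in> A \<Longrightarrow> p i \<in> carrier (group_ring G)) \<Longrightarrow> sum p A \<in> carrier (group_ring G)"
  by (induction A rule: infinite_finite_induct) auto

lemma frag_cmul_closed [simp]:
  "p \<in> carrier (group_ring G) \<Longrightarrow> frag_cmul c p \<in> carrier (group_ring G)"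
  using keys_cmul[of c p] by (auto simp: carrier_group_ring)

lemma frag_of_closed [simp]: "frag_of g \<in> carrier (group_ring G) \<longleftrightarrow> g \<in> carrier G"
  by (simp add: carrier_group_ring)

text \<open>Reading the product as two nested additive extensions gives additivity in both arguments
  for all finitely supported functions, with no membership in the carrier to discharge.\<close>

lemma group_ring_mult_eq_pm_ext:
  "p \<otimes>\<^bsub>group_ring G\<^esub> q = pm_ext (\<lambda>g c. pm_ext (\<lambda>h d. Poly_Mapping.single (g \<otimes> h) (c * d)) q) p"
  by (simp add: group_ring_def pm_ext_def)

lemma additive_mult_left: "additive (\<lambda>p. p \<otimes>\<^bsub>group_ring G\<^esub> q)"
  unfolding group_ring_mult_eq_pm_ext
  by (rule additive_pm_ext, unfold_locales)
    (simp add: pm_ext_def distrib_right single_add sum.distrib)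

lemma additive_mult_right: "additive (\<lambda>q. p \<otimes>\<^bsub>group_ring G\<^esub> q)"
proof -
  have "additive (pm_ext (\<lambda>h d. Poly_Mapping.single (g \<otimes> h) (c * d)))" for g and c :: int
    by (rule additive_pm_ext, unfold_locales) (simp add: distrib_left single_add)
  then show ?thesis
    unfolding group_ring_mult_eq_pm_ext
    by unfold_locales (simp add: pm_ext_def[of _ p] additive.add sum.distrib)
qed

lemmas gr_distribs =
  additive.add[OF additive_mult_left] additive.add[OF additive_mult_right]
  additive.diff[OF additive_mult_left] additive.diff[OF additive_mult_right]
  additive.minus[OF additive_mult_left] additive.minus[OF additive_mult_right]

lemmas gr_mult_zero [simp] =
  additive.zero[OF additive_mult_left] additive.zero[OF additive_mult_right]

lemmas gr_mult_sum =
  additive.sum[OF additive_mult_left] additive.sum[OF additive_mult_right]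

lemma single_mult_single:
  "Poly_Mapping.single g c \<otimes>\<^bsub>group_ring G\<^esub> Poly_Mapping.single h d = Poly_Mapping.single (g \<otimes> h) (c * d)"
  unfolding group_ring_mult_eq_pm_ext by (simp add: pm_ext_single)

lemma frag_of_mult [simp]: "frag_of g \<otimes>\<^bsub>group_ring G\<^esub> frag_of h = frag_of (g \<otimes> h)"
  by (simp add: single_mult_single)

end

lemma single_eq_frag_cmul: "Poly_Mapping.single g (c::int) = frag_cmul c (frag_of g)"
  by (rule poly_mapping_eqI) (simp add: lookup_single when_def)

text \<open>Additive maps are linear over the integers. This carries signs and carry counts through
  maps that are not R-linear, such as the homotopies.\<close>

lemma additive_frag_cmul_comm:
  assumes "additive F"
  shows "F (frag_cmul c p) = frag_cmul c (F p)"
proof -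
  have n: "F (frag_cmul (int n) p) = frag_cmul (int n) (F p)" for n
    by (induction n) (simp_all add: additive.zero[OF assms] additive.add[OF assms] frag_cmul_distrib)
  show ?thesis
  proof (cases c rule: int_cases2)
    case (nonneg m)
    then show ?thesis by (simp add: n)
  next
    case (nonpos m)
    have "F (frag_cmul (- int m) p) = F (- frag_cmul (int m) p)" by simp
    also have "\<dots> = - F (frag_cmul (int m) p)"
      by (rule additive.minus[OF assms])
    finally show ?thesis using nonpos by (simp add: n)
  qed
qed

lemmas gr_mult_cmul =
  additive_frag_cmul_comm[OF additive_mult_left] additive_frag_cmul_comm[OF additive_mult_right]

context comm_group
begin

lemma group_ring_m_closed [simp]:
  assumes "p \<in> carrier (group_ring G)" "q \<in> carrier (group_ring G)"
  shows "p \<otimes>\<^bsub>group_ring G\<^esub> q \<in> carrier (group_ring G)"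
proof -
  have "Poly_Mapping.single (g \<otimes> h) (c :: int) \<in> carrier (group_ring G)"
    if "g \<in> Poly_Mapping.keys p" "h \<in> Poly_Mapping.keys q" for g h c
    using that assms by (auto simp: carrier_group_ring)
  then show ?thesis
    unfolding group_ring_mult_eq_pm_ext pm_ext_def by (intro group_ring_sum_closed) 
qed

lemma group_ring_m_comm:
  assumes p: "p \<in> carrier (group_ring G)" and q: "q \<in> carrier (group_ring G)"
  shows "p \<otimes>\<^bsub>group_ring G\<^esub> q = q \<otimes>\<^bsub>group_ring G\<^esub> p"
proof (rule additive_eqI_frag[OF _ additive_mult_left additive_mult_right, where S = "carrier G"])
  show "Poly_Mapping.keys p \<subseteq> carrier G" using p by (simp add: carrier_group_ring)
  show "frag_of g \<otimes>\<^bsub>group_ring G\<^esub> q = q \<otimes>\<^bsub>group_ring G\<^esub> frag_of g" if "g \<in> carrier G" for g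
    by (rule additive_eqI_frag[OF _ additive_mult_right additive_mult_left, where S = "carrier G"])
      (use q that in \<open>auto simp: carrier_group_ring m_comm\<close>)
qed

lemma group_ring_m_assoc:
  assumes p: "p \<in> carrier (group_ring G)" and q: "q \<in> carrier (group_ring G)"
    and r: "r \<in> carrier (group_ring G)"
  shows "p \<otimes>\<^bsub>group_ring G\<^esub> q \<otimes>\<^bsub>group_ring G\<^esub> r = p \<otimes>\<^bsub>group_ring G\<^esub> (q \<otimes>\<^bsub>group_ring G\<^esub> r)"
proof (rule additive_eqI_frag[where r = p and S = "carrier G"])
  fix g assume g: "g \<in> carrier G"
  show "frag_of g \<otimes>\<^bsub>group_ring G\<^esub> q \<otimes>\<^bsub>group_ring G\<^esub> r
      = frag_of g \<otimes>\<^bsub>group_ring G\<^esub> (q \<otimes>\<^bsub>group_ring G\<^esub> r)"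
  proof (rule additive_eqI_frag[where r = q and S = "carrier G"])
    fix h assume h: "h \<in> carrier G"
    show "frag_of g \<otimes>\<^bsub>group_ring G\<^esub> frag_of h \<otimes>\<^bsub>group_ring G\<^esub> r
      = frag_of g \<otimes>\<^bsub>group_ring G\<^esub> (frag_of h \<otimes>\<^bsub>group_ring G\<^esub> r)"
      by (rule additive_eqI_frag[where r = r and S = "carrier G"])
        (use r g h in \<open>auto simp: carrier_group_ring m_assoc intro: additive_mult_right
          additive_comp[OF additive_mult_right additive_mult_right]\<close>)
  qed (use q in \<open>auto simp: carrier_group_ring
        intro: additive_comp[OF additive_mult_left additive_mult_right]
          additive_comp[OF additive_mult_right additive_mult_left]\<close>)
qed (use p in \<open>auto simp: carrier_group_ring intro: additive_mult_left
      additive_comp[OF additive_mult_left additive_mult_left]\<close>)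

lemma group_ring_l_one [simp]:
  assumes p: "p \<in> carrier (group_ring G)"
  shows "frag_of \<one> \<otimes>\<^bsub>group_ring G\<^esub> p = p"
  by (rule additive_eqI_frag[OF _ additive_mult_right additive_id, where S = "carrier G"])
    (use p in \<open>auto simp: carrier_group_ring\<close>)

lemma group_ring_r_one [simp]:
  assumes p: "p \<in> carrier (group_ring G)"
  shows "p \<otimes>\<^bsub>group_ring G\<^esub> frag_of \<one> = p"
  using group_ring_l_one[OF p] group_ring_m_comm[OF p] by simp

lemma cring_group_ring: "cring (group_ring G)"
proof (intro cringI abelian_groupI comm_monoidI)
  show "\<exists>q\<in>carrier (group_ring G). q \<oplus>\<^bsub>group_ring G\<^esub> p = \<zero>\<^bsub>group_ring G\<^esub>"
    if "p \<in> carrier (group_ring G)" for p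
    by (rule bexI[of _ "- p"]) (use that in auto)
qed (auto simp: add_ac gr_distribs group_ring_m_assoc intro: group_ring_m_comm)

section \<open>Integers and geometric sums in the group ring\<close>

lemma gr_int_mult:
  assumes "p \<in> carrier (group_ring G)"
  shows "gr_int G c \<otimes>\<^bsub>group_ring G\<^esub> p = frag_cmul c p"
  using assms unfolding gr_int_def
  by (subst single_eq_frag_cmul) (simp add: gr_mult_cmul)

lemma gr_int_closed [simp]: "gr_int G c \<in> carrier (group_ring G)"
  unfolding gr_int_def by (auto simp: carrier_group_ring)

lemma gr_geom_closed [simp]: "g \<in> carrier G \<Longrightarrow> gr_geom G g m \<in> carrier (group_ring G)"
  unfolding gr_geom_def by (intro group_ring_sum_closed) auto

lemma gr_geom_0 [simp]: "gr_geom G g 0 = 0"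
  by (simp add: gr_geom_def)

lemma gr_geom_add:
  assumes "g \<in> carrier G"
  shows "gr_geom G g (k + l) = gr_geom G g k + frag_of (g [^] k) \<otimes>\<^bsub>group_ring G\<^esub> gr_geom G g l"
proof -
  have "gr_geom G g (k + l) = gr_geom G g k + (\<Sum>t\<in>{k..<k+l}. frag_of (g [^] t))"
    unfolding gr_geom_def by (simp add: sum.atLeastLessThan_concat lessThan_atLeast0)
  also have "(\<Sum>t\<in>{k..<k+l}. frag_of (g [^] t)) = (\<Sum>t<l. frag_of (g [^] (k + t)))"
    by (rule sum.reindex_bij_witness[of _ "\<lambda>t. k + t" "\<lambda>t. t - k"]) auto
  also have "\<dots> = frag_of (g [^] k) \<otimes>\<^bsub>group_ring G\<^esub> gr_geom G g l"
    by (simp add: gr_geom_def gr_mult_sum nat_pow_mult assms)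
  finally show ?thesis .
qed

lemma gr_geom_telescope:
  assumes "g \<in> carrier G"
  shows "(frag_of g - frag_of \<one>) \<otimes>\<^bsub>group_ring G\<^esub> gr_geom G g k = frag_of (g [^] k) - frag_of \<one>"
proof -
  have "(frag_of g - frag_of \<one>) \<otimes>\<^bsub>group_ring G\<^esub> gr_geom G g k
      = (\<Sum>t<k. frag_of (g [^] Suc t) - frag_of (g [^] t))"
    unfolding gr_geom_def using assms by (simp add: gr_mult_sum gr_distribs m_comm)
  also have "\<dots> = frag_of (g [^] k) - frag_of (g [^] (0::nat))"
    by (rule sum_lessThan_telescope)
  finally show ?thesis by simp
qed

lemma gr_geom_mult_order:
  assumes g: "g \<in> carrier G" "g [^] n = \<one>"
  shows "gr_geom G g (n * m) = frag_cmul (int m) (gr_geom G g n)"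
proof (induction m)
  case (Suc m)
  have "gr_geom G g (n * Suc m) = gr_geom G g (n + n * m)" by simp
  also have "\<dots> = gr_geom G g n + gr_geom G g (n * m)"
    using assms by (simp only: gr_geom_add) simp
  finally show ?case using Suc by (simp add: frag_cmul_distrib)
qed simp

text \<open>Each full turn around the cyclic group contributes one norm element
  \<open>gr_geom G g n\<close>. With \<open>m = k + l\<close> the number of turns is the carry that
  appears as the coefficient of x_i^2 in degree 2.\<close>

lemma gr_geom_eq_mod:
  assumes g: "g \<in> carrier G" "g [^] n = \<one>"
  shows "gr_geom G g m = frag_cmul (int (m div n)) (gr_geom G g n) + gr_geom G g (m mod n)"
proof -
  have "gr_geom G g m = gr_geom G g (n * (m div n) + m mod n)" by simp
  also have "\<dots> = gr_geom G g (n * (m div n)) + gr_geom G g (m mod n)"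
    using assms by (simp only: gr_geom_add nat_pow_pow[symmetric]) simp
  finally show ?thesis by (simp only: gr_geom_mult_order[OF g])
qed

end

section \<open>Free modules over the group ring\<close>

context
  fixes G :: "('g, 'x) monoid_scheme" (structure)
begin

lemma free_mod_sel [simp]:
  "\<zero>\<^bsub>free_mod G B\<^esub> = 0" "f \<oplus>\<^bsub>free_mod G B\<^esub> f' = f + f'" "r \<odot>\<^bsub>free_mod G B\<^esub> f = gr_scale G r f"
  by (simp_all add: free_mod_def)

lemma carrier_free_mod:
  "carrier (free_mod G B) = {f. Poly_Mapping.keys f \<subseteq> B \<and>
    (\<forall>b. Poly_Mapping.lookup f b \<in> carrier (group_ring G))}"
  by (simp add: free_mod_def)

lemma free_mod_mono:
  "f \<in> carrier (free_mod G B) \<Longrightarrow> B \<subseteq> B' \<Longrightarrow> f \<in> carrier (free_mod G B')"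
  by (auto simp: carrier_free_mod)

lemma free_mod_UNIV:
  "f \<in> carrier (free_mod G B) \<Longrightarrow> f \<in> carrier (free_mod G UNIV)"
  by (auto simp: carrier_free_mod)

lemma free_mod_zero_closed [simp]: "0 \<in> carrier (free_mod G B)"
  by (simp add: carrier_free_mod)

lemma free_mod_add_closed [simp]:
  "\<lbrakk>f \<in> carrier (free_mod G B); f' \<in> carrier (free_mod G B)\<rbrakk> \<Longrightarrow> f + f' \<in> carrier (free_mod G B)"
  using keys_add[of f f'] by (auto simp: carrier_free_mod lookup_add)

lemma free_mod_uminus_closed [simp]:
  "f \<in> carrier (free_mod G B) \<Longrightarrow> - f \<in> carrier (free_mod G B)"
  by (auto simp: carrier_free_mod in_keys_iff)

lemma free_mod_diff_closed [simp]:
  "\<lbrakk>f \<in> carrier (free_mod G B); f' \<in> carrier (free_mod G B)\<rbrakk> \<Longrightarrow> f - f' \<in> carrier (free_mod G B)"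
  using free_mod_add_closed[of f B "- f'"] by simp

lemma free_mod_sum_closed:
  "(\<And>i. i \<in> A \<Longrightarrow> f i \<in> carrier (free_mod G B)) \<Longrightarrow> sum f A \<in> carrier (free_mod G B)"
  by (induction A rule: infinite_finite_induct) auto

lemma single_closed:
  assumes "b \<in> B" "c \<in> carrier (group_ring G)"
  shows "Poly_Mapping.single b c \<in> carrier (free_mod G B)"
  using assms by (auto simp: carrier_free_mod lookup_single when_def)

lemma lookup_gr_scale:
  "Poly_Mapping.lookup (gr_scale G r f) b = r \<otimes>\<^bsub>group_ring G\<^esub> Poly_Mapping.lookup f b"
  unfolding gr_scale_def by (simp add: Poly_Mapping.map.rep_eq when_def)

lemma gr_scale_single [simp]:
  "gr_scale G r (Poly_Mapping.single b c) = Poly_Mapping.single b (r \<otimes>\<^bsub>group_ring G\<^esub> c)"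
  by (rule poly_mapping_eqI) (simp add: lookup_gr_scale lookup_single when_def)

lemma additive_scale_left: "additive (\<lambda>r. gr_scale G r f)"
  by unfold_locales (rule poly_mapping_eqI, simp add: lookup_gr_scale lookup_add gr_distribs)

lemma additive_scale_right: "additive (gr_scale G r)"
  by unfold_locales (rule poly_mapping_eqI, simp add: lookup_gr_scale lookup_add gr_distribs)

lemmas gr_scale_distribs =
  additive.add[OF additive_scale_left] additive.add[OF additive_scale_right]
  additive.diff[OF additive_scale_left] additive.diff[OF additive_scale_right]
  additive.minus[OF additive_scale_left] additive.minus[OF additive_scale_right]

lemmas gr_scale_zero [simp] =
  additive.zero[OF additive_scale_left] additive.zero[OF additive_scale_right]

lemmas gr_scale_sum =
  additive.sum[OF additive_scale_left] additive.sum[OF additive_scale_right]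

text \<open>The R-linear map with prescribed values on the basis. Both differentials and all
  components of the comparison map are built this way, while the homotopies use
  \<open>pm_ext\<close> directly.\<close>

definition lin :: "('b \<Rightarrow> 'c \<Rightarrow>\<^sub>0 'g \<Rightarrow>\<^sub>0 int) \<Rightarrow> ('b \<Rightarrow>\<^sub>0 'g \<Rightarrow>\<^sub>0 int) \<Rightarrow> ('c \<Rightarrow>\<^sub>0 'g \<Rightarrow>\<^sub>0 int)" where
  "lin \<phi> = pm_ext (\<lambda>b c. gr_scale G c (\<phi> b))"

lemma additive_lin: "additive (lin \<phi>)"
  unfolding lin_def by (rule additive_pm_ext) (rule additive_scale_left)

lemma lin_single [simp]: "lin \<phi> (Poly_Mapping.single b c) = gr_scale G c (\<phi> b)"
  unfolding lin_def by (simp add: pm_ext_single)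

end

text \<open>As an abelian group the free module is generated by the elements g b with g in G and b
  in the basis. This is the test for maps that are merely additive; for R-linear ones
  \<open>lin_eqI\<close> looks at the basis only.\<close>

lemma free_mod_eqI_frag:
  fixes G (structure)
  assumes f: "f \<in> carrier (free_mod G B)" and F: "additive F" and H: "additive H"
    and eq: "\<And>b g. \<lbrakk>b \<in> B; g \<in> carrier G\<rbrakk> \<Longrightarrow>
      F (Poly_Mapping.single b (frag_of g)) = H (Poly_Mapping.single b (frag_of g))"
  shows "F f = H f"
proof (rule additive_eqI_single[OF F H])
  fix b assume "b \<in> Poly_Mapping.keys f"
  then have b: "b \<in> B" using f by (auto simp: carrier_free_mod)
  show "F (Poly_Mapping.single b (Poly_Mapping.lookup f b)) = H (Poly_Mapping.single b (Poly_Mapping.lookup f b))"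
    by (rule additive_eqI_frag[OF _ additive_comp[OF F additive_single] additive_comp[OF H additive_single],
          where S = "carrier G"])
      (use f b eq in \<open>auto simp: carrier_free_mod carrier_group_ring\<close>)
qed

context comm_group
begin

lemma gr_scale_closed [simp]:
  "\<lbrakk>r \<in> carrier (group_ring G); f \<in> carrier (free_mod G B)\<rbrakk> \<Longrightarrow> gr_scale G r f \<in> carrier (free_mod G B)"
  by (auto simp: carrier_free_mod lookup_gr_scale in_keys_iff) (metis gr_mult_zero(2) in_keys_iff subsetD)

lemma gr_scale_scale:
  assumes "r \<in> carrier (group_ring G)" "t \<in> carrier (group_ring G)" "f \<in> carrier (free_mod G B)"
  shows "gr_scale G r (gr_scale G t f) = gr_scale G (r \<otimes>\<^bsub>group_ring G\<^esub> t) f"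
  using assms
  by (intro poly_mapping_eqI) (auto simp: lookup_gr_scale group_ring_m_assoc carrier_free_mod)

lemma gr_scale_one [simp]:
  assumes "f \<in> carrier (free_mod G B)"
  shows "gr_scale G (frag_of \<one>) f = f"
  using assms by (intro poly_mapping_eqI) (auto simp: lookup_gr_scale carrier_free_mod)

lemma gr_basis_closed: "b \<in> B \<Longrightarrow> gr_basis G b \<in> carrier (free_mod G B)"
  by (simp add: gr_basis_def single_closed)

lemma gr_scale_basis:
  "c \<in> carrier (group_ring G) \<Longrightarrow> gr_scale G c (gr_basis G b) = Poly_Mapping.single b c"
  by (simp add: gr_basis_def)

lemma module_free_mod: "module (group_ring G) (free_mod G B)"
proof (intro moduleI cring_group_ring abelian_groupI)
  show "\<exists>y\<in>carrier (free_mod G B). y \<oplus>\<^bsub>free_mod G B\<^esub> x = \<zero>\<^bsub>free_mod G B\<^esub>"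
    if "x \<in> carrier (free_mod G B)" for x
    by (rule bexI[of _ "- x"]) (use that in auto)
qed (auto simp: add_ac gr_scale_distribs gr_scale_scale)

lemma lin_closed:
  assumes "f \<in> carrier (free_mod G B)" "\<And>b. b \<in> B \<Longrightarrow> \<phi> b \<in> carrier (free_mod G C)"
  shows "lin G \<phi> f \<in> carrier (free_mod G C)"
  unfolding lin_def pm_ext_def using assms
  by (intro free_mod_sum_closed gr_scale_closed) (auto simp: carrier_free_mod)

lemma lin_scale:
  assumes r: "r \<in> carrier (group_ring G)" and f: "f \<in> carrier (free_mod G B)"
    and \<phi>: "\<And>b. b \<in> B \<Longrightarrow> \<phi> b \<in> carrier (free_mod G C)"
  shows "lin G \<phi> (gr_scale G r f) = gr_scale G r (lin G \<phi> f)"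
  using f
  by (rule free_mod_eqI_frag) (auto intro!: additive_comp[OF additive_lin] additive_comp[OF additive_scale_right]
      additive_scale_right additive_lin simp: gr_scale_scale[OF r _ \<phi>])

lemma lin_basis:
  assumes "\<phi> b \<in> carrier (free_mod G C)"
  shows "lin G \<phi> (gr_basis G b) = \<phi> b"
  using assms by (simp add: gr_basis_def)

lemma module_map_lin:
  assumes "\<And>b. b \<in> B \<Longrightarrow> \<phi> b \<in> carrier (free_mod G C)"
  shows "module_map (group_ring G) (free_mod G B) (free_mod G C) (lin G \<phi>)"
  unfolding module_map_def hom_def
  using assms by (auto simp: lin_closed additive.add[OF additive_lin] intro!: lin_scale[of _ _ B _ C])

lemma lin_eqI:
  assumes f: "f \<in> carrier (free_mod G B)"
    and F: "additive F" "\<And>r x. \<lbrakk>r \<in> carrier (group_ring G); x \<in> carrier (free_mod G B)\<rbrakk> \<Longrightarrow>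
      F (gr_scale G r x) = gr_scale G r (F x)"
    and H: "additive H" "\<And>r x. \<lbrakk>r \<in> carrier (group_ring G); x \<in> carrier (free_mod G B)\<rbrakk> \<Longrightarrow>
      H (gr_scale G r x) = gr_scale G r (H x)"
    and eq: "\<And>b. b \<in> B \<Longrightarrow> F (gr_basis G b) = H (gr_basis G b)"
  shows "F f = H f"
proof (rule free_mod_eqI_frag[OF f F(1) H(1)])
  fix b g assume *: "b \<in> B" "g \<in> carrier G"
  then have "F (gr_scale G (frag_of g) (gr_basis G b)) = H (gr_scale G (frag_of g) (gr_basis G b))"
    by (simp add: F(2) H(2) eq gr_basis_closed)
  with * show "F (Poly_Mapping.single b (frag_of g)) = H (Poly_Mapping.single b (frag_of g))"
    by (simp add: gr_scale_basis)
qed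

text \<open>Scaling by \<open>gr_int G c\<close> is an integer multiple in disguise, so maps that do
  not respect the action of G still commute with it. The memberships ensure that the unit of the
  group ring acts as the identity on \<open>x\<close> and \<open>F x\<close>.\<close>

lemma additive_scale_int:
  assumes F: "additive F" and x: "x \<in> carrier (free_mod G B)" and Fx: "F x \<in> carrier (free_mod G C)"
  shows "F (gr_scale G (gr_int G c) x) = gr_scale G (gr_int G c) (F x)"
proof -
  have add1: "additive (\<lambda>p. F (gr_scale G p x))" "additive (\<lambda>p. gr_scale G p (F x))"
    by (intro additive_comp[OF F] additive_scale_left)+
  have "F (gr_scale G (gr_int G c) x) - gr_scale G (gr_int G c) (F x) = 0"
    by (rule additive_eq_0I_frag[where r = "gr_int G c" and S = "{\<one>}"])
      (use x Fx in \<open>auto intro!: additive_diff add1 simp: gr_int_def\<close>)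
  then show ?thesis by simp
qed

lemma gr_scale_int_uminus:
  "gr_scale G (gr_int G (- c)) f = - gr_scale G (gr_int G c) f"
  by (simp add: gr_int_def single_uminus gr_scale_distribs)

lemma gr_scale_int_1 [simp]:
  "f \<in> carrier (free_mod G B) \<Longrightarrow> gr_scale G (gr_int G 1) f = f"
  by (simp add: gr_int_def)

end

section \<open>A criterion for quasi-isomorphisms\<close>

lemma comm_group_subgroup:
  assumes "comm_group A" "subgroup H A"
  shows "comm_group (A\<lparr>carrier := H\<rparr>)"
proof -
  interpret comm_group A by fact
  show ?thesis
    by (rule group.group_comm_groupI[OF subgroup.subgroup_is_group[OF assms(2) group_axioms]])
      (use assms(2) in \<open>auto simp: m_comm subgroup.mem_carrier\<close>)
qed

text \<open>The hypotheses \<open>to\<close>, \<open>reflects\<close> and \<open>onto\<close> give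
  well-definedness, injectivity and surjectivity in turn. The induced map is written without
  representatives, in the same shape as \<open>homology_map\<close>.\<close>

lemma FactGroup_iso:
  assumes "comm_group A" "comm_group A'" and H: "subgroup H A" and H': "subgroup H' A'"
    and f: "f \<in> hom A A'"
    and to: "\<And>x. x \<in> H \<Longrightarrow> f x \<in> H'"
    and reflects: "\<And>x. \<lbrakk>x \<in> carrier A; f x \<in> H'\<rbrakk> \<Longrightarrow> x \<in> H"
    and onto: "\<And>y. y \<in> carrier A' \<Longrightarrow> \<exists>x\<in>carrier A. \<exists>h\<in>H'. y = h \<otimes>\<^bsub>A'\<^esub> f x"
  shows "(\<lambda>C. H' <#>\<^bsub>A'\<^esub> (f ` C)) \<in> iso (A Mod H) (A' Mod H')"
proof -
  interpret A: comm_group A by fact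
  interpret A': comm_group A' by fact
  interpret f: group_hom A A' f by unfold_locales (rule f)
  interpret H: normal H A using H by (rule A.subgroup_imp_normal)
  interpret H': normal H' A' using H' by (rule A'.subgroup_imp_normal)
  let ?F = "\<lambda>C. H' <#>\<^bsub>A'\<^esub> (f ` C)"
  \<comment> \<open>\<open>f\<close> sends \<open>H\<close> into \<open>H'\<close>, so its variation
    on a coset is absorbed by the factor \<open>H'\<close> and the product of sets is a single
    coset.\<close>
  have coset: "?F (H #>\<^bsub>A\<^esub> x) = H' #>\<^bsub>A'\<^esub> f x" if x: "x \<in> carrier A" for x
  proof (intro equalityI subsetI)
    fix y assume "y \<in> ?F (H #>\<^bsub>A\<^esub> x)"
    then obtain h' h where h: "h' \<in> H'" "h \<in> H" "y = h' \<otimes>\<^bsub>A'\<^esub> f (h \<otimes>\<^bsub>A\<^esub> x)"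
      by (auto simp: set_mult_def r_coset_def)
    then have "y = (h' \<otimes>\<^bsub>A'\<^esub> f h) \<otimes>\<^bsub>A'\<^esub> f x"
      using x by (simp add: A'.m_assoc)
    then show "y \<in> H' #>\<^bsub>A'\<^esub> f x"
      using h to by (auto simp: r_coset_def)
  next
    fix y assume "y \<in> H' #>\<^bsub>A'\<^esub> f x"
    then obtain h' where h: "h' \<in> H'" "y = h' \<otimes>\<^bsub>A'\<^esub> f x"
      by (auto simp: r_coset_def)
    moreover have "x \<in> H #>\<^bsub>A\<^esub> x"
      by (rule A.rcos_self[OF x H])
    ultimately show "y \<in> ?F (H #>\<^bsub>A\<^esub> x)"
      by (auto simp: set_mult_def)
  qed
  have same: "H' #>\<^bsub>A'\<^esub> y = H' #>\<^bsub>A'\<^esub> y' \<longleftrightarrow> y \<otimes>\<^bsub>A'\<^esub> inv\<^bsub>A'\<^esub> y' \<in> H'"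
    if "y \<in> carrier A'" "y' \<in> carrier A'" for y y'
  proof
    assume "H' #>\<^bsub>A'\<^esub> y = H' #>\<^bsub>A'\<^esub> y'"
    then have "y \<in> H' #>\<^bsub>A'\<^esub> y'" using A'.rcos_self[OF that(1) H'] by simp
    then obtain h where "h \<in> H'" "y = h \<otimes>\<^bsub>A'\<^esub> y'" by (auto simp: r_coset_def)
    then show "y \<otimes>\<^bsub>A'\<^esub> inv\<^bsub>A'\<^esub> y' \<in> H'" using that by (simp add: A'.m_assoc)
  next
    assume h: "y \<otimes>\<^bsub>A'\<^esub> inv\<^bsub>A'\<^esub> y' \<in> H'"
    then have "(y \<otimes>\<^bsub>A'\<^esub> inv\<^bsub>A'\<^esub> y') \<otimes>\<^bsub>A'\<^esub> y' \<in> H' #>\<^bsub>A'\<^esub> y'"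
      by (auto simp: r_coset_def)
    then have "y \<in> H' #>\<^bsub>A'\<^esub> y'" using that by (simp add: A'.m_assoc)
    then show "H' #>\<^bsub>A'\<^esub> y = H' #>\<^bsub>A'\<^esub> y'"
      using A'.repr_independence[OF _ that(2) H'] by blast
  qed
  have hom: "?F \<in> hom (A Mod H) (A' Mod H')"
    unfolding hom_def carrier_FactGroup
    by (auto simp: coset H.rcos_sum H'.rcos_sum)
  have inj: "inj_on ?F (carrier (A Mod H))"
  proof (rule inj_onI)
    fix C D assume "C \<in> carrier (A Mod H)" "D \<in> carrier (A Mod H)" and eq: "?F C = ?F D"
    then obtain x y where xy: "x \<in> carrier A" "y \<in> carrier A" "C = H #>\<^bsub>A\<^esub> x" "D = H #>\<^bsub>A\<^esub> y"
      by (auto simp: carrier_FactGroup)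
    with eq have "f x \<otimes>\<^bsub>A'\<^esub> inv\<^bsub>A'\<^esub> f y \<in> H'"
      using same by (simp add: coset)
    then have "f (x \<otimes>\<^bsub>A\<^esub> inv\<^bsub>A\<^esub> y) \<in> H'" using xy by simp
    then have h: "x \<otimes>\<^bsub>A\<^esub> inv\<^bsub>A\<^esub> y \<in> H" using xy reflects by simp
    then have "(x \<otimes>\<^bsub>A\<^esub> inv\<^bsub>A\<^esub> y) \<otimes>\<^bsub>A\<^esub> y \<in> H #>\<^bsub>A\<^esub> y"
      by (auto simp: r_coset_def)
    then have "x \<in> H #>\<^bsub>A\<^esub> y" using xy by (simp add: A.m_assoc)
    then show "C = D"
      using A.repr_independence[OF _ xy(2) H] xy by blast
  qed
  have "?F ` carrier (A Mod H) = carrier (A' Mod H')"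
  proof (intro equalityI subsetI)
    fix D assume "D \<in> carrier (A' Mod H')"
    then obtain y where y: "y \<in> carrier A'" "D = H' #>\<^bsub>A'\<^esub> y"
      by (auto simp: carrier_FactGroup)
    obtain x h where x: "x \<in> carrier A" "h \<in> H'" "y = h \<otimes>\<^bsub>A'\<^esub> f x"
      using onto[OF y(1)] by blast
    have "D = H' #>\<^bsub>A'\<^esub> f x"
      unfolding y(2) by (subst same) (use x y in \<open>auto simp: A'.m_assoc\<close>)
    then show "D \<in> ?F ` carrier (A Mod H)"
      using x(1) coset by (force simp: carrier_FactGroup)
  qed (use hom in \<open>auto simp: hom_def\<close>)
  with hom inj show ?thesis
    by (simp add: iso_def bij_betw_def)
qed

section \<open>Cycles, boundaries and maps on homology\<close>

lemma chain_complex_group_hom: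
  assumes "chain_complex R M d"
  shows "group_hom (add_monoid (M (Suc n))) (add_monoid (M n)) (d (Suc n))"
proof -
  have "comm_group (add_monoid (M k))" for k
    using assms unfolding chain_complex_def
    by (meson abelian_group.a_comm_group module.axioms(2))
  then show ?thesis
    using assms unfolding chain_complex_def module_map_def
    by (intro group_hom.intro group_hom_axioms.intro) (auto simp: comm_group_def)
qed

lemma
  assumes c: "chain_complex R M d"
  shows subgroup_cycles: "subgroup (cycles M d n) (add_monoid (M n))"
    and subgroup_boundaries: "subgroup (boundaries M d n) (add_monoid (M n))"
    and boundaries_subset_cycles: "boundaries M d n \<subseteq> cycles M d n"
proof -
  show "subgroup (cycles M d n) (add_monoid (M n))"
  proof (cases n)
    case 0
    then have "cycles M d n = carrier (add_monoid (M n))" by (auto simp: cycles_def)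
    then show ?thesis
      using group.subgroup_self[OF group_hom.axioms(2)[OF chain_complex_group_hom[OF c, of n]]] by simp
  next
    case (Suc m)
    then have "cycles M d n = kernel (add_monoid (M (Suc m))) (add_monoid (M m)) (d (Suc m))"
      by (auto simp: cycles_def kernel_def)
    then show ?thesis
      using group_hom.subgroup_kernel[OF chain_complex_group_hom[OF c, of m]] Suc by simp
  qed
  show "subgroup (boundaries M d n) (add_monoid (M n))"
    using group_hom.img_is_subgroup[OF chain_complex_group_hom[OF c, of n]]
    by (simp add: boundaries_def)
  show "boundaries M d n \<subseteq> cycles M d n"
    using c unfolding chain_complex_def module_map_def hom_def
    by (cases n) (auto simp: boundaries_def cycles_def)
qed

text \<open>Bijectivity on homology becomes a statement about elements through
  \<open>FactGroup_iso\<close>: \<open>reflects\<close> is injectivity, \<open>onto\<close>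
  surjectivity, and well-definedness comes from the chain map property.\<close>

lemma quasi_isomorphismI:
  assumes \<sigma>: "chain_map R M d N e \<sigma>"
    and reflects: "\<And>n z. \<lbrakk>z \<in> cycles M d n; \<sigma> n z \<in> boundaries N e n\<rbrakk> \<Longrightarrow> z \<in> boundaries M d n"
    and onto: "\<And>n w. w \<in> cycles N e n \<Longrightarrow>
      \<exists>z\<in>cycles M d n. \<exists>y\<in>boundaries N e n. w = y \<oplus>\<^bsub>N n\<^esub> \<sigma> n z"
  shows "quasi_isomorphism R M d N e \<sigma>"
proof -
  have c: "chain_complex R M d" "chain_complex R N e"
    and mm: "\<And>n. module_map R (M n) (N n) (\<sigma> n)"
    and comm: "\<And>n x. x \<in> carrier (M (Suc n)) \<Longrightarrow> e (Suc n) (\<sigma> (Suc n) x) = \<sigma> n (d (Suc n) x)"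
    using \<sigma> by (auto simp: chain_map_def)
  have "homology_map N e \<sigma> n \<in> iso (homology M d n) (homology N e n)" for n
  proof -
    have cg: "comm_group (add_monoid (M k))" "comm_group (add_monoid (N k))" for k
      using c unfolding chain_complex_def
      by (meson abelian_group.a_comm_group module.axioms(2))+
    have hom: "\<sigma> k \<in> hom (add_monoid (M k)) (add_monoid (N k))" for k
      using mm[of k] by (simp add: module_map_def)
    have \<sigma>0: "\<sigma> k \<zero>\<^bsub>M k\<^esub> = \<zero>\<^bsub>N k\<^esub>" for k
      using hom_one[OF hom, of k] cg[of k] by (simp add: comm_group_def)
    have cyc: "\<sigma> n z \<in> cycles N e n" if z: "z \<in> cycles M d n" for z
      using z hom[of n] comm[of z "n - 1"] \<sigma>0[of "n - 1"]
      by (cases n) (auto simp: cycles_def hom_def)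
    \<comment> \<open>The product of sets is taken here in the group of cycles, but in
      \<open>homology_map\<close> in all of \<open>N n\<close>. Both records share the
      multiplication, so unfolding \<open>set_mult_def\<close> identifies the two.\<close>
    have "(\<lambda>C. boundaries N e n <#>\<^bsub>add_monoid (N n)\<lparr>carrier := cycles N e n\<rparr>\<^esub> (\<sigma> n ` C)) \<in>
      iso (add_monoid (M n)\<lparr>carrier := cycles M d n\<rparr> Mod boundaries M d n)
          (add_monoid (N n)\<lparr>carrier := cycles N e n\<rparr> Mod boundaries N e n)"
    proof (rule FactGroup_iso)
      show "comm_group (add_monoid (M n)\<lparr>carrier := cycles M d n\<rparr>)"
        by (rule comm_group_subgroup[OF cg(1) subgroup_cycles[OF c(1)]])
      show "comm_group (add_monoid (N n)\<lparr>carrier := cycles N e n\<rparr>)"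
        by (rule comm_group_subgroup[OF cg(2) subgroup_cycles[OF c(2)]])
      show "subgroup (boundaries M d n) (add_monoid (M n)\<lparr>carrier := cycles M d n\<rparr>)"
        using cg by (intro group.subgroup_incl subgroup_boundaries[OF c(1)] subgroup_cycles[OF c(1)]
            boundaries_subset_cycles[OF c(1)]) (auto simp: comm_group_def)
      show "subgroup (boundaries N e n) (add_monoid (N n)\<lparr>carrier := cycles N e n\<rparr>)"
        using cg by (intro group.subgroup_incl subgroup_boundaries[OF c(2)] subgroup_cycles[OF c(2)]
            boundaries_subset_cycles[OF c(2)]) (auto simp: comm_group_def)
      show "\<sigma> n \<in> hom (add_monoid (M n)\<lparr>carrier := cycles M d n\<rparr>)
          (add_monoid (N n)\<lparr>carrier := cycles N e n\<rparr>)"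
        using hom[of n] cyc by (auto simp: hom_def cycles_def)
      show "\<sigma> n x \<in> boundaries N e n" if x: "x \<in> boundaries M d n" for x
        using x comm[of _ n, symmetric] hom[of "Suc n"] by (auto simp: boundaries_def hom_def)
      show "x \<in> boundaries M d n" if "x \<in> carrier (add_monoid (M n)\<lparr>carrier := cycles M d n\<rparr>)"
        "\<sigma> n x \<in> boundaries N e n" for x
        using that reflects by simp
    qed (use onto in simp)
    then show ?thesis
      by (simp add: homology_def homology_map_def[abs_def] set_mult_def)
  qed
  with \<sigma> show ?thesis by (simp add: quasi_isomorphism_def)
qed

section \<open>The normalized standard resolution is exact\<close>

text \<open>Two nested extensions, because a group element of the coefficient moves into the symbol
  and only its integer multiplicity remains as the new coefficient. The case of the unit is the
  normalization [1, g_1, ..., g_n] = 0.\<close>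

definition std_homotopy ::
  "('g, 'x) monoid_scheme \<Rightarrow> ('g list \<Rightarrow>\<^sub>0 'g \<Rightarrow>\<^sub>0 int) \<Rightarrow> ('g list \<Rightarrow>\<^sub>0 'g \<Rightarrow>\<^sub>0 int)" where
  "std_homotopy G = pm_ext (\<lambda>gs. pm_ext (\<lambda>g c.
     if g = \<one>\<^bsub>G\<^esub> then 0 else Poly_Mapping.single (g # gs) (gr_int G c)))"

lemma std_diff_eq_lin: "std_diff G n = lin G (std_diff_sym G)"
  by (rule ext) (simp add: std_diff_def lin_def pm_ext_def)

lemma additive_std_diff: "additive (std_diff G n)"
  by (simp add: std_diff_eq_lin additive_lin)

lemma additive_std_homotopy: "additive (std_homotopy G)"
  unfolding std_homotopy_def
  by (intro additive_pm_ext) (simp add: additive_def gr_int_def single_add)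

context comm_group
begin

lemma std_homotopy_single:
  "std_homotopy G (Poly_Mapping.single gs (frag_of g)) = (if g = \<one> then 0 else gr_basis G (g # gs))"
proof -
  have a: "additive (pm_ext (\<lambda>g c. if g = \<one> then 0 else Poly_Mapping.single (g # gs) (gr_int G c)))"
    by (intro additive_pm_ext) (simp add: additive_def gr_int_def single_add)
  have "std_homotopy G (Poly_Mapping.single gs (frag_of g))
      = pm_ext (\<lambda>g c. if g = \<one> then 0 else Poly_Mapping.single (g # gs) (gr_int G c)) (frag_of g)"
    unfolding std_homotopy_def by (rule pm_ext_single) (rule additive.zero[OF a])
  also have "\<dots> = (if g = \<one> then 0 else Poly_Mapping.single (g # gs) (gr_int G 1))"
    by (rule pm_ext_single) (simp add: gr_int_def)
  finally show ?thesis
    by (simp add: gr_basis_def gr_int_def)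
qed

lemma std_homotopy_sym:
  assumes "g \<in> carrier G"
  shows "std_homotopy G (gr_scale G (frag_of g) (std_sym G gs)) = std_sym G (g # gs)"
  using assms
  by (auto simp: std_sym_def gr_scale_basis std_homotopy_single additive.zero[OF additive_std_homotopy])

lemma carrier_std_mod: "carrier (std_mod G n) = carrier (free_mod G {gs. length gs = n \<and> set gs \<subseteq> carrier G - {\<one>}})"
  by (simp add: std_mod_def)

lemma std_sym_closed:
  assumes "set gs \<subseteq> carrier G" "length gs = n"
  shows "std_sym G gs \<in> carrier (std_mod G n)"
  using assms by (auto simp: std_mod_def std_sym_def intro!: gr_basis_closed)

lemma std_sym_UNIV [simp]: "std_sym G gs \<in> carrier (free_mod G UNIV)"
  by (auto simp: std_sym_def intro!: gr_basis_closed)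

lemma std_diff_sym_closed:
  assumes gs: "set gs \<subseteq> carrier G" "length gs = Suc n"
  shows "std_diff_sym G gs \<in> carrier (std_mod G n)"
proof -
  have "std_sym G (take (i - 1) gs @ [gs ! (i - 1) \<otimes> gs ! i] @ drop (i + 1) gs) \<in> carrier (std_mod G n)"
    if "i \<in> {1..<length gs}" for i
  proof (rule std_sym_closed)
    have "gs ! (i - 1) \<in> carrier G" "gs ! i \<in> carrier G"
      using that gs by (auto intro!: subsetD[OF gs(1) nth_mem])
    then show "set (take (i - 1) gs @ [gs ! (i - 1) \<otimes> gs ! i] @ drop (i + 1) gs) \<subseteq> carrier G"
      using gs(1) by (auto dest: in_set_takeD in_set_dropD)
    show "length (take (i - 1) gs @ [gs ! (i - 1) \<otimes> gs ! i] @ drop (i + 1) gs) = n"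
      using that gs(2) by (auto simp: min_def)
  qed
  moreover have "std_sym G (tl gs) \<in> carrier (std_mod G n)" "std_sym G (butlast gs) \<in> carrier (std_mod G n)"
    using gs by (auto intro!: std_sym_closed dest: in_set_butlastD list.set_sel(2)[rotated])
  moreover have "hd gs \<in> carrier G"
    using gs by (cases gs) auto
  ultimately show ?thesis
    unfolding std_diff_sym_def std_mod_def
    by (intro free_mod_add_closed free_mod_sum_closed gr_scale_closed) auto
qed

text \<open>This is d h + h d = 1 at \<open>g\<close> times the symbol \<open>gs\<close>. Prepending
  \<open>g\<close> turns the faces of \<open>gs\<close> into those of \<open>g # gs\<close> with
  index raised by one, hence with opposite sign; only the term that drops \<open>g\<close> from the
  symbol is left over.\<close>

lemma std_diff_sym_Cons:
  assumes g: "g \<in> carrier G" and gs: "set gs \<subseteq> carrier G" "gs \<noteq> []"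
  shows "std_diff_sym G (g # gs) =
    gr_scale G (frag_of g) (std_sym G gs) - std_homotopy G (gr_scale G (frag_of g) (std_diff_sym G gs))"
proof -
  define n where "n = length gs"
  define F where "F = (\<lambda>x. std_homotopy G (gr_scale G (frag_of g) x))"
  define face where "face = (\<lambda>i. take (i - 1) gs @ [gs ! (i - 1) \<otimes> gs ! i] @ drop (i + 1) gs)"
  define face' where "face' = (\<lambda>i. take (i - 1) (g # gs) @ [(g # gs) ! (i - 1) \<otimes> (g # gs) ! i] @ drop (i + 1) (g # gs))"
  have F: "additive F"
    unfolding F_def by (intro additive_comp[OF additive_std_homotopy] additive_scale_right)
  have F_sym: "F (std_sym G l) = std_sym G (g # l)" for l
    unfolding F_def by (rule std_homotopy_sym[OF g])
  have F_int: "F (gr_scale G (gr_int G c) (std_sym G l)) = gr_scale G (gr_int G c) (std_sym G (g # l))" for c l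
    by (subst additive_scale_int[OF F, where B = UNIV and C = UNIV]) (auto simp: F_sym)
  have hd: "hd gs \<in> carrier G" using gs by (cases gs) auto
  \<comment> \<open>The first term of the differential of \<open>gs\<close> has the coefficient
    \<open>hd gs\<close> instead of a sign. Multiplied by \<open>g\<close> it becomes the merged
    entry in face 1 of \<open>g # gs\<close>.\<close>
  have F_hd: "F (gr_scale G (frag_of (hd gs)) (std_sym G (tl gs))) = std_sym G ((g \<otimes> hd gs) # tl gs)"
    unfolding F_def using g hd
    by (subst gr_scale_scale[where B = UNIV]) (auto simp: std_homotopy_sym)
  have "F (std_diff_sym G gs) = std_sym G ((g \<otimes> hd gs) # tl gs)
      + (\<Sum>i\<in>{1..<n}. gr_scale G (gr_int G ((-1) ^ i)) (std_sym G (g # face i)))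
      + gr_scale G (gr_int G ((-1) ^ n)) (std_sym G (g # butlast gs))"
    unfolding std_diff_sym_def
    by (simp only: additive.add[OF F] additive.sum[OF F] F_int F_hd n_def face_def)
  moreover have "std_diff_sym G (g # gs) = gr_scale G (frag_of g) (std_sym G gs)
      + (\<Sum>i\<in>{1..<Suc n}. gr_scale G (gr_int G ((-1) ^ i)) (std_sym G (face' i)))
      + gr_scale G (gr_int G ((-1) ^ Suc n)) (std_sym G (g # butlast gs))"
    unfolding std_diff_sym_def n_def face'_def using gs(2) by simp
  moreover have "(\<Sum>i\<in>{1..<Suc n}. gr_scale G (gr_int G ((-1) ^ i)) (std_sym G (face' i))) =
      - std_sym G ((g \<otimes> hd gs) # tl gs)
      - (\<Sum>i\<in>{1..<n}. gr_scale G (gr_int G ((-1) ^ i)) (std_sym G (g # face i)))"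
  proof -
    have f1: "face' 1 = (g \<otimes> hd gs) # tl gs"
      using gs(2) by (cases gs) (auto simp: face'_def)
    have f2: "face' (Suc i) = g # face i" if "i \<in> {1..<n}" for i
      using that by (cases i) (auto simp: face'_def face_def)
    define f where "f = (\<lambda>i. gr_scale G (gr_int G ((-1) ^ i)) (std_sym G (face' i)))"
    have "sum f {1..<Suc n} = f 1 + sum f {Suc 1..<Suc n}"
      using gs(2) by (intro sum.atLeast_Suc_lessThan) (simp add: n_def)
    also have "sum f {Suc 1..<Suc n} = (\<Sum>i\<in>{1..<n}. f (Suc i))"
      by (rule sum.shift_bounds_Suc_ivl)
    also have "\<dots> = (\<Sum>i\<in>{1..<n}. - gr_scale G (gr_int G ((-1) ^ i)) (std_sym G (g # face i)))"
      by (rule sum.cong) (simp_all add: f_def f2 gr_scale_int_uminus)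
    finally show ?thesis
      using f1 by (simp add: f_def gr_scale_int_uminus gr_scale_int_1[OF std_sym_UNIV] sum_negf
          del: sum.op_ivl_Suc)
  qed
  ultimately show ?thesis
    unfolding F_def by (simp add: gr_scale_int_uminus)
qed

lemma std_diff_sym_singleton:
  "g \<in> carrier G \<Longrightarrow> std_diff_sym G [g] = Poly_Mapping.single [] (frag_of g - frag_of \<one>)"
  by (simp add: std_diff_sym_def std_sym_def gr_basis_def gr_int_def single_uminus gr_distribs single_diff)

text \<open>The symbol is 0 in the normalized complex, so its formal differential has to vanish as
  well. In \<open>std_diff_sym_Cons\<close> with \<open>g = \<one>\<close> the homotopy kills all
  terms of the differential of \<open>gs\<close> with integer coefficients and sends the remaining
  one back to \<open>gs\<close>.\<close>

lemma std_diff_sym_one_Cons: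
  assumes gs: "set gs \<subseteq> carrier G"
  shows "std_diff_sym G (\<one> # gs) = 0"
proof (cases "gs = []")
  case True
  then show ?thesis by (simp add: std_diff_sym_singleton)
next
  case False
  have h0: "std_homotopy G (std_sym G l) = 0" for l
    by (auto simp: std_sym_def std_homotopy_single gr_basis_def additive.zero[OF additive_std_homotopy])
  have hc: "std_homotopy G (gr_scale G (gr_int G c) (std_sym G l)) = 0" for c l
    by (subst additive_scale_int[OF additive_std_homotopy, where B = UNIV and C = UNIV]) (auto simp: h0)
  have "hd gs \<in> carrier G" using False gs by (cases gs) auto
  then have "std_homotopy G (std_diff_sym G gs) = std_sym G (hd gs # tl gs)"
    unfolding std_diff_sym_def
    by (simp only: additive.add[OF additive_std_homotopy] additive.sum[OF additive_std_homotopy]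
        hc std_homotopy_sym) simp
  moreover have "std_diff_sym G gs \<in> carrier (std_mod G (length gs - 1))"
    using False gs by (intro std_diff_sym_closed) auto
  ultimately show ?thesis
    using std_diff_sym_Cons[OF one_closed gs False] False
    by (simp add: std_mod_def gr_scale_one[OF std_sym_UNIV])
qed

lemma std_diff_basis:
  assumes "set gs \<subseteq> carrier G" "length gs = Suc n"
  shows "std_diff G m (gr_basis G gs) = std_diff_sym G gs"
  unfolding std_diff_eq_lin
  by (rule lin_basis) (rule std_diff_sym_closed[OF assms, unfolded std_mod_def])

lemma std_diff_sym_Cons_eq:
  assumes "set (g # gs) \<subseteq> carrier G" "\<one> \<notin> set gs"
  shows "std_diff G m (std_sym G (g # gs)) = std_diff_sym G (g # gs)"
  using assms
  by (auto simp: std_sym_def additive.zero[OF additive_std_diff] std_diff_sym_one_Cons std_diff_basis)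

text \<open>On a symbol with coefficient \<open>g\<close> this is \<open>std_diff_sym_Cons\<close>
  rearranged. The degree is positive because in degree 0 the composite d h sends k to k - 1, with
  the augmentation as defect.\<close>

lemma std_homotopy_identity:
  assumes "x \<in> carrier (std_mod G (Suc n))"
  shows "std_diff G (Suc (Suc n)) (std_homotopy G x) + std_homotopy G (std_diff G (Suc n) x) = x"
proof (rule free_mod_eqI_frag[OF assms[unfolded std_mod_def]])
  fix gs g assume gs: "gs \<in> {gs. length gs = Suc n \<and> set gs \<subseteq> carrier G - {\<one>}}" and g: "g \<in> carrier G"
  then have sym: "std_sym G gs = gr_basis G gs" by (auto simp: std_sym_def)
  have x: "Poly_Mapping.single gs (frag_of g) = gr_scale G (frag_of g) (std_sym G gs)"
    using g by (simp add: gr_scale_basis sym)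
  have "std_diff G (Suc (Suc n)) (std_homotopy G (Poly_Mapping.single gs (frag_of g))) = std_diff_sym G (g # gs)"
    unfolding x std_homotopy_sym[OF g] using gs g by (intro std_diff_sym_Cons_eq) auto
  moreover have "std_diff G (Suc n) (Poly_Mapping.single gs (frag_of g)) = gr_scale G (frag_of g) (std_diff_sym G gs)"
    by (simp add: std_diff_eq_lin)
  ultimately show "std_diff G (Suc (Suc n)) (std_homotopy G (Poly_Mapping.single gs (frag_of g)))
      + std_homotopy G (std_diff G (Suc n) (Poly_Mapping.single gs (frag_of g)))
      = Poly_Mapping.single gs (frag_of g)"
    using std_diff_sym_Cons[OF g, of gs] gs by (fastforce simp: x)
qed (intro additive_plus additive_comp[OF additive_std_diff] additive_comp[OF additive_std_homotopy]
      additive_std_homotopy additive_std_diff additive_id)+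

lemma std_homotopy_closed:
  assumes x: "x \<in> carrier (std_mod G n)"
  shows "std_homotopy G x \<in> carrier (std_mod G (Suc n))"
proof -
  have "pm_ext (\<lambda>g c. if g = \<one> then 0 else Poly_Mapping.single (g # gs) (gr_int G c)) r
      \<in> carrier (std_mod G (Suc n))"
    if "length gs = n" "set gs \<subseteq> carrier G - {\<one>}" "Poly_Mapping.keys r \<subseteq> carrier G" for gs r
    unfolding pm_ext_def std_mod_def using that
    by (intro free_mod_sum_closed) (auto intro!: single_closed)
  then show ?thesis
    unfolding std_homotopy_def pm_ext_def[of _ x] using x
    unfolding std_mod_def by (intro free_mod_sum_closed) (auto simp: carrier_free_mod[of G "{gs. length gs = n \<and> _ gs}"] carrier_group_ring)
qed

lemma std_diff_closed:
  assumes "x \<in> carrier (std_mod G (Suc n))"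
  shows "std_diff G m x \<in> carrier (std_mod G n)"
  using assms unfolding std_diff_eq_lin std_mod_def
  by (rule lin_closed) (use std_diff_sym_closed in \<open>auto simp: std_mod_def\<close>)

lemma std_diff_scale:
  assumes "r \<in> carrier (group_ring G)" "x \<in> carrier (std_mod G (Suc n))"
  shows "std_diff G m (gr_scale G r x) = gr_scale G r (std_diff G m x)"
  using assms unfolding std_diff_eq_lin std_mod_def
  by (rule lin_scale) (use std_diff_sym_closed in \<open>auto simp: std_mod_def\<close>)

text \<open>
  Since \<open>d h + h d = 1\<close> and the image of the homotopy \<open>h\<close> spans the next module, \<open>d d = 0\<close>
  follows by induction from \<open>d d h = d (1 - h d) = d - (1 - h d) d = h d d\<close>.
\<close>

lemma std_diff_diff:
  assumes "x \<in> carrier (std_mod G (Suc (Suc n)))"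
  shows "std_diff G (Suc n) (std_diff G (Suc (Suc n)) x) = 0"
  using assms
proof (induction n arbitrary: x)
  note add = additive.diff[OF additive_std_diff]
  have step: "std_diff G (Suc n) (std_diff G (Suc (Suc n)) x) = 0"
    if x: "x \<in> carrier (std_mod G (Suc (Suc n)))"
      and dhd: "\<And>y. y \<in> carrier (std_mod G (Suc n)) \<Longrightarrow>
        std_diff G (Suc n) (std_homotopy G (std_diff G (Suc n) y)) = std_diff G (Suc n) y" for n x
  proof (rule lin_eqI[OF x[unfolded std_mod_def], where H = "\<lambda>_. 0"])
    fix gs assume gs: "gs \<in> {gs. length gs = Suc (Suc n) \<and> set gs \<subseteq> carrier G - {\<one>}}"
    then obtain g gs' where gs': "gs = g # gs'" "g \<in> carrier G" "g \<noteq> \<one>" "\<one> \<notin> set gs'"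
      "set gs' \<subseteq> carrier G" "length gs' = Suc n"
      by (cases gs) auto
    define y where "y = gr_scale G (frag_of g) (std_sym G gs')"
    have y: "y \<in> carrier (std_mod G (Suc n))"
      unfolding y_def using gs' std_sym_closed[of gs' "Suc n"] by (simp add: std_mod_def)
    have b: "gr_basis G gs = std_homotopy G y"
      using gs' by (simp add: y_def std_homotopy_sym) (simp add: std_sym_def)
    have "std_diff G (Suc (Suc n)) (gr_basis G gs) = y - std_homotopy G (std_diff G (Suc n) y)"
      unfolding b using std_homotopy_identity[OF y] by (simp add: eq_diff_eq)
    then show "std_diff G (Suc n) (std_diff G (Suc (Suc n)) (gr_basis G gs)) = 0"
      by (simp add: add dhd[OF y])
  qed (auto intro: additive_comp[OF additive_std_diff] additive_std_diff additive_0
      simp: std_diff_scale[OF _ std_diff_closed] std_diff_scale simp flip: std_mod_def)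
  {
    case 0
    \<comment> \<open>In degree 0 the composite d h is not the identity but sends k to k - 1. The
      image of d is generated by differences of two group elements, on which the two corrections
      cancel.\<close>
    have "std_diff G (Suc 0) (std_homotopy G (std_diff G (Suc 0) y)) = std_diff G (Suc 0) y"
      if y: "y \<in> carrier (std_mod G (Suc 0))" for y
    proof (rule free_mod_eqI_frag[OF y[unfolded std_mod_def]])
      fix gs g assume "gs \<in> {gs. length gs = Suc 0 \<and> set gs \<subseteq> carrier G - {\<one>}}" and g: "g \<in> carrier G"
      then obtain g1 where g1: "gs = [g1]" "g1 \<in> carrier G"
        by (cases gs) auto
      have d: "std_diff G (Suc 0) (Poly_Mapping.single gs (frag_of g)) =
          Poly_Mapping.single [] (frag_of (g \<otimes> g1)) - Poly_Mapping.single [] (frag_of g)"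
        using g g1 by (simp add: std_diff_eq_lin std_diff_sym_singleton gr_scale_distribs single_diff)
      have dh: "std_diff G (Suc 0) (std_homotopy G (Poly_Mapping.single [] (frag_of k)))
          = Poly_Mapping.single [] (frag_of k) - Poly_Mapping.single [] (frag_of \<one>)"
        if k: "k \<in> carrier G" for k
      proof -
        have "std_homotopy G (Poly_Mapping.single [] (frag_of k)) = std_sym G [k]"
          by (simp add: std_homotopy_single std_sym_def)
        then show ?thesis
          using k by (simp add: std_diff_sym_Cons_eq std_diff_sym_singleton single_diff)
      qed
      show "std_diff G (Suc 0) (std_homotopy G (std_diff G (Suc 0) (Poly_Mapping.single gs (frag_of g))))
          = std_diff G (Suc 0) (Poly_Mapping.single gs (frag_of g))"
        unfolding d using g g1 by (simp add: additive.diff[OF additive_std_homotopy] add dh)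
    qed (intro additive_comp[OF additive_std_diff] additive_comp[OF additive_std_homotopy] additive_std_diff)+
    with 0 show ?case by (intro step)
  next
    case (Suc n)
    show ?case
    proof (rule step[OF Suc.prems])
      fix y assume y: "y \<in> carrier (std_mod G (Suc (Suc n)))"
      have "std_diff G (Suc (Suc n)) (std_homotopy G (std_diff G (Suc (Suc n)) y))
          = std_diff G (Suc (Suc n)) y - std_homotopy G (std_diff G (Suc n) (std_diff G (Suc (Suc n)) y))"
        using std_homotopy_identity[OF std_diff_closed[OF y], of "Suc (Suc n)"] by (simp add: eq_diff_eq)
      then show "std_diff G (Suc (Suc n)) (std_homotopy G (std_diff G (Suc (Suc n)) y))
          = std_diff G (Suc (Suc n)) y"
        by (simp add: Suc.IH[OF y] additive.zero[OF additive_std_homotopy])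
    qed
  }
qed

lemma module_map_std_diff:
  "module_map (group_ring G) (std_mod G (Suc n)) (std_mod G n) (std_diff G m)"
  unfolding std_diff_eq_lin std_mod_def
  by (rule module_map_lin) (use std_diff_sym_closed in \<open>auto simp: std_mod_def\<close>)

lemma chain_complex_std: "chain_complex (group_ring G) (std_mod G) (std_diff G)"
  unfolding chain_complex_def
  by (auto simp: module_map_std_diff std_diff_diff) (simp_all add: std_mod_def module_free_mod)

lemma std_exact:
  assumes "z \<in> cycles (std_mod G) (std_diff G) (Suc n)"
  shows "z \<in> boundaries (std_mod G) (std_diff G) (Suc n)"
proof -
  have z: "z \<in> carrier (std_mod G (Suc n))" "std_diff G (Suc n) z = 0"
    using assms by (auto simp: cycles_def std_mod_def)
  have "z = std_diff G (Suc (Suc n)) (std_homotopy G z)"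
    using std_homotopy_identity[OF z(1)] by (simp add: z(2) additive.zero[OF additive_std_homotopy])
  then show ?thesis
    using std_homotopy_closed[OF z(1)] by (auto simp: boundaries_def)
qed

end

section \<open>Products of finite cyclic groups\<close>

text \<open>The hypotheses of the theorem. The orders of the factors are called \<open>od\<close>
  because \<open>ord\<close> denotes the order of an element of a group.\<close>

locale cyclic_product =
  fixes s :: nat
    and Gf :: "nat \<Rightarrow> 'a monoid"
    and b :: "nat \<Rightarrow> 'a"
    and od :: "nat \<Rightarrow> nat"
    and G :: "(nat \<Rightarrow> 'a) monoid" (structure)
    and a :: "nat \<Rightarrow> (nat \<Rightarrow> 'a)"
  assumes factor_group: "\<And>i. i \<in> {1..s} \<Longrightarrow> group (Gf i)"
    and factor_gen: "\<And>i. i \<in> {1..s} \<Longrightarrow> b i \<in> carrier (Gf i)"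
    and factor_cyclic: "\<And>i. i \<in> {1..s} \<Longrightarrow> carrier (Gf i) = generate (Gf i) {b i}"
    and factor_finite: "\<And>i. i \<in> {1..s} \<Longrightarrow> finite (carrier (Gf i))"
    and factor_order: "\<And>i. i \<in> {1..s} \<Longrightarrow> order (Gf i) = od i"
    and G_eq: "G = product_group {1..s} Gf"
    and a_eq: "\<And>i. i \<in> {1..s} \<Longrightarrow>
                 a i = (\<lambda>j\<in>{1..s}. if j = i then b i else \<one>\<^bsub>Gf j\<^esub>)"
begin

abbreviation gpow :: "nat \<Rightarrow> nat \<Rightarrow> 'a" where "gpow i k \<equiv> b i [^]\<^bsub>Gf i\<^esub> k"

text \<open>The discrete logarithm to the base \<open>b i\<close>. On the \<open>i\<close>-th factor
  the least exponent lies below \<open>od i\<close>, so it recovers the exponents of the theorem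
  from the group elements.\<close>

definition dlog :: "nat \<Rightarrow> 'a \<Rightarrow> nat" where "dlog i x = (LEAST k. gpow i k = x)"

context
  fixes i assumes i: "i \<in> {1..s}"
begin

interpretation Gi: group "Gf i" using factor_group i by simp

lemma od_pos: "od i > 0"
  using i factor_finite factor_order[OF i] by (metis Gi.order_gt_0_iff_finite)

lemma gpow_closed [simp]: "gpow i k \<in> carrier (Gf i)"
  using factor_gen i by simp

lemma gpow_od [simp]: "gpow i (od i) = \<one>\<^bsub>Gf i\<^esub>"
  using Gi.pow_order_eq_1[OF factor_gen[OF i]] factor_order[OF i] by simp

lemma gpow_mod: "gpow i (k mod od i) = gpow i k"
proof -
  have "gpow i k = gpow i (od i * (k div od i) + k mod od i)" by simp
  also have "\<dots> = gpow i (od i * (k div od i)) \<otimes>\<^bsub>Gf i\<^esub> gpow i (k mod od i)"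
    by (rule Gi.nat_pow_mult[OF factor_gen[OF i], symmetric])
  also have "gpow i (od i * (k div od i)) = \<one>\<^bsub>Gf i\<^esub>"
    by (simp add: Gi.nat_pow_pow[OF factor_gen[OF i], symmetric])
  finally show ?thesis by simp
qed

lemma ord_gen: "group.ord (Gf i) (b i) = od i"
  using Gi.generate_pow_card[OF factor_gen[OF i]] factor_order[OF i] factor_cyclic[OF i]
  by (simp add: order_def)

lemma gpow_inj: "\<lbrakk>gpow i k = gpow i l; k < od i; l < od i\<rbrakk> \<Longrightarrow> k = l"
  using Gi.ord_inj[OF factor_gen[OF i]] unfolding ord_gen inj_on_def by auto

lemma factor_elem: "x \<in> carrier (Gf i) \<Longrightarrow> \<exists>k. x = gpow i k"
  using Gi.generate_pow_on_finite_carrier[OF factor_finite[OF i] factor_gen[OF i]] factor_cyclic[OF i]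
  by auto

lemma gpow_dlog:
  assumes "x \<in> carrier (Gf i)"
  shows "gpow i (dlog i x) = x"
  using factor_elem[OF assms] unfolding dlog_def by (metis (mono_tags) LeastI)

lemma dlog_less:
  assumes "x \<in> carrier (Gf i)"
  shows "dlog i x < od i"
proof -
  obtain k where "x = gpow i (k mod od i)" using factor_elem[OF assms] gpow_mod by auto
  then have "dlog i x \<le> k mod od i" unfolding dlog_def by (intro Least_le) simp
  also have "\<dots> < od i" using od_pos by simp
  finally show ?thesis .
qed

lemma dlog_gpow: "k < od i \<Longrightarrow> dlog i (gpow i k) = k"
  by (rule gpow_inj) (simp_all add: gpow_dlog dlog_less)

lemma dlog_one [simp]: "dlog i \<one>\<^bsub>Gf i\<^esub> = 0"
  using dlog_gpow[of 0] od_pos by simp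

lemma dlog_mult:
  assumes "x \<in> carrier (Gf i)" "y \<in> carrier (Gf i)"
  shows "dlog i (x \<otimes>\<^bsub>Gf i\<^esub> y) = (dlog i x + dlog i y) mod od i"
proof -
  have "x \<otimes>\<^bsub>Gf i\<^esub> y = gpow i (dlog i x) \<otimes>\<^bsub>Gf i\<^esub> gpow i (dlog i y)"
    by (simp add: gpow_dlog assms)
  also have "\<dots> = gpow i ((dlog i x + dlog i y) mod od i)"
    by (simp add: Gi.nat_pow_mult factor_gen[OF i] gpow_mod)
  finally show ?thesis using od_pos by (simp add: dlog_gpow)
qed

text \<open>Both products have the same discrete logarithm, a sum of two exponents modulo
  \<open>od i\<close>.\<close>

lemma factor_comm:
  assumes "x \<in> carrier (Gf i)" "y \<in> carrier (Gf i)"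
  shows "x \<otimes>\<^bsub>Gf i\<^esub> y = y \<otimes>\<^bsub>Gf i\<^esub> x"
proof -
  have "x \<otimes>\<^bsub>Gf i\<^esub> y = gpow i (dlog i (x \<otimes>\<^bsub>Gf i\<^esub> y))"
    by (simp add: gpow_dlog assms)
  also have "\<dots> = gpow i (dlog i (y \<otimes>\<^bsub>Gf i\<^esub> x))"
    by (simp add: dlog_mult assms add.commute)
  finally show ?thesis by (simp add: gpow_dlog assms)
qed

lemma factor_simps [simp]:
  "\<one>\<^bsub>Gf i\<^esub> \<in> carrier (Gf i)"
  "x \<in> carrier (Gf i) \<Longrightarrow> \<one>\<^bsub>Gf i\<^esub> \<otimes>\<^bsub>Gf i\<^esub> x = x"
  "x \<in> carrier (Gf i) \<Longrightarrow> x \<otimes>\<^bsub>Gf i\<^esub> \<one>\<^bsub>Gf i\<^esub> = x"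
  "\<lbrakk>x \<in> carrier (Gf i); y \<in> carrier (Gf i)\<rbrakk> \<Longrightarrow> x \<otimes>\<^bsub>Gf i\<^esub> y \<in> carrier (Gf i)"
  "gpow i 0 = \<one>\<^bsub>Gf i\<^esub>"
  by simp_all

lemma gpow_Suc: "b i \<otimes>\<^bsub>Gf i\<^esub> gpow i k = gpow i (Suc k)"
  using Gi.nat_pow_Suc2[OF factor_gen[OF i]] by simp

end

section \<open>Coordinates in the product group\<close>

lemma carrier_G: "carrier G = (\<Pi>\<^sub>E i\<in>{1..s}. carrier (Gf i))"
  by (simp add: G_eq)

lemma mult_G: "x \<otimes> y = (\<lambda>i\<in>{1..s}. x i \<otimes>\<^bsub>Gf i\<^esub> y i)"
  by (simp add: G_eq)

lemma one_G: "\<one> = (\<lambda>i\<in>{1..s}. \<one>\<^bsub>Gf i\<^esub>)"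
  by (simp add: G_eq)

sublocale comm_group G
proof (rule group.group_comm_groupI)
  show "group G" unfolding G_eq by (rule product_group) (rule factor_group)
  show "x \<otimes> y = y \<otimes> x" if "x \<in> carrier G" "y \<in> carrier G" for x y
    using that by (auto simp: mult_G carrier_G PiE_iff factor_comm intro!: restrict_ext)
qed

lemma coord_closed [simp]: "\<lbrakk>x \<in> carrier G; i \<in> {1..s}\<rbrakk> \<Longrightarrow> x i \<in> carrier (Gf i)"
  by (auto simp: carrier_G)

lemma G_eqI:
  "\<lbrakk>x \<in> carrier G; y \<in> carrier G; \<And>i. i \<in> {1..s} \<Longrightarrow> x i = y i\<rbrakk> \<Longrightarrow> x = y"
  unfolding carrier_G by (rule PiE_ext)

lemma G_mult_coord [simp]: "i \<in> {1..s} \<Longrightarrow> (x \<otimes> y) i = x i \<otimes>\<^bsub>Gf i\<^esub> y i"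
  by (simp add: mult_G)

lemma G_one_coord [simp]: "i \<in> {1..s} \<Longrightarrow> \<one> i = \<one>\<^bsub>Gf i\<^esub>"
  by (simp add: one_G)

lemma a_closed [simp]: "i \<in> {1..s} \<Longrightarrow> a i \<in> carrier G"
  by (auto simp: a_eq carrier_G factor_gen)

lemma a_pow_coord:
  assumes i: "i \<in> {1..s}" and j: "j \<in> {1..s}"
  shows "(a i [^] k) j = (if j = i then gpow i k else \<one>\<^bsub>Gf j\<^esub>)"
proof (induction k)
  case 0
  then show ?case using assms by simp
next
  case (Suc k)
  interpret Gj: group "Gf j" using factor_group j by simp
  have "(a i [^] Suc k) j = (a i [^] k) j \<otimes>\<^bsub>Gf j\<^esub> a i j"
    using assms by simp
  then show ?case using Suc assms by (auto simp: a_eq nat_pow_Suc)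
qed

declare nat_pow_Suc [simp del] Group.nat_pow_Suc [simp del]

lemma a_pow_od [simp]: "i \<in> {1..s} \<Longrightarrow> a i [^] od i = \<one>"
  by (rule G_eqI) (auto simp: a_pow_coord)

lemma upd_closed [simp]:
  "\<lbrakk>x \<in> carrier G; i \<in> {1..s}; y \<in> carrier (Gf i)\<rbrakk> \<Longrightarrow> x(i := y) \<in> carrier G"
  by (auto simp: carrier_G PiE_iff extensional_def)

lemma upd_gpow:
  assumes "x \<in> carrier G" "i \<in> {1..s}"
  shows "x(i := gpow i k) = a i [^] k \<otimes> x(i := \<one>\<^bsub>Gf i\<^esub>)"
  by (rule G_eqI) (use assms in \<open>auto simp: a_pow_coord\<close>)

lemma upd_same_gpow:
  assumes "x \<in> carrier G" "i \<in> {1..s}"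
  shows "x(i := gpow i (dlog i (x i))) = x"
  using assms by (simp add: gpow_dlog)

text \<open>The new exponent is left unreduced: when it reaches \<open>od i\<close>,
  \<open>gpow\<close> itself wraps around to the unit. This wrap-around is the case distinction in
  \<open>eta_homotopy_odd\<close>.\<close>

lemma a_mult_eq_upd:
  assumes "x \<in> carrier G" "i \<in> {1..s}"
  shows "a i \<otimes> x = x(i := gpow i (Suc (dlog i (x i))))"
proof (rule G_eqI)
  fix j assume j: "j \<in> {1..s}"
  have "b i \<otimes>\<^bsub>Gf i\<^esub> x i = gpow i (Suc (dlog i (x i)))"
    using assms gpow_Suc[of i "dlog i (x i)"] by (simp add: gpow_dlog)
  with j show "(a i \<otimes> x) j = (x(i := gpow i (Suc (dlog i (x i))))) j"
    using assms by (simp add: a_eq)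
qed (use assms in auto)


section \<open>Contracting homotopies for the factors\<close>

text \<open>The augmentation of the \<open>i\<close>-th factor, extended linearly over the other
  factors.\<close>

definition proj :: "nat \<Rightarrow> ((nat \<Rightarrow> 'a) \<Rightarrow>\<^sub>0 int) \<Rightarrow> ((nat \<Rightarrow> 'a) \<Rightarrow>\<^sub>0 int)" where
  "proj i = frag_extend (\<lambda>g. frag_of (g(i := \<one>\<^bsub>Gf i\<^esub>)))"

text \<open>
  The contracting homotopy of the periodic resolution of the \<open>i\<close>-th factor, from degree \<open>k\<close> to
  degree \<open>k + 1\<close>, extended linearly over the other factors: \<open>a\<^sub>i ^ m\<close> is sent to
  \<open>1 + a\<^sub>i + \<dots> + a\<^sub>i ^ (m - 1)\<close> for even \<open>k\<close>, and for odd \<open>k\<close> to \<open>1\<close> if \<open>m\<close> is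
  the last exponent and to \<open>0\<close> otherwise.
\<close>

definition eta :: "nat \<Rightarrow> nat \<Rightarrow> ((nat \<Rightarrow> 'a) \<Rightarrow>\<^sub>0 int) \<Rightarrow> ((nat \<Rightarrow> 'a) \<Rightarrow>\<^sub>0 int)" where
  "eta i k = frag_extend (\<lambda>g.
     if even k then (\<Sum>t<dlog i (g i). frag_of (g(i := gpow i t)))
     else if Suc (dlog i (g i)) = od i then frag_of (g(i := \<one>\<^bsub>Gf i\<^esub>)) else 0)"

abbreviation coef :: "nat \<Rightarrow> nat \<Rightarrow> ((nat \<Rightarrow> 'a) \<Rightarrow>\<^sub>0 int)" where
  "coef i k \<equiv> poly_coeff G (a i) (od i) k"

lemma additive_frag_extend: "additive (frag_extend \<phi>)"
  by unfold_locales (rule frag_extend_add)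

lemma additive_proj: "additive (proj i)"
  unfolding proj_def by (rule additive_frag_extend)

lemma additive_eta: "additive (eta i k)"
  unfolding eta_def by (rule additive_frag_extend)

lemma frag_extend_closed:
  assumes "r \<in> carrier (group_ring G)" "\<And>g. g \<in> carrier G \<Longrightarrow> \<phi> g \<in> carrier (group_ring G)"
  shows "frag_extend \<phi> r \<in> carrier (group_ring G)"
  using keys_frag_extend[of \<phi> r] assms unfolding carrier_group_ring mem_Collect_eq by blast

lemma proj_closed [simp]:
  "\<lbrakk>i \<in> {1..s}; r \<in> carrier (group_ring G)\<rbrakk> \<Longrightarrow> proj i r \<in> carrier (group_ring G)"
  unfolding proj_def by (rule frag_extend_closed) auto

lemma eta_closed [simp]:
  "\<lbrakk>i \<in> {1..s}; r \<in> carrier (group_ring G)\<rbrakk> \<Longrightarrow> eta i k r \<in> carrier (group_ring G)"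
  unfolding eta_def by (rule frag_extend_closed) (auto intro!: group_ring_sum_closed)

lemma coef_closed [simp]: "i \<in> {1..s} \<Longrightarrow> coef i k \<in> carrier (group_ring G)"
  by (auto simp: poly_coeff_def)

lemma coef_0 [simp]: "coef i 0 = 0"
  by (simp add: poly_coeff_def)

lemma eta_even_frag:
  "even k \<Longrightarrow> eta i k (frag_of g) = (\<Sum>t<dlog i (g i). frag_of (g(i := gpow i t)))"
  by (simp add: eta_def)

lemma eta_odd_frag:
  "odd k \<Longrightarrow> eta i k (frag_of g) =
    (if Suc (dlog i (g i)) = od i then frag_of (g(i := \<one>\<^bsub>Gf i\<^esub>)) else 0)"
  by (simp add: eta_def)

lemma eta_upd_gpow:
  assumes "i \<in> {1..s}" "even k" "m < od i"
  shows "eta i k (frag_of (g(i := gpow i m))) = (\<Sum>t<m. frag_of (g(i := gpow i t)))"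
  using assms by (simp add: eta_even_frag dlog_gpow)

text \<open>Multiplying 1 + a_i + ... + a_i^(m-1) by a_i - 1 telescopes to a_i^m - 1, and the final
  1 is the augmentation \<open>proj\<close>. For \<open>k = 0\<close> this is the contraction at the
  end of the resolution of one factor.\<close>

lemma a_minus_one_mult_eta:
  assumes i: "i \<in> {1..s}" and r: "r \<in> carrier (group_ring G)" and k: "even k"
  shows "(frag_of (a i) - frag_of \<one>) \<otimes>\<^bsub>group_ring G\<^esub> eta i k r = r - proj i r"
proof (rule additive_eqI_frag[where S = "carrier G" and r = r])
  fix g assume g: "g \<in> carrier G"
  have *: "a i \<otimes> g(i := gpow i t) = g(i := gpow i (Suc t))" if "t < od i" for t
    using i g that by (subst a_mult_eq_upd) (auto simp: dlog_gpow)
  have "(frag_of (a i) - frag_of \<one>) \<otimes>\<^bsub>group_ring G\<^esub> eta i k (frag_of g)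
      = (\<Sum>t<dlog i (g i). frag_of (g(i := gpow i (Suc t))) - frag_of (g(i := gpow i t)))"
    unfolding eta_even_frag[OF k] gr_mult_sum
  proof (rule sum.cong)
    fix t assume "t \<in> {..<dlog i (g i)}"
    then have "t < od i" using dlog_less[OF i, of "g i"] g i by simp
    then show "(frag_of (a i) - frag_of \<one>) \<otimes>\<^bsub>group_ring G\<^esub> frag_of (g(i := gpow i t))
        = frag_of (g(i := gpow i (Suc t))) - frag_of (g(i := gpow i t))"
      using i g by (simp add: gr_distribs *)
  qed simp
  also have "\<dots> = frag_of (g(i := gpow i (dlog i (g i)))) - frag_of (g(i := gpow i 0))"
    by (rule sum_lessThan_telescope)
  finally show "(frag_of (a i) - frag_of \<one>) \<otimes>\<^bsub>group_ring G\<^esub> eta i k (frag_of g)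
      = frag_of g - proj i (frag_of g)"
    using g i by (simp add: proj_def upd_same_gpow)
qed (use r in \<open>auto simp: carrier_group_ring intro!: additive_comp[OF additive_mult_right] additive_eta
      additive_diff additive_id additive_proj\<close>)

text \<open>a_i^k - 1 is a multiple of a_i - 1, which annihilates the norm because a_i has order
  dividing \<open>od i\<close>.\<close>

lemma norm_mult_a_pow:
  fixes k :: nat
  assumes i: "i \<in> {1..s}"
  shows "gr_geom G (a i) (od i) \<otimes>\<^bsub>group_ring G\<^esub> frag_of (a i [^] k) = gr_geom G (a i) (od i)"
proof -
  let ?N = "gr_geom G (a i) (od i)"
  have "(frag_of (a i [^] k) - frag_of \<one>) \<otimes>\<^bsub>group_ring G\<^esub> ?N = 0"
  proof -
    have "(frag_of (a i [^] k) - frag_of \<one>) \<otimes>\<^bsub>group_ring G\<^esub> ?N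
        = (frag_of (a i) - frag_of \<one>) \<otimes>\<^bsub>group_ring G\<^esub> gr_geom G (a i) k \<otimes>\<^bsub>group_ring G\<^esub> ?N"
      using i by (simp add: gr_geom_telescope)
    also have "\<dots> = gr_geom G (a i) k \<otimes>\<^bsub>group_ring G\<^esub> ((frag_of (a i) - frag_of \<one>) \<otimes>\<^bsub>group_ring G\<^esub> ?N)"
      using i by (subst group_ring_m_comm[of "frag_of (a i) - frag_of \<one>"]) (auto simp: group_ring_m_assoc)
    also have "\<dots> = 0"
      using i by (simp add: gr_geom_telescope)
    finally show ?thesis .
  qed
  then show ?thesis
    using i by (simp add: gr_distribs group_ring_m_comm[of ?N])
qed

text \<open>The norm absorbs the \<open>i\<close>-th component of \<open>g\<close>, so the product
  is the sum over the whole coset of \<open>g\<close> modulo the \<open>i\<close>-th factor.\<close>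

lemma norm_mult_frag:
  assumes i: "i \<in> {1..s}" and g: "g \<in> carrier G"
  shows "gr_geom G (a i) (od i) \<otimes>\<^bsub>group_ring G\<^esub> frag_of g = (\<Sum>t< od i. frag_of (g(i := gpow i t)))"
proof -
  let ?h = "g(i := \<one>\<^bsub>Gf i\<^esub>)"
  have "g = a i [^] dlog i (g i) \<otimes> ?h"
    using upd_gpow[OF g i, of "dlog i (g i)"] upd_same_gpow[OF g i] by simp
  then have "gr_geom G (a i) (od i) \<otimes>\<^bsub>group_ring G\<^esub> frag_of g
      = gr_geom G (a i) (od i) \<otimes>\<^bsub>group_ring G\<^esub> (frag_of (a i [^] dlog i (g i)) \<otimes>\<^bsub>group_ring G\<^esub> frag_of ?h)"
    by simp
  also have "\<dots> = gr_geom G (a i) (od i) \<otimes>\<^bsub>group_ring G\<^esub> frag_of ?h"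
    using i g by (simp add: group_ring_m_assoc[symmetric] norm_mult_a_pow del: frag_of_mult)
  also have "\<dots> = (\<Sum>t< od i. frag_of (g(i := gpow i t)))"
    unfolding gr_geom_def using i g by (simp add: gr_mult_sum upd_gpow)
  finally show ?thesis .
qed

text \<open>If \<open>g\<close> has exponent m, the even homotopy has the terms 0, ..., m at a_i g
  and the terms 0, ..., m - 1 at g, with difference g. When a_i g wraps around, the first sum
  becomes empty and the norm times the odd homotopy supplies the same terms.\<close>

lemma eta_homotopy_odd:
  assumes i: "i \<in> {1..s}" and r: "r \<in> carrier (group_ring G)" and k: "even k" "odd l"
  shows "gr_geom G (a i) (od i) \<otimes>\<^bsub>group_ring G\<^esub> eta i l r
    + eta i k ((frag_of (a i) - frag_of \<one>) \<otimes>\<^bsub>group_ring G\<^esub> r) = r"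
proof (rule additive_eqI_frag[where S = "carrier G" and r = r])
  fix g assume g: "g \<in> carrier G"
  define m where "m = dlog i (g i)"
  have m: "m < od i" using dlog_less i g by (simp add: m_def)
  have g_eq: "g(i := gpow i m) = g" unfolding m_def using upd_same_gpow[OF g i] by simp
  have eg: "eta i k (frag_of g) = (\<Sum>t<m. frag_of (g(i := gpow i t)))"
    using k by (simp add: eta_even_frag m_def)
  have ag: "a i \<otimes> g = g(i := gpow i (Suc m))"
    using a_mult_eq_upd[OF g i] by (simp add: m_def)
  have "gr_geom G (a i) (od i) \<otimes>\<^bsub>group_ring G\<^esub> eta i l (frag_of g) + eta i k (frag_of (a i \<otimes> g))
      = (\<Sum>t<Suc m. frag_of (g(i := gpow i t)))"
  proof (cases "Suc m = od i")
    case True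
    have "eta i k (frag_of (a i \<otimes> g)) = 0"
      unfolding ag True using i k by (simp add: eta_even_frag)
    moreover have "eta i l (frag_of g) = frag_of (g(i := \<one>\<^bsub>Gf i\<^esub>))"
      using True k by (simp add: eta_odd_frag m_def)
    ultimately show ?thesis
      unfolding True using i g by (simp add: norm_mult_frag)
  next
    case False
    then have "Suc m < od i" using m by simp
    then have "eta i k (frag_of (a i \<otimes> g)) = (\<Sum>t<Suc m. frag_of (g(i := gpow i t)))"
      unfolding ag using i k by (subst eta_upd_gpow) auto
    moreover have "eta i l (frag_of g) = 0"
      using False k by (simp add: eta_odd_frag m_def)
    ultimately show ?thesis by simp
  qed
  then show "gr_geom G (a i) (od i) \<otimes>\<^bsub>group_ring G\<^esub> eta i l (frag_of g)
    + eta i k ((frag_of (a i) - frag_of \<one>) \<otimes>\<^bsub>group_ring G\<^esub> frag_of g) = frag_of g"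
    using g i g_eq by (simp add: gr_distribs additive.diff[OF additive_eta] eg add_diff_eq)
qed (use r in \<open>auto simp: carrier_group_ring intro!: additive_comp[OF additive_mult_right] additive_eta
      additive_plus additive_id additive_comp[OF additive_eta] additive_mult_right\<close>)

text \<open>The norm times \<open>g\<close> runs once through a coset, and the odd homotopy responds
  only to the last exponent, which yields \<open>proj\<close>. That is exactly the defect in
  \<open>a_minus_one_mult_eta\<close>.\<close>

lemma eta_homotopy_even:
  assumes i: "i \<in> {1..s}" and r: "r \<in> carrier (group_ring G)" and k: "even k" "odd l"
  shows "(frag_of (a i) - frag_of \<one>) \<otimes>\<^bsub>group_ring G\<^esub> eta i k r
    + eta i l (gr_geom G (a i) (od i) \<otimes>\<^bsub>group_ring G\<^esub> r) = r"
proof -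
  have "eta i l (gr_geom G (a i) (od i) \<otimes>\<^bsub>group_ring G\<^esub> r) = proj i r"
  proof (rule additive_eqI_frag[where S = "carrier G" and r = r])
    fix g assume g: "g \<in> carrier G"
    obtain m where m: "od i = Suc m" using od_pos[OF i] by (cases "od i") auto
    have "eta i l (gr_geom G (a i) (od i) \<otimes>\<^bsub>group_ring G\<^esub> frag_of g)
        = (\<Sum>t< od i. eta i l (frag_of (g(i := gpow i t))))"
      using g i by (simp add: norm_mult_frag additive.sum[OF additive_eta])
    also have "\<dots> = (\<Sum>t< od i. if t = m then frag_of (g(i := \<one>\<^bsub>Gf i\<^esub>)) else 0)"
      using k i m by (intro sum.cong) (auto simp: eta_odd_frag dlog_gpow)
    also have "\<dots> = proj i (frag_of g)"
      by (simp add: m proj_def)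
    finally show "eta i l (gr_geom G (a i) (od i) \<otimes>\<^bsub>group_ring G\<^esub> frag_of g) = proj i (frag_of g)" .
  qed (use r in \<open>auto simp: carrier_group_ring intro!: additive_comp[OF additive_eta] additive_mult_right
        additive_proj\<close>)
  then show ?thesis using a_minus_one_mult_eta[OF i r k(1)] by simp
qed

lemma coef_eta_0:
  assumes "i \<in> {1..s}" "r \<in> carrier (group_ring G)"
  shows "coef i 1 \<otimes>\<^bsub>group_ring G\<^esub> eta i 0 r = r - proj i r"
  using a_minus_one_mult_eta[OF assms] by (simp add: poly_coeff_def)

lemma coef_eta_Suc:
  assumes "i \<in> {1..s}" "r \<in> carrier (group_ring G)"
  shows "coef i (Suc (Suc k)) \<otimes>\<^bsub>group_ring G\<^esub> eta i (Suc k) r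
    + eta i k (coef i (Suc k) \<otimes>\<^bsub>group_ring G\<^esub> r) = r"
  using eta_homotopy_odd[OF assms, of k "Suc k"] eta_homotopy_even[OF assms, of "Suc k" k]
  by (auto simp: poly_coeff_def)

text \<open>The homotopy reads and changes the \<open>i\<close>-th component alone, so it commutes
  with group elements that are trivial there, and \<open>coef j l\<close> is a combination of such
  elements. This is what lets h_i anticommute with d_j.\<close>

lemma eta_coef_mult:
  assumes i: "i \<in> {1..s}" and j: "j \<in> {1..s}" "j \<noteq> i" and r: "r \<in> carrier (group_ring G)"
  shows "eta i k (coef j l \<otimes>\<^bsub>group_ring G\<^esub> r) = coef j l \<otimes>\<^bsub>group_ring G\<^esub> eta i k r"
proof -
  have frag: "eta i k (frag_of h \<otimes>\<^bsub>group_ring G\<^esub> r) = frag_of h \<otimes>\<^bsub>group_ring G\<^esub> eta i k r"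
    if h: "h \<in> carrier G" "h i = \<one>\<^bsub>Gf i\<^esub>" for h
  proof (rule additive_eqI_frag[where S = "carrier G" and r = r])
    fix g assume g: "g \<in> carrier G"
    have c: "(h \<otimes> g) i = g i" using i g h by simp
    have u: "(h \<otimes> g)(i := y) = h \<otimes> g(i := y)" if "y \<in> carrier (Gf i)" for y
      by (rule G_eqI) (use i g h that in auto)
    show "eta i k (frag_of h \<otimes>\<^bsub>group_ring G\<^esub> frag_of g)
        = frag_of h \<otimes>\<^bsub>group_ring G\<^esub> eta i k (frag_of g)"
      using i by (cases "even k") (simp_all add: eta_even_frag eta_odd_frag c u gr_mult_sum)
  qed (use r in \<open>auto simp: carrier_group_ring intro!: additive_comp[OF additive_eta] additive_mult_right
        additive_comp[OF additive_mult_right] additive_eta\<close>)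
  have p: "(a j [^] t) i = \<one>\<^bsub>Gf i\<^esub>" for t :: nat
    using a_pow_coord[OF j(1) i] j by auto
  have fp: "eta i k (frag_of (a j [^] t) \<otimes>\<^bsub>group_ring G\<^esub> r)
      = frag_of (a j [^] t) \<otimes>\<^bsub>group_ring G\<^esub> eta i k r" for t :: nat
    using j p by (intro frag) auto
  have fa: "eta i k (frag_of (a j) \<otimes>\<^bsub>group_ring G\<^esub> r) = frag_of (a j) \<otimes>\<^bsub>group_ring G\<^esub> eta i k r"
    using i j by (intro frag a_closed) (simp_all add: a_eq)
  have one: "(\<one> :: nat \<Rightarrow> 'a) i = \<one>\<^bsub>Gf i\<^esub>" using i by simp
  have "coef j l = 0 \<or> coef j l = frag_of (a j) - frag_of \<one> \<or> coef j l = gr_geom G (a j) (od j)"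
    by (auto simp: poly_coeff_def)
  then show ?thesis
    using j fa frag[of \<one>] fp one
    by (auto simp: additive.zero[OF additive_eta] gr_distribs additive.diff[OF additive_eta]
        gr_geom_def gr_mult_sum additive.sum[OF additive_eta])
qed

lemma coef_comm:
  assumes "i \<in> {1..s}" "j \<in> {1..s}" "r \<in> carrier (group_ring G)"
  shows "coef i k \<otimes>\<^bsub>group_ring G\<^esub> (coef j l \<otimes>\<^bsub>group_ring G\<^esub> r)
    = coef j l \<otimes>\<^bsub>group_ring G\<^esub> (coef i k \<otimes>\<^bsub>group_ring G\<^esub> r)"
  using assms group_ring_m_comm[of "coef i k" "coef j l"] by (simp flip: group_ring_m_assoc)

lemma coef_coef:
  assumes i: "i \<in> {1..s}" and r: "r \<in> carrier (group_ring G)"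
  shows "coef i k \<otimes>\<^bsub>group_ring G\<^esub> (coef i (Suc k) \<otimes>\<^bsub>group_ring G\<^esub> r) = 0"
proof -
  have N: "(frag_of (a i) - frag_of \<one>) \<otimes>\<^bsub>group_ring G\<^esub> gr_geom G (a i) (od i) = 0"
    using i by (simp add: gr_geom_telescope)
  then have "coef i k \<otimes>\<^bsub>group_ring G\<^esub> coef i (Suc k) = 0"
    using i group_ring_m_comm[of "frag_of (a i) - frag_of \<one>" "gr_geom G (a i) (od i)"]
    by (auto simp: poly_coeff_def)
  then show ?thesis using assms by (simp flip: group_ring_m_assoc)
qed

end

section \<open>The polynomial resolution is exact\<close>

definition var_exp :: "nat \<Rightarrow> (nat \<Rightarrow>\<^sub>0 nat)" where "var_exp i = Poly_Mapping.single i 1"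

definition psgn :: "nat \<Rightarrow> (nat \<Rightarrow>\<^sub>0 nat) \<Rightarrow> int" where
  "psgn i k = (-1) ^ (\<Sum>j\<in>{1..<i}. Poly_Mapping.lookup k j)"

lemma lookup_var_exp: "Poly_Mapping.lookup (var_exp i) j = (if i = j then 1 else 0)"
  by (simp add: var_exp_def lookup_single when_def)

text \<open>The sign of the i-th term counts only the variables in front of x_i. For distinct i and
  j exactly one of x_i, x_j stands in front of the other, and this single flip is the source of
  every anticommutation below.\<close>

lemma psgn_add_var_exp:
  assumes "j \<ge> 1"
  shows "psgn i (k + var_exp j) = (if j < i then - psgn i k else psgn i k)"
proof -
  have "(\<Sum>l\<in>{1..<i}. Poly_Mapping.lookup (k + var_exp j) l)
      = (\<Sum>l\<in>{1..<i}. Poly_Mapping.lookup k l) + (\<Sum>l\<in>{1..<i}. if j = l then 1 else 0)"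
    by (simp only: lookup_add lookup_var_exp sum.distrib)
  also have "(\<Sum>l\<in>{1..<i}. if j = l then 1 else (0::nat)) = (if j < i then 1 else 0)"
    using assms by (subst sum.delta') auto
  finally show ?thesis by (simp add: psgn_def)
qed

lemma psgn_square [simp]: "psgn i k * psgn i k = 1"
  by (simp add: psgn_def flip: power_add mult_2)

text \<open>Writing a monomial divisible by x_i as a product with x_i removes the truncated
  subtraction from the computations.\<close>

lemma exponent_split:
  assumes "Poly_Mapping.lookup k i > 0"
  obtains k' where "k = k' + var_exp i"
proof
  show "k = (k - var_exp i) + var_exp i"
    using assms by (intro poly_mapping_eqI) (auto simp: lookup_add lookup_var_exp minus_poly_mapping.rep_eq)
qed

lemma poly_mapping_eq_uminus_self:
  fixes x :: "'b \<Rightarrow>\<^sub>0 'g \<Rightarrow>\<^sub>0 int"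
  assumes "x = - x"
  shows "x = 0"
proof (intro poly_mapping_eqI)
  fix k g
  have "Poly_Mapping.lookup (Poly_Mapping.lookup x k) g = Poly_Mapping.lookup (Poly_Mapping.lookup (- x) k) g"
    using assms by simp
  then show "Poly_Mapping.lookup (Poly_Mapping.lookup x k) g = Poly_Mapping.lookup (Poly_Mapping.lookup 0 k) g"
    by simp
qed

context cyclic_product
begin

definition part_diff ::
  "nat \<Rightarrow> ((nat \<Rightarrow>\<^sub>0 nat) \<Rightarrow>\<^sub>0 (nat \<Rightarrow> 'a) \<Rightarrow>\<^sub>0 int) \<Rightarrow> ((nat \<Rightarrow>\<^sub>0 nat) \<Rightarrow>\<^sub>0 (nat \<Rightarrow> 'a) \<Rightarrow>\<^sub>0 int)" where
  "part_diff i = pm_ext (\<lambda>k r. Poly_Mapping.single (k - var_exp i)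
     (frag_cmul (psgn i k) (coef i (Poly_Mapping.lookup k i) \<otimes>\<^bsub>group_ring G\<^esub> r)))"

text \<open>The sign is that of \<open>part_diff i\<close> at the monomial with x_i added, since x_i
  does not count in its own sign. Hence the signs in d_i h_i and h_i d_i square to 1.\<close>

definition part_homotopy ::
  "nat \<Rightarrow> ((nat \<Rightarrow>\<^sub>0 nat) \<Rightarrow>\<^sub>0 (nat \<Rightarrow> 'a) \<Rightarrow>\<^sub>0 int) \<Rightarrow> ((nat \<Rightarrow>\<^sub>0 nat) \<Rightarrow>\<^sub>0 (nat \<Rightarrow> 'a) \<Rightarrow>\<^sub>0 int)" where
  "part_homotopy i = pm_ext (\<lambda>k r. Poly_Mapping.single (k + var_exp i)
     (frag_cmul (psgn i k) (eta i (Poly_Mapping.lookup k i) r)))"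

text \<open>On monomials free of x_i this is not the identity but the augmentation of the
  \<open>i\<close>-th factor on the coefficients: that is what the contraction of the factor misses
  in degree 0.\<close>

definition part_proj ::
  "nat \<Rightarrow> ((nat \<Rightarrow>\<^sub>0 nat) \<Rightarrow>\<^sub>0 (nat \<Rightarrow> 'a) \<Rightarrow>\<^sub>0 int) \<Rightarrow> ((nat \<Rightarrow>\<^sub>0 nat) \<Rightarrow>\<^sub>0 (nat \<Rightarrow> 'a) \<Rightarrow>\<^sub>0 int)" where
  "part_proj i = pm_ext (\<lambda>k r. if Poly_Mapping.lookup k i = 0 then Poly_Mapping.single k (proj i r) else 0)"

lemma additive_part_diff: "additive (part_diff i)"
  unfolding part_diff_def
  by (intro additive_pm_ext additive_comp[OF additive_single] additive_comp[OF additive_frag_cmul]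
      additive_mult_right)

lemma additive_part_homotopy: "additive (part_homotopy i)"
  unfolding part_homotopy_def
  by (intro additive_pm_ext additive_comp[OF additive_single] additive_comp[OF additive_frag_cmul]
      additive_eta)

lemma additive_part_proj: "additive (part_proj i)"
  unfolding part_proj_def
  by (intro additive_pm_ext) (simp add: additive_def additive.add[OF additive_proj] single_add)

lemma part_diff_single:
  "part_diff i (Poly_Mapping.single k r) = Poly_Mapping.single (k - var_exp i)
     (frag_cmul (psgn i k) (coef i (Poly_Mapping.lookup k i) \<otimes>\<^bsub>group_ring G\<^esub> r))"
  unfolding part_diff_def by (rule pm_ext_single) simp

lemma part_diff_single_0:
  "Poly_Mapping.lookup k i = 0 \<Longrightarrow> part_diff i (Poly_Mapping.single k r) = 0"
  by (simp add: part_diff_single)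

lemma part_diff_single_add:
  "i \<ge> 1 \<Longrightarrow> part_diff i (Poly_Mapping.single (k + var_exp i) r) = Poly_Mapping.single k
     (frag_cmul (psgn i k) (coef i (Suc (Poly_Mapping.lookup k i)) \<otimes>\<^bsub>group_ring G\<^esub> r))"
  by (simp add: part_diff_single psgn_add_var_exp lookup_add lookup_var_exp)

lemma part_homotopy_single:
  "part_homotopy i (Poly_Mapping.single k r) = Poly_Mapping.single (k + var_exp i)
     (frag_cmul (psgn i k) (eta i (Poly_Mapping.lookup k i) r))"
  unfolding part_homotopy_def by (rule pm_ext_single) (simp add: additive.zero[OF additive_eta])

lemma part_proj_single:
  "part_proj i (Poly_Mapping.single k r) =
    (if Poly_Mapping.lookup k i = 0 then Poly_Mapping.single k (proj i r) else 0)"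
  unfolding part_proj_def by (rule pm_ext_single) (simp add: additive.zero[OF additive_proj])

lemma pm_ext_free_mod_closed:
  assumes "f \<in> carrier (free_mod G B)"
    and "\<And>b r. \<lbrakk>b \<in> B; r \<in> carrier (group_ring G)\<rbrakk> \<Longrightarrow> \<phi> b r \<in> carrier (free_mod G C)"
  shows "pm_ext \<phi> f \<in> carrier (free_mod G C)"
  unfolding pm_ext_def using assms
  by (intro free_mod_sum_closed) (auto simp: carrier_free_mod[of G B])

text \<open>The identities between partial differentials and homotopies are proved over all exponent
  functions. Degree and range of the variables enter afterwards through \<open>monomials\<close>,
  apart from the computations of signs.\<close>

lemma part_diff_closed:
  assumes "i \<in> {1..s}" "f \<in> carrier (free_mod G UNIV)"
  shows "part_diff i f \<in> carrier (free_mod G UNIV)"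
  unfolding part_diff_def
  by (rule pm_ext_free_mod_closed[OF assms(2)]) (use assms(1) in \<open>auto intro!: single_closed\<close>)

lemma part_homotopy_closed:
  assumes "i \<in> {1..s}" "f \<in> carrier (free_mod G UNIV)"
  shows "part_homotopy i f \<in> carrier (free_mod G UNIV)"
  unfolding part_homotopy_def
  by (rule pm_ext_free_mod_closed[OF assms(2)]) (use assms(1) in \<open>auto intro!: single_closed\<close>)

text \<open>For i = j both sides vanish, since consecutive coefficients are a_i - 1 and the norm.
  For distinct indices the coefficients commute and exactly one of the two orders picks up a
  sign.\<close>

lemma part_diff_anticommute:
  assumes i: "i \<in> {1..s}" and j: "j \<in> {1..s}" and f: "f \<in> carrier (free_mod G UNIV)"
  shows "part_diff i (part_diff j f) = - part_diff j (part_diff i f)"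
proof (rule free_mod_eqI_frag[OF f])
  fix k :: "nat \<Rightarrow>\<^sub>0 nat" and g assume g: "g \<in> carrier G"
  let ?r = "frag_of g"
  show "part_diff i (part_diff j (Poly_Mapping.single k ?r)) = - part_diff j (part_diff i (Poly_Mapping.single k ?r))"
  proof (cases "i = j")
    case True
    show ?thesis
    proof (cases "Poly_Mapping.lookup k i > 1")
      case True
      then obtain k1 where k1: "k = k1 + var_exp i" using exponent_split[of k i] by auto
      with True have "Poly_Mapping.lookup k1 i > 0" by (simp add: lookup_add lookup_var_exp)
      then obtain k2 where "k1 = k2 + var_exp i" using exponent_split by blast
      with k1 show ?thesis
        using i g \<open>i = j\<close> by (simp add: part_diff_single_add gr_mult_cmul lookup_add lookup_var_exp coef_coef)
    next
      case False
      \<comment> \<open>The exponent is at most 1, so at the latest after one application it is 0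
        and the coefficient vanishes.\<close>
      have "part_diff i (part_diff i (Poly_Mapping.single k ?r)) = 0"
        using False by (cases "Poly_Mapping.lookup k i = 0")
          (auto simp: part_diff_single_0 additive.zero[OF additive_part_diff] part_diff_single[of i k]
            minus_poly_mapping.rep_eq lookup_var_exp)
      then show ?thesis using \<open>i = j\<close> by simp
    qed
  next
    case False
    have z: "part_diff i (part_diff j (Poly_Mapping.single k ?r)) = 0
      \<and> part_diff j (part_diff i (Poly_Mapping.single k ?r)) = 0"
      if "Poly_Mapping.lookup k i = 0 \<or> Poly_Mapping.lookup k j = 0"
      using that False by (auto simp: part_diff_single_0 additive.zero[OF additive_part_diff] part_diff_single[of _ k]
            minus_poly_mapping.rep_eq lookup_var_exp)
    show ?thesis
    proof (cases "Poly_Mapping.lookup k i = 0 \<or> Poly_Mapping.lookup k j = 0")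
      case True
      then show ?thesis using z by simp
    next
      case nz: False
      then obtain k1 where k1: "k = k1 + var_exp i" using exponent_split[of k i] by auto
      with nz False have "Poly_Mapping.lookup k1 j > 0" by (simp add: lookup_add lookup_var_exp)
      then obtain k2 where "k1 = k2 + var_exp j" using exponent_split by blast
      then have k: "k = (k2 + var_exp j) + var_exp i" "k = (k2 + var_exp i) + var_exp j"
        using k1 by (simp_all add: add_ac)
      define u where "u = coef i (Suc (Poly_Mapping.lookup k2 i)) \<otimes>\<^bsub>group_ring G\<^esub>
        (coef j (Suc (Poly_Mapping.lookup k2 j)) \<otimes>\<^bsub>group_ring G\<^esub> ?r)"
      have 1: "part_diff i (part_diff j (Poly_Mapping.single k ?r))
          = Poly_Mapping.single k2 (frag_cmul (psgn j (k2 + var_exp i) * psgn i k2) u)"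
        unfolding k(2) u_def using i j False
        by (simp add: part_diff_single_add gr_mult_cmul lookup_add lookup_var_exp mult.commute)
      have 2: "part_diff j (part_diff i (Poly_Mapping.single k ?r))
          = Poly_Mapping.single k2 (frag_cmul (psgn i (k2 + var_exp j) * psgn j k2) u)"
        unfolding k(1) u_def using i j g False
        by (simp add: part_diff_single_add gr_mult_cmul lookup_add lookup_var_exp coef_comm[of i j] mult.commute)
      show ?thesis
        unfolding 1 2 using i j False
        by (auto simp: psgn_add_var_exp mult.commute single_uminus[symmetric])
    qed
  qed
qed (intro additive_comp[OF additive_part_diff] additive_part_diff additive_uminus)+

text \<open>Raising x_i flips the sign of d_j if i < j, and lowering x_j flips that of h_i if j < i.
  Exactly one of these happens, while the coefficients agree by
  \<open>eta_coef_mult\<close>.\<close>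

lemma part_diff_homotopy_anticommute:
  assumes i: "i \<in> {1..s}" and j: "j \<in> {1..s}" "j \<noteq> i" and r: "r \<in> carrier (group_ring G)"
  shows "part_diff j (part_homotopy i (Poly_Mapping.single k r))
    + part_homotopy i (part_diff j (Poly_Mapping.single k r)) = 0"
proof (cases "Poly_Mapping.lookup k j = 0")
  case True
  then show ?thesis
    using j by (simp add: part_diff_single_0 part_homotopy_single lookup_add lookup_var_exp
        additive.zero[OF additive_part_homotopy])
next
  case False
  then obtain k' where k: "k = k' + var_exp j" using exponent_split[of k j] by auto
  define u where "u = coef j (Suc (Poly_Mapping.lookup k' j)) \<otimes>\<^bsub>group_ring G\<^esub> eta i (Poly_Mapping.lookup k' i) r"
  have "part_homotopy i (Poly_Mapping.single k r) = Poly_Mapping.single ((k' + var_exp i) + var_exp j)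
      (frag_cmul (psgn i (k' + var_exp j)) (eta i (Poly_Mapping.lookup k' i) r))"
    unfolding k using i j by (simp add: part_homotopy_single lookup_add lookup_var_exp add_ac)
  then have 1: "part_diff j (part_homotopy i (Poly_Mapping.single k r))
    = Poly_Mapping.single (k' + var_exp i) (frag_cmul (psgn i (k' + var_exp j) * psgn j (k' + var_exp i)) u)"
    unfolding u_def using i j
    by (simp add: part_diff_single_add gr_mult_cmul lookup_add lookup_var_exp mult.commute)
  have 2: "part_homotopy i (part_diff j (Poly_Mapping.single k r))
    = Poly_Mapping.single (k' + var_exp i) (frag_cmul (psgn i k' * psgn j k') u)"
    unfolding k u_def using i j r
    by (simp add: part_diff_single_add part_homotopy_single additive_frag_cmul_comm[OF additive_eta]
        eta_coef_mult)
  show ?thesis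
    unfolding 1 2 using i j by (auto simp: psgn_add_var_exp simp flip: single_add frag_cmul_distrib)
qed

lemma part_diff_homotopy_same:
  assumes i: "i \<in> {1..s}" and r: "r \<in> carrier (group_ring G)"
  shows "part_diff i (part_homotopy i (Poly_Mapping.single k r))
    + part_homotopy i (part_diff i (Poly_Mapping.single k r))
    = Poly_Mapping.single k r - part_proj i (Poly_Mapping.single k r)"
proof -
  have dh: "part_diff i (part_homotopy i (Poly_Mapping.single k r))
    = Poly_Mapping.single k (coef i (Suc (Poly_Mapping.lookup k i)) \<otimes>\<^bsub>group_ring G\<^esub> eta i (Poly_Mapping.lookup k i) r)"
    using i by (simp add: part_homotopy_single part_diff_single_add gr_mult_cmul)
  show ?thesis
  proof (cases "Poly_Mapping.lookup k i = 0")
    case True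
    then show ?thesis
      using coef_eta_0[OF i r]
      by (simp add: dh part_diff_single_0 part_proj_single additive.zero[OF additive_part_homotopy] single_diff)
  next
    case False
    then obtain k' where k: "k = k' + var_exp i" using exponent_split[of k i] by auto
    have "part_homotopy i (part_diff i (Poly_Mapping.single k r))
      = Poly_Mapping.single k (eta i (Poly_Mapping.lookup k' i) (coef i (Suc (Poly_Mapping.lookup k' i)) \<otimes>\<^bsub>group_ring G\<^esub> r))"
      unfolding k using i
      by (simp add: part_diff_single_add part_homotopy_single additive_frag_cmul_comm[OF additive_eta])
    then show ?thesis
      unfolding dh using False coef_eta_Suc[OF i r, of "Poly_Mapping.lookup k' i"]
      by (simp add: part_proj_single k lookup_add lookup_var_exp flip: single_add)
  qed
qed

lemma poly_diff_eq_lin: "poly_diff G s a od n = lin G (poly_diff_mono G s a od)"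
  by (rule ext) (simp add: poly_diff_def lin_def pm_ext_def)

lemma additive_poly_diff: "additive (poly_diff G s a od n)"
  by (simp add: poly_diff_eq_lin additive_lin)

lemma poly_diff_mono_eq:
  "poly_diff_mono G s a od k = (\<Sum>i\<in>{1..s}. Poly_Mapping.single (k - var_exp i)
     (frag_cmul (psgn i k) (coef i (Poly_Mapping.lookup k i))))"
  unfolding poly_diff_mono_def
  by (rule sum.cong) (auto simp: gr_basis_def gr_int_mult var_exp_def psgn_def)

lemma poly_diff_eq_sum:
  assumes "f \<in> carrier (free_mod G UNIV)"
  shows "poly_diff G s a od n f = (\<Sum>i\<in>{1..s}. part_diff i f)"
proof (rule free_mod_eqI_frag[OF assms additive_poly_diff additive_sum_fun[OF additive_part_diff]])
  fix k :: "nat \<Rightarrow>\<^sub>0 nat" and g assume g: "g \<in> carrier G"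
  show "poly_diff G s a od n (Poly_Mapping.single k (frag_of g))
      = (\<Sum>i\<in>{1..s}. part_diff i (Poly_Mapping.single k (frag_of g)))"
    unfolding poly_diff_eq_lin lin_single poly_diff_mono_eq gr_scale_sum
    by (rule sum.cong) (use g in \<open>auto simp: part_diff_single gr_mult_cmul group_ring_m_comm\<close>)
qed

lemma poly_diff_closed_UNIV:
  "f \<in> carrier (free_mod G UNIV) \<Longrightarrow> poly_diff G s a od n f \<in> carrier (free_mod G UNIV)"
  unfolding poly_diff_eq_sum by (intro free_mod_sum_closed part_diff_closed)

text \<open>By anticommutation the double sum over all pairs, diagonal included, is its own negative
  once the indices are exchanged, and integer coefficients have no 2-torsion.\<close>

lemma poly_diff_diff_UNIV:
  assumes f: "f \<in> carrier (free_mod G UNIV)"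
  shows "poly_diff G s a od m (poly_diff G s a od n f) = 0"
proof -
  let ?X = "\<Sum>i\<in>{1..s}. \<Sum>j\<in>{1..s}. part_diff i (part_diff j f)"
  have "poly_diff G s a od m (poly_diff G s a od n f) = ?X"
    using poly_diff_eq_sum[OF f] poly_diff_eq_sum[OF poly_diff_closed_UNIV[OF f]]
    by (simp add: additive.sum[OF additive_part_diff])
  moreover have "?X = (\<Sum>i\<in>{1..s}. \<Sum>j\<in>{1..s}. - part_diff j (part_diff i f))"
    using part_diff_anticommute f by (intro sum.cong refl) blast
  then have "?X = - ?X"
    by (subst (asm) sum.swap) (simp add: sum_negf)
  then have "?X = 0"
    by (rule poly_mapping_eq_uminus_self)
  ultimately show ?thesis by simp
qed

lemma poly_homotopy_identity:
  assumes i: "i \<in> {1..s}" and f: "f \<in> carrier (free_mod G UNIV)"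
  shows "poly_diff G s a od m (part_homotopy i f) + part_homotopy i (poly_diff G s a od n f) = f - part_proj i f"
proof -
  have "(\<Sum>j\<in>{1..s}. part_diff j (part_homotopy i f) + part_homotopy i (part_diff j f)) = f - part_proj i f"
  proof (rule free_mod_eqI_frag[OF f])
    fix k :: "nat \<Rightarrow>\<^sub>0 nat" and g assume g: "g \<in> carrier G"
    let ?x = "Poly_Mapping.single k (frag_of g)"
    have "(\<Sum>j\<in>{1..s} - {i}. part_diff j (part_homotopy i ?x) + part_homotopy i (part_diff j ?x)) = 0"
      using i g by (intro sum.neutral) (auto intro!: part_diff_homotopy_anticommute)
    then show "(\<Sum>j\<in>{1..s}. part_diff j (part_homotopy i ?x) + part_homotopy i (part_diff j ?x)) = ?x - part_proj i ?x"
      using i g by (subst sum.remove[of _ i]) (auto simp: part_diff_homotopy_same)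
  qed (intro additive_sum_fun additive_plus additive_comp[OF additive_part_diff] additive_comp[OF additive_part_homotopy]
      additive_part_homotopy additive_part_diff additive_diff additive_id additive_part_proj)+
  then show ?thesis
    using i f by (simp add: poly_diff_eq_sum part_homotopy_closed sum.distrib additive.sum[OF additive_part_homotopy])
qed

section \<open>The grading by degree\<close>

definition monomials :: "nat \<Rightarrow> (nat \<Rightarrow>\<^sub>0 nat) set" where
  "monomials n = {k. Poly_Mapping.keys k \<subseteq> {1..s} \<and> (\<Sum>i\<in>{1..s}. Poly_Mapping.lookup k i) = n}"

lemma poly_mod_eq: "poly_mod G s n = free_mod G (monomials n)"
  by (simp add: poly_mod_def monomials_def)

lemma monomials_add_var_exp:
  assumes "i \<in> {1..s}"
  shows "k + var_exp i \<in> monomials (Suc n) \<longleftrightarrow> k \<in> monomials n"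
proof -
  have "(\<Sum>l\<in>{1..s}. Poly_Mapping.lookup (var_exp i) l) = 1"
    using assms by (simp add: lookup_var_exp)
  then have "(\<Sum>l\<in>{1..s}. Poly_Mapping.lookup (k + var_exp i) l) = Suc (\<Sum>l\<in>{1..s}. Poly_Mapping.lookup k l)"
    by (simp add: lookup_add sum.distrib)
  moreover have "Poly_Mapping.keys (k + var_exp i) = insert i (Poly_Mapping.keys k)"
    by (auto simp: in_keys_iff lookup_add lookup_var_exp split: if_splits)
  ultimately show ?thesis using assms by (auto simp: monomials_def)
qed

lemma poly_diff_mono_closed:
  assumes k: "k \<in> monomials (Suc n)"
  shows "poly_diff_mono G s a od k \<in> carrier (poly_mod G s n)"
  unfolding poly_diff_mono_eq poly_mod_eq
proof (rule free_mod_sum_closed)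
  fix i assume i: "i \<in> {1..s}"
  show "Poly_Mapping.single (k - var_exp i) (frag_cmul (psgn i k) (coef i (Poly_Mapping.lookup k i)))
      \<in> carrier (free_mod G (monomials n))"
  proof (cases "Poly_Mapping.lookup k i = 0")
    case False
    then obtain k' where k': "k = k' + var_exp i" using exponent_split[of k i] by auto
    then have "k' \<in> monomials n" using k monomials_add_var_exp[OF i] by simp
    then show ?thesis using i by (auto simp: k' intro!: single_closed)
  qed simp
qed

lemma module_map_poly_diff:
  "module_map (group_ring G) (poly_mod G s (Suc n)) (poly_mod G s n) (poly_diff G s a od m)"
  unfolding poly_diff_eq_lin poly_mod_eq
  by (rule module_map_lin) (use poly_diff_mono_closed in \<open>auto simp: poly_mod_eq\<close>)

lemma poly_diff_scale:
  assumes "r \<in> carrier (group_ring G)" "x \<in> carrier (poly_mod G s (Suc n))"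
  shows "poly_diff G s a od m (gr_scale G r x) = gr_scale G r (poly_diff G s a od m x)"
  using module_map_poly_diff[of n m] assms by (auto simp: module_map_def poly_mod_eq)

lemma poly_mod_UNIV: "x \<in> carrier (poly_mod G s n) \<Longrightarrow> x \<in> carrier (free_mod G UNIV)"
  unfolding poly_mod_eq by (rule free_mod_UNIV)

lemma poly_diff_diff:
  "x \<in> carrier (poly_mod G s n) \<Longrightarrow> poly_diff G s a od m (poly_diff G s a od m' x) = 0"
  by (rule poly_diff_diff_UNIV) (rule poly_mod_UNIV)

lemma chain_complex_poly: "chain_complex (group_ring G) (poly_mod G s) (poly_diff G s a od)"
  unfolding chain_complex_def
  by (auto simp: module_map_poly_diff poly_diff_diff) (simp_all add: poly_mod_eq module_free_mod)

lemma part_homotopy_poly_mod: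
  assumes i: "i \<in> {1..s}" and f: "f \<in> carrier (poly_mod G s n)"
  shows "part_homotopy i f \<in> carrier (poly_mod G s (Suc n))"
  unfolding part_homotopy_def poly_mod_eq
  by (rule pm_ext_free_mod_closed[OF f[unfolded poly_mod_eq]])
    (use i in \<open>auto intro!: single_closed simp: monomials_add_var_exp\<close>)

text \<open>The projection changes coefficients and drops monomials but creates none, so variables
  eliminated earlier do not return.\<close>

lemma part_proj_closed:
  assumes i: "i \<in> {1..s}" and f: "f \<in> carrier (free_mod G B)"
  shows "part_proj i f \<in> carrier (free_mod G {k\<in>B. Poly_Mapping.lookup k i = 0})"
  unfolding part_proj_def
  by (rule pm_ext_free_mod_closed[OF f]) (use i in \<open>auto intro!: single_closed\<close>)

section \<open>Eliminating the variables from a cycle\<close>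

lemma poly_cycle_reduce:
  assumes z: "z \<in> carrier (poly_mod G s n)" "poly_diff G s a od n z = 0" and m: "m \<le> s"
  shows "\<exists>y\<in>carrier (poly_mod G s (Suc n)).
    z - poly_diff G s a od (Suc n) y \<in> carrier (free_mod G {k \<in> monomials n. \<forall>j\<in>{1..m}. Poly_Mapping.lookup k j = 0})"
  using m
proof (induction m)
  case 0
  then show ?case
    using z by (intro bexI[of _ 0]) (auto simp: additive.zero[OF additive_poly_diff] poly_mod_eq)
next
  case (Suc m)
  let ?d = "poly_diff G s a od"
  let ?B = "{k \<in> monomials n. \<forall>j\<in>{1..m}. Poly_Mapping.lookup k j = 0}"
  have i: "Suc m \<in> {1..s}" using Suc.prems by simp
  obtain y where y: "y \<in> carrier (poly_mod G s (Suc n))"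
    and w: "z - ?d (Suc n) y \<in> carrier (free_mod G ?B)"
    using Suc by auto
  define w where "w = z - ?d (Suc n) y"
  have wU: "w \<in> carrier (free_mod G UNIV)" and wn: "w \<in> carrier (poly_mod G s n)"
    using w unfolding w_def poly_mod_eq by (auto elim: free_mod_UNIV free_mod_mono)
  \<comment> \<open>Subtracting a boundary preserves cycles, so the term h d w of the homotopy
    identity drops out and only the projection is left.\<close>
  have "?d n w = 0"
    unfolding w_def using z(2) poly_diff_diff[OF y] by (simp add: additive.diff[OF additive_poly_diff])
  then have *: "w - ?d (Suc n) (part_homotopy (Suc m) w) = part_proj (Suc m) w"
    using poly_homotopy_identity[OF i wU, of "Suc n" n]
    by (simp add: additive.zero[OF additive_part_homotopy])
  have "part_proj (Suc m) w \<in> carrier (free_mod G {k \<in> ?B. Poly_Mapping.lookup k (Suc m) = 0})"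
    using part_proj_closed[OF i w] unfolding w_def .
  then have "part_proj (Suc m) w \<in> carrier (free_mod G {k \<in> monomials n. \<forall>j\<in>{1..Suc m}. Poly_Mapping.lookup k j = 0})"
    by (rule free_mod_mono) (auto simp: le_Suc_eq)
  then have "z - ?d (Suc n) (y + part_homotopy (Suc m) w)
      \<in> carrier (free_mod G {k \<in> monomials n. \<forall>j\<in>{1..Suc m}. Poly_Mapping.lookup k j = 0})"
    unfolding *[symmetric] by (simp add: w_def additive.add[OF additive_poly_diff] diff_diff_eq)
  moreover have "y + part_homotopy (Suc m) w \<in> carrier (poly_mod G s (Suc n))"
    using y part_homotopy_poly_mod[OF i wn] by (simp add: poly_mod_eq)
  ultimately show ?case by blast
qed

lemma poly_exact:
  assumes z: "z \<in> carrier (poly_mod G s (Suc n))" "poly_diff G s a od (Suc n) z = 0"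
  shows "\<exists>y\<in>carrier (poly_mod G s (Suc (Suc n))). poly_diff G s a od (Suc (Suc n)) y = z"
proof -
  obtain y where y: "y \<in> carrier (poly_mod G s (Suc (Suc n)))"
    "z - poly_diff G s a od (Suc (Suc n)) y
      \<in> carrier (free_mod G {k \<in> monomials (Suc n). \<forall>j\<in>{1..s}. Poly_Mapping.lookup k j = 0})"
    using poly_cycle_reduce[OF z order_refl] by blast
  have empty: "{k \<in> monomials (Suc n). \<forall>j\<in>{1..s}. Poly_Mapping.lookup k j = 0} = {}"
    unfolding monomials_def using sum.neutral[of "{1..s}"] by force
  have "Poly_Mapping.keys (z - poly_diff G s a od (Suc (Suc n)) y) = {}"
    using y(2) unfolding empty by (simp add: carrier_free_mod)
  then show ?thesis using y(1) by (auto intro!: bexI[of _ y])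
qed


section \<open>The comparison map in low degrees\<close>

abbreviation xlog :: "nat \<Rightarrow> (nat \<Rightarrow> 'a) \<Rightarrow> nat" where "xlog i x \<equiv> dlog i (x i)"

text \<open>With the strict bound this is the factor that stands before index m in the formulas for
  \<sigma>. It runs from the unit at \<open>m = 1\<close> to \<open>x\<close> at
  \<open>m = Suc s\<close>, the end points of the telescoping sums.\<close>

definition prefix :: "nat \<Rightarrow> (nat \<Rightarrow> 'a) \<Rightarrow> (nat \<Rightarrow> 'a)" where
  "prefix m x = (\<lambda>j\<in>{1..s}. if j < m then x j else \<one>\<^bsub>Gf j\<^esub>)"

lemma prefix_closed [simp]: "x \<in> carrier G \<Longrightarrow> prefix m x \<in> carrier G"
  by (auto simp: prefix_def carrier_G PiE_iff)

lemma prefix_coord: "j \<in> {1..s} \<Longrightarrow> prefix m x j = (if j < m then x j else \<one>\<^bsub>Gf j\<^esub>)"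
  by (simp add: prefix_def)

lemma prefix_1: "x \<in> carrier G \<Longrightarrow> prefix 1 x = \<one>"
  by (rule G_eqI) (auto simp: prefix_coord)

lemma prefix_all: "x \<in> carrier G \<Longrightarrow> prefix (Suc s) x = x"
  by (rule G_eqI) (auto simp: prefix_coord)

lemma prefix_mult:
  "\<lbrakk>x \<in> carrier G; y \<in> carrier G\<rbrakk> \<Longrightarrow> prefix m (x \<otimes> y) = prefix m x \<otimes> prefix m y"
  by (rule G_eqI) (auto simp: prefix_coord)

lemma prefix_Suc:
  assumes "x \<in> carrier G" "m \<in> {1..s}"
  shows "prefix (Suc m) x = prefix m x \<otimes> a m [^] xlog m x"
  by (rule G_eqI) (use assms in \<open>auto simp: prefix_coord a_pow_coord gpow_dlog less_Suc_eq\<close>)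

lemma xlog_less [simp]: "\<lbrakk>x \<in> carrier G; i \<in> {1..s}\<rbrakk> \<Longrightarrow> xlog i x < od i"
  by (simp add: dlog_less)

text \<open>The prescribed value as a function of the group element, with exponents read off by
  \<open>xlog\<close>: a linear map on the standard resolution needs values on symbols, not on
  tuples of exponents.\<close>

definition sigma1_sym :: "(nat \<Rightarrow> 'a) \<Rightarrow> ((nat \<Rightarrow>\<^sub>0 nat) \<Rightarrow>\<^sub>0 (nat \<Rightarrow> 'a) \<Rightarrow>\<^sub>0 int)" where
  "sigma1_sym x = (\<Sum>i\<in>{1..s}. gr_scale G
     (frag_of (prefix i x) \<otimes>\<^bsub>group_ring G\<^esub> gr_geom G (a i) (xlog i x)) (poly_var G i))"

definition sigma2_pow :: "nat \<Rightarrow> nat \<Rightarrow> nat \<Rightarrow> nat \<Rightarrow> ((nat \<Rightarrow>\<^sub>0 nat) \<Rightarrow>\<^sub>0 (nat \<Rightarrow> 'a) \<Rightarrow>\<^sub>0 int)" where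
  "sigma2_pow i k j l =
     (if i = j then gr_scale G (gr_int G (int ((k + l) div od i))) (poly_var2 G i i)
      else if i < j then 0
      else - gr_scale G (gr_geom G (a j) l \<otimes>\<^bsub>group_ring G\<^esub> gr_geom G (a i) k) (poly_var2 G j i))"

definition sigma2_sym ::
  "(nat \<Rightarrow> 'a) \<Rightarrow> (nat \<Rightarrow> 'a) \<Rightarrow> ((nat \<Rightarrow>\<^sub>0 nat) \<Rightarrow>\<^sub>0 (nat \<Rightarrow> 'a) \<Rightarrow>\<^sub>0 int)" where
  "sigma2_sym x y = (\<Sum>i\<in>{1..s}. \<Sum>j\<in>{1..i}.
     gr_scale G (frag_of (prefix i x \<otimes> prefix j y)) (sigma2_pow i (xlog i x) j (xlog j y)))"

lemma scale_poly_var: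
  "c \<in> carrier (group_ring G) \<Longrightarrow> gr_scale G c (poly_var G i) = Poly_Mapping.single (var_exp i) c"
  by (simp add: poly_var_def gr_scale_basis var_exp_def)

lemma scale_poly_var2:
  "c \<in> carrier (group_ring G) \<Longrightarrow> gr_scale G c (poly_var2 G i j) = Poly_Mapping.single (var_exp i + var_exp j) c"
  by (simp add: poly_var2_def gr_scale_basis var_exp_def)

lemma sigma1_sym_eq:
  assumes "x \<in> carrier G"
  shows "sigma1_sym x = (\<Sum>i\<in>{1..s}. Poly_Mapping.single (var_exp i)
     (frag_of (prefix i x) \<otimes>\<^bsub>group_ring G\<^esub> gr_geom G (a i) (xlog i x)))"
  unfolding sigma1_sym_def by (rule sum.cong) (use assms in \<open>auto simp: scale_poly_var\<close>)

lemma var_exp_monomials: "i \<in> {1..s} \<Longrightarrow> var_exp i \<in> monomials 1"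
  using monomials_add_var_exp[of i 0 0] by (simp add: monomials_def)

lemma var_exp2_monomials: "\<lbrakk>i \<in> {1..s}; j \<in> {1..s}\<rbrakk> \<Longrightarrow> var_exp i + var_exp j \<in> monomials 2"
  using monomials_add_var_exp[of j "var_exp i" 1] var_exp_monomials by (simp add: numeral_2_eq_2)

lemma sigma1_sym_closed:
  assumes "x \<in> carrier G"
  shows "sigma1_sym x \<in> carrier (poly_mod G s 1)"
  unfolding sigma1_sym_eq[OF assms] poly_mod_eq
  by (intro free_mod_sum_closed single_closed var_exp_monomials) (use assms in auto)

lemma sigma2_pow_closed:
  assumes "i \<in> {1..s}" "j \<in> {1..s}"
  shows "sigma2_pow i k j l \<in> carrier (poly_mod G s 2)"
  unfolding sigma2_pow_def poly_mod_eq
  using assms by (auto simp: scale_poly_var2 intro!: free_mod_uminus_closed single_closed var_exp2_monomials)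

lemma sigma2_sym_closed:
  assumes "x \<in> carrier G" "y \<in> carrier G"
  shows "sigma2_sym x y \<in> carrier (poly_mod G s 2)"
proof -
  have "gr_scale G (frag_of (prefix i x \<otimes> prefix j y)) (sigma2_pow i (xlog i x) j (xlog j y))
      \<in> carrier (poly_mod G s 2)" if "i \<in> {1..s}" "j \<in> {1..i}" for i j
    using sigma2_pow_closed[of i j] that assms by (auto simp: poly_mod_eq)
  then show ?thesis
    unfolding sigma2_sym_def poly_mod_eq by (intro free_mod_sum_closed) auto
qed

text \<open>If one exponent is 0, there is no carry because the other is below the order, and in the
  mixed case one geometric sum is empty. Thus the formula respects the normalization.\<close>

lemma sigma2_pow_0:
  assumes "k < od i" "l < od j" "k = 0 \<or> l = 0"
  shows "sigma2_pow i k j l = 0"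
  using assms by (auto simp: sigma2_pow_def gr_int_def)

lemma sigma1_sym_one: "sigma1_sym \<one> = 0"
  unfolding sigma1_sym_def by (rule sum.neutral) auto

lemma sigma2_sym_one:
  assumes "x \<in> carrier G" "y \<in> carrier G" "x = \<one> \<or> y = \<one>"
  shows "sigma2_sym x y = 0"
  unfolding sigma2_sym_def
proof (intro sum.neutral ballI)
  fix i j assume "i \<in> {1..s}" "j \<in> {1..i}"
  then have *: "i \<in> {1..s}" "j \<in> {1..s}" by auto
  have "sigma2_pow i (xlog i x) j (xlog j y) = 0"
    by (rule sigma2_pow_0) (use * assms in auto)
  then show "gr_scale G (frag_of (prefix i x \<otimes> prefix j y)) (sigma2_pow i (xlog i x) j (xlog j y)) = 0"
    by simp
qed

text \<open>A power of one generator has no other nonzero exponent, so by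
  \<open>sigma2_pow_0\<close> at most one term survives, and there both prefixes are
  trivial.\<close>

lemma sigma2_sym_pow:
  assumes i: "i \<in> {1..s}" and j: "j \<in> {1..s}" and k: "k < od i" and l: "l < od j"
  shows "sigma2_sym (a i [^] k) (a j [^] l) = sigma2_pow i k j l"
proof -
  let ?x = "a i [^] k" and ?y = "a j [^] l"
  have xlog: "xlog m ?x = (if m = i then k else 0)" "xlog m ?y = (if m = j then l else 0)"
    if "m \<in> {1..s}" for m
    using that i j k l by (auto simp: a_pow_coord dlog_gpow)
  have pre: "prefix i ?x = \<one>" "prefix j ?y = \<one>"
    by (rule G_eqI; use i j in \<open>auto simp: prefix_coord a_pow_coord\<close>)+
  have term_eq: "gr_scale G (frag_of (prefix i' ?x \<otimes> prefix j' ?y)) (sigma2_pow i' (xlog i' ?x) j' (xlog j' ?y))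
    = (if i' = i \<and> j' = j then sigma2_pow i k j l else 0)"
    if "i' \<in> {1..s}" "j' \<in> {1..i'}" for i' j'
  proof -
    have m: "j' \<in> {1..s}" using that by auto
    show ?thesis
    proof (cases "i' = i \<and> j' = j")
      case True
      have "sigma2_pow i k j l \<in> carrier (poly_mod G s 2)" by (rule sigma2_pow_closed[OF i j])
      then show ?thesis
        using True xlog[OF i] xlog[OF j] pre by (simp add: poly_mod_eq)
    next
      case False
      have "sigma2_pow i' (xlog i' ?x) j' (xlog j' ?y) = 0"
        by (rule sigma2_pow_0) (use False xlog that m k l i j od_pos in auto)
      then show ?thesis using False by auto
    qed
  qed
  have "sigma2_sym ?x ?y = (\<Sum>i'\<in>{1..s}. \<Sum>j'\<in>{1..i'}. if i' = i \<and> j' = j then sigma2_pow i k j l else 0)"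
    unfolding sigma2_sym_def by (intro sum.cong refl term_eq)
  also have "\<dots> = (\<Sum>i'\<in>{1..s}. if i' = i then (\<Sum>j'\<in>{1..i}. if j' = j then sigma2_pow i k j l else 0) else 0)"
    by (intro sum.cong refl) auto
  \<comment> \<open>For i < j the pair lies outside the range of summation, in accordance with the
    value 0 of \<open>sigma2_pow\<close> there.\<close>
  also have "\<dots> = sigma2_pow i k j l"
    using i j by (auto simp: sigma2_pow_def)
  finally show ?thesis .
qed

section \<open>Differentials of monomials of degree one and two\<close>

lemma poly_diff_single_var:
  assumes i: "i \<in> {1..s}" and r: "r \<in> carrier (group_ring G)"
  shows "poly_diff G s a od n (Poly_Mapping.single (var_exp i) r)
    = Poly_Mapping.single 0 ((frag_of (a i) - frag_of \<one>) \<otimes>\<^bsub>group_ring G\<^esub> r)"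
proof -
  let ?x = "Poly_Mapping.single (var_exp i) r"
  have "poly_diff G s a od n ?x = (\<Sum>m\<in>{1..s}. part_diff m ?x)"
    by (rule poly_diff_eq_sum) (use r in \<open>auto intro: single_closed\<close>)
  also have "\<dots> = (\<Sum>m\<in>{1..s}. if m = i then part_diff i ?x else 0)"
    by (intro sum.cong refl) (auto simp: part_diff_single_0 lookup_var_exp)
  also have "\<dots> = part_diff i (Poly_Mapping.single (0 + var_exp i) r)"
    using i by simp
  also have "\<dots> = Poly_Mapping.single 0 ((frag_of (a i) - frag_of \<one>) \<otimes>\<^bsub>group_ring G\<^esub> r)"
    using i by (subst part_diff_single_add) (auto simp: psgn_def poly_coeff_def)
  finally show ?thesis .
qed

lemma poly_diff_single_square:
  assumes i: "i \<in> {1..s}" and r: "r \<in> carrier (group_ring G)"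
  shows "poly_diff G s a od n (Poly_Mapping.single (var_exp i + var_exp i) r)
    = Poly_Mapping.single (var_exp i) (gr_geom G (a i) (od i) \<otimes>\<^bsub>group_ring G\<^esub> r)"
proof -
  let ?x = "Poly_Mapping.single (var_exp i + var_exp i) r"
  have "poly_diff G s a od n ?x = (\<Sum>m\<in>{1..s}. part_diff m ?x)"
    by (rule poly_diff_eq_sum) (use r in \<open>auto intro: single_closed\<close>)
  also have "\<dots> = (\<Sum>m\<in>{1..s}. if m = i then part_diff i ?x else 0)"
    by (intro sum.cong refl) (auto simp: part_diff_single_0 lookup_var_exp lookup_add)
  also have "\<dots> = part_diff i ?x"
    using i by simp
  also have "\<dots> = Poly_Mapping.single (var_exp i) (gr_geom G (a i) (od i) \<otimes>\<^bsub>group_ring G\<^esub> r)"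
    using i by (subst part_diff_single_add) (auto simp: psgn_def poly_coeff_def lookup_var_exp)
  finally show ?thesis .
qed

lemma poly_diff_single_product:
  assumes i: "i \<in> {1..s}" and j: "j \<in> {1..<i}" and r: "r \<in> carrier (group_ring G)"
  shows "poly_diff G s a od n (Poly_Mapping.single (var_exp j + var_exp i) r)
    = Poly_Mapping.single (var_exp i) ((frag_of (a j) - frag_of \<one>) \<otimes>\<^bsub>group_ring G\<^esub> r)
      - Poly_Mapping.single (var_exp j) ((frag_of (a i) - frag_of \<one>) \<otimes>\<^bsub>group_ring G\<^esub> r)"
proof -
  let ?x = "Poly_Mapping.single (var_exp j + var_exp i) r"
  have j': "j \<in> {1..s}" "j \<noteq> i" using i j by auto
  have pi: "part_diff i ?x = - Poly_Mapping.single (var_exp j) ((frag_of (a i) - frag_of \<one>) \<otimes>\<^bsub>group_ring G\<^esub> r)"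
  proof -
    \<comment> \<open>The single x_j in front of x_i makes K_i = 1. Nothing precedes x_j, so its
      sign below is positive.\<close>
    have "psgn i (0 + var_exp j) = - 1" using j by (subst psgn_add_var_exp) (auto simp: psgn_def)
    then show ?thesis
      using i j by (subst part_diff_single_add) (auto simp: poly_coeff_def lookup_var_exp single_uminus)
  qed
  have pj: "part_diff j ?x = Poly_Mapping.single (var_exp i) ((frag_of (a j) - frag_of \<one>) \<otimes>\<^bsub>group_ring G\<^esub> r)"
  proof -
    have "psgn j (0 + var_exp i) = 1" using i j by (subst psgn_add_var_exp) (auto simp: psgn_def)
    moreover have "?x = Poly_Mapping.single (var_exp i + var_exp j) r" by (simp add: add.commute)
    ultimately show ?thesis
      using i j by (simp add: part_diff_single_add) (auto simp: poly_coeff_def lookup_var_exp)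
  qed
  have "poly_diff G s a od n ?x = (\<Sum>m\<in>{1..s}. part_diff m ?x)"
    by (rule poly_diff_eq_sum) (use r in \<open>auto intro: single_closed\<close>)
  also have "\<dots> = (\<Sum>m\<in>{1..s}. (if m = i then part_diff i ?x else 0) + (if m = j then part_diff j ?x else 0))"
    using j' by (intro sum.cong refl) (auto simp: part_diff_single_0 lookup_var_exp lookup_add)
  also have "\<dots> = part_diff i ?x + part_diff j ?x"
    using i j' by (simp add: sum.distrib)
  finally show ?thesis by (simp add: pi pj)
qed

text \<open>The common source of the telescoping: together with \<open>gr_geom_telescope\<close> it
  turns a_i - 1 times a coefficient of \<sigma>_1 into a difference of consecutive prefixes.\<close>

lemma prefix_diff:
  assumes "x \<in> carrier G" "i \<in> {1..s}"
  shows "(frag_of (a i [^] xlog i x) - frag_of \<one>) \<otimes>\<^bsub>group_ring G\<^esub> frag_of (prefix i x)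
    = frag_of (prefix (Suc i) x) - frag_of (prefix i x)"
  using assms by (simp add: gr_distribs prefix_Suc m_comm)

lemma poly_diff_sigma1:
  assumes x: "x \<in> carrier G"
  shows "poly_diff G s a od n (sigma1_sym x) = Poly_Mapping.single 0 (frag_of x - frag_of \<one>)"
proof -
  have "poly_diff G s a od n (sigma1_sym x)
      = (\<Sum>i\<in>{1..s}. Poly_Mapping.single 0 (frag_of (prefix (Suc i) x) - frag_of (prefix i x)))"
    unfolding sigma1_sym_eq[OF x] additive.sum[OF additive_poly_diff]
  proof (intro sum.cong refl)
    fix i assume i: "i \<in> {1..s}"
    have "(frag_of (a i) - frag_of \<one>) \<otimes>\<^bsub>group_ring G\<^esub>
          (frag_of (prefix i x) \<otimes>\<^bsub>group_ring G\<^esub> gr_geom G (a i) (xlog i x))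
        = ((frag_of (a i) - frag_of \<one>) \<otimes>\<^bsub>group_ring G\<^esub> gr_geom G (a i) (xlog i x)) \<otimes>\<^bsub>group_ring G\<^esub> frag_of (prefix i x)"
      using i x by (simp add: group_ring_m_assoc group_ring_m_comm[of "frag_of (prefix i x)"])
    also have "\<dots> = frag_of (prefix (Suc i) x) - frag_of (prefix i x)"
      using i x by (simp add: gr_geom_telescope prefix_diff)
    finally show "poly_diff G s a od n (Poly_Mapping.single (var_exp i)
        (frag_of (prefix i x) \<otimes>\<^bsub>group_ring G\<^esub> gr_geom G (a i) (xlog i x)))
      = Poly_Mapping.single 0 (frag_of (prefix (Suc i) x) - frag_of (prefix i x))"
      using i x by (simp add: poly_diff_single_var)
  qed
  also have "\<dots> = Poly_Mapping.single 0 (\<Sum>i\<in>{1..s}. frag_of (prefix (Suc i) x) - frag_of (prefix i x))"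
    by (rule additive.sum[OF additive_single, symmetric])
  also have "(\<Sum>i\<in>{1..s}. frag_of (prefix (Suc i) x) - frag_of (prefix i x)) = frag_of x - frag_of \<one>"
    using x prefix_1[OF x] prefix_all[OF x] sum_Suc_diff[of 1 s "\<lambda>i. frag_of (prefix i x)"] by simp
  finally show ?thesis .
qed

text \<open>In d(x_j x_i) either a_i - 1 meets the geometric sum in a_i or a_j - 1 meets the one in
  a_j. So the coefficient of x_j will telescope in i, and that of x_i in j.\<close>

lemma poly_diff_sigma2_pow_less:
  assumes x: "x \<in> carrier G" and y: "y \<in> carrier G" and i: "i \<in> {1..s}" and j: "j \<in> {1..<i}"
  shows "poly_diff G s a od n (gr_scale G (frag_of (prefix i x \<otimes> prefix j y)) (sigma2_pow i (xlog i x) j (xlog j y)))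
    = Poly_Mapping.single (var_exp j) ((frag_of (prefix (Suc i) x) - frag_of (prefix i x))
        \<otimes>\<^bsub>group_ring G\<^esub> (frag_of (prefix j y) \<otimes>\<^bsub>group_ring G\<^esub> gr_geom G (a j) (xlog j y)))
    - Poly_Mapping.single (var_exp i) ((frag_of (prefix (Suc j) y) - frag_of (prefix j y))
        \<otimes>\<^bsub>group_ring G\<^esub> (frag_of (prefix i x) \<otimes>\<^bsub>group_ring G\<^esub> gr_geom G (a i) (xlog i x)))"
proof -
  have j': "j \<in> {1..s}" using i j by auto
  interpret R: cring "group_ring G" by (rule cring_group_ring)
  define p q u v where "p = gr_geom G (a i) (xlog i x)" and "q = gr_geom G (a j) (xlog j y)"
    and "u = frag_of (prefix i x)" and "v = frag_of (prefix j y)"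
  have C: "p \<in> carrier (group_ring G)" "q \<in> carrier (group_ring G)" "u \<in> carrier (group_ring G)" "v \<in> carrier (group_ring G)"
    "frag_of (a i) - frag_of \<one> \<in> carrier (group_ring G)" "frag_of (a j) - frag_of \<one> \<in> carrier (group_ring G)"
    using i j' x y by (auto simp: p_def q_def u_def v_def)
  have "gr_scale G (frag_of (prefix i x \<otimes> prefix j y)) (sigma2_pow i (xlog i x) j (xlog j y))
      = Poly_Mapping.single (var_exp j + var_exp i) (- (u \<otimes>\<^bsub>group_ring G\<^esub> v \<otimes>\<^bsub>group_ring G\<^esub> (q \<otimes>\<^bsub>group_ring G\<^esub> p)))"
    using j C unfolding sigma2_pow_def
    by (simp add: scale_poly_var2 gr_scale_distribs p_def q_def u_def v_def single_uminus)
  also have "poly_diff G s a od n \<dots> =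
      Poly_Mapping.single (var_exp j) ((frag_of (a i) - frag_of \<one>) \<otimes>\<^bsub>group_ring G\<^esub> (u \<otimes>\<^bsub>group_ring G\<^esub> v \<otimes>\<^bsub>group_ring G\<^esub> (q \<otimes>\<^bsub>group_ring G\<^esub> p)))
    - Poly_Mapping.single (var_exp i) ((frag_of (a j) - frag_of \<one>) \<otimes>\<^bsub>group_ring G\<^esub> (u \<otimes>\<^bsub>group_ring G\<^esub> v \<otimes>\<^bsub>group_ring G\<^esub> (q \<otimes>\<^bsub>group_ring G\<^esub> p)))"
    using C by (subst poly_diff_single_product[OF i j]) (simp_all add: gr_distribs(5,6) single_uminus)
  also have "(frag_of (a i) - frag_of \<one>) \<otimes>\<^bsub>group_ring G\<^esub> (u \<otimes>\<^bsub>group_ring G\<^esub> v \<otimes>\<^bsub>group_ring G\<^esub> (q \<otimes>\<^bsub>group_ring G\<^esub> p))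
      = (((frag_of (a i) - frag_of \<one>) \<otimes>\<^bsub>group_ring G\<^esub> p) \<otimes>\<^bsub>group_ring G\<^esub> u) \<otimes>\<^bsub>group_ring G\<^esub> (v \<otimes>\<^bsub>group_ring G\<^esub> q)"
    using C by (simp only: R.m_ac R.m_closed)
  also have "((frag_of (a i) - frag_of \<one>) \<otimes>\<^bsub>group_ring G\<^esub> p) \<otimes>\<^bsub>group_ring G\<^esub> u
      = frag_of (prefix (Suc i) x) - frag_of (prefix i x)"
    using i x by (simp add: p_def u_def gr_geom_telescope prefix_diff)
  also have "(frag_of (a j) - frag_of \<one>) \<otimes>\<^bsub>group_ring G\<^esub> (u \<otimes>\<^bsub>group_ring G\<^esub> v \<otimes>\<^bsub>group_ring G\<^esub> (q \<otimes>\<^bsub>group_ring G\<^esub> p))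
      = (((frag_of (a j) - frag_of \<one>) \<otimes>\<^bsub>group_ring G\<^esub> q) \<otimes>\<^bsub>group_ring G\<^esub> v) \<otimes>\<^bsub>group_ring G\<^esub> (u \<otimes>\<^bsub>group_ring G\<^esub> p)"
    using C by (simp only: R.m_ac R.m_closed)
  also have "((frag_of (a j) - frag_of \<one>) \<otimes>\<^bsub>group_ring G\<^esub> q) \<otimes>\<^bsub>group_ring G\<^esub> v
      = frag_of (prefix (Suc j) y) - frag_of (prefix j y)"
    using j' y by (simp add: q_def v_def gr_geom_telescope prefix_diff)
  finally show ?thesis by (simp only: p_def q_def u_def v_def)
qed

lemma poly_diff_sigma2_pow_same:
  assumes x: "x \<in> carrier G" and y: "y \<in> carrier G" and i: "i \<in> {1..s}"
  shows "poly_diff G s a od n (gr_scale G (frag_of (prefix i x \<otimes> prefix i y)) (sigma2_pow i (xlog i x) i (xlog i y)))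
    = Poly_Mapping.single (var_exp i) (frag_of (prefix i x \<otimes> prefix i y) \<otimes>\<^bsub>group_ring G\<^esub>
        frag_cmul (int ((xlog i x + xlog i y) div od i)) (gr_geom G (a i) (od i)))"
proof -
  let ?c = "gr_int G (int ((xlog i x + xlog i y) div od i))" and ?w = "frag_of (prefix i x \<otimes> prefix i y)"
  let ?N = "gr_geom G (a i) (od i)"
  interpret R: cring "group_ring G" by (rule cring_group_ring)
  have C: "?w \<in> carrier (group_ring G)" "?c \<in> carrier (group_ring G)" "?N \<in> carrier (group_ring G)"
    using x y i by auto
  have "gr_scale G ?w (sigma2_pow i (xlog i x) i (xlog i y))
      = Poly_Mapping.single (var_exp i + var_exp i) (?w \<otimes>\<^bsub>group_ring G\<^esub> ?c)"
    unfolding sigma2_pow_def using x y by (simp add: scale_poly_var2)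
  then have "poly_diff G s a od n (gr_scale G ?w (sigma2_pow i (xlog i x) i (xlog i y)))
      = Poly_Mapping.single (var_exp i) (?N \<otimes>\<^bsub>group_ring G\<^esub> (?w \<otimes>\<^bsub>group_ring G\<^esub> ?c))"
    using C by (simp add: poly_diff_single_square[OF i])
  also have "?N \<otimes>\<^bsub>group_ring G\<^esub> (?w \<otimes>\<^bsub>group_ring G\<^esub> ?c) = ?w \<otimes>\<^bsub>group_ring G\<^esub> (?c \<otimes>\<^bsub>group_ring G\<^esub> ?N)"
    using C by (simp only: R.m_ac R.m_closed)
  finally show ?thesis using C by (simp add: gr_int_mult)
qed

text \<open>The right side is what \<sigma>_1 makes of d[x, y]. Telescoping in both indices leaves
  one identity for the coefficient of each x_i, in which the carry term accounts for the reduction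
  of the exponents of x y.\<close>

lemma poly_diff_sigma2:
  assumes x: "x \<in> carrier G" and y: "y \<in> carrier G"
  shows "poly_diff G s a od n (sigma2_sym x y)
    = gr_scale G (frag_of x) (sigma1_sym y) - sigma1_sym (x \<otimes> y) + sigma1_sym x"
proof -
  interpret R: cring "group_ring G" by (rule cring_group_ring)
  define U V P Q where "U = (\<lambda>i. frag_of (prefix i x))" and "V = (\<lambda>i. frag_of (prefix i y))"
    and "P = (\<lambda>i. gr_geom G (a i) (xlog i x))" and "Q = (\<lambda>i. gr_geom G (a i) (xlog i y))"
  define T where "T = (\<lambda>i. U i \<otimes>\<^bsub>group_ring G\<^esub> V i \<otimes>\<^bsub>group_ring G\<^esub>
        frag_cmul (int ((xlog i x + xlog i y) div od i)) (gr_geom G (a i) (od i)))"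
  let ?S = "\<lambda>i c. Poly_Mapping.single (var_exp i) c :: (nat \<Rightarrow>\<^sub>0 nat) \<Rightarrow>\<^sub>0 (nat \<Rightarrow> 'a) \<Rightarrow>\<^sub>0 int"
  have C: "U i \<in> carrier (group_ring G)" "V i \<in> carrier (group_ring G)" for i
    using x y by (auto simp: U_def V_def)
  have C': "P i \<in> carrier (group_ring G)" "Q i \<in> carrier (group_ring G)" if "i \<in> {1..s}" for i
    using that by (auto simp: P_def Q_def)
  \<comment> \<open>For fixed i the x_i parts telescope in j from the unit to \<open>V i\<close>,
    while the x_j parts have to wait for the sum over i.\<close>
  have row: "(\<Sum>j\<in>{1..i}. poly_diff G s a od n (gr_scale G (frag_of (prefix i x \<otimes> prefix j y))
        (sigma2_pow i (xlog i x) j (xlog j y))))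
    = ?S i (T i) - ?S i ((V i - frag_of \<one>) \<otimes>\<^bsub>group_ring G\<^esub> (U i \<otimes>\<^bsub>group_ring G\<^esub> P i))
      + (\<Sum>j\<in>{1..<i}. ?S j ((U (Suc i) - U i) \<otimes>\<^bsub>group_ring G\<^esub> (V j \<otimes>\<^bsub>group_ring G\<^esub> Q j)))"
    if i: "i \<in> {1..s}" for i
  proof -
    let ?t = "\<lambda>j. poly_diff G s a od n (gr_scale G (frag_of (prefix i x \<otimes> prefix j y))
        (sigma2_pow i (xlog i x) j (xlog j y)))"
    have "{1..i} = insert i {1..<i}" using i by auto
    then have "sum ?t {1..i} = ?t i + sum ?t {1..<i}" by simp
    also have "?t i = ?S i (T i)"
      using poly_diff_sigma2_pow_same[OF x y i] by (simp add: T_def U_def V_def)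
    also have "sum ?t {1..<i} = (\<Sum>j\<in>{1..<i}. ?S j ((U (Suc i) - U i) \<otimes>\<^bsub>group_ring G\<^esub> (V j \<otimes>\<^bsub>group_ring G\<^esub> Q j))
        - ?S i ((V (Suc j) - V j) \<otimes>\<^bsub>group_ring G\<^esub> (U i \<otimes>\<^bsub>group_ring G\<^esub> P i)))"
      using poly_diff_sigma2_pow_less[OF x y i] by (intro sum.cong refl) (simp add: U_def V_def P_def Q_def)
    also have "\<dots> = (\<Sum>j\<in>{1..<i}. ?S j ((U (Suc i) - U i) \<otimes>\<^bsub>group_ring G\<^esub> (V j \<otimes>\<^bsub>group_ring G\<^esub> Q j)))
        - ?S i ((\<Sum>j\<in>{1..<i}. V (Suc j) - V j) \<otimes>\<^bsub>group_ring G\<^esub> (U i \<otimes>\<^bsub>group_ring G\<^esub> P i))"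
      by (rule trans[OF sum_subtractf]) (simp only: gr_mult_sum additive.sum[OF additive_single])
    also have "(\<Sum>j\<in>{1..<i}. V (Suc j) - V j) = V i - frag_of \<one>"
      using i y prefix_1[OF y] sum_Suc_diff'[of 1 i V] by (simp add: V_def)
    finally show ?thesis by simp
  qed
  have "poly_diff G s a od n (sigma2_sym x y) =
     (\<Sum>i\<in>{1..s}. ?S i (T i) - ?S i ((V i - frag_of \<one>) \<otimes>\<^bsub>group_ring G\<^esub> (U i \<otimes>\<^bsub>group_ring G\<^esub> P i)))
      + (\<Sum>i\<in>{1..s}. \<Sum>j\<in>{1..<i}. ?S j ((U (Suc i) - U i) \<otimes>\<^bsub>group_ring G\<^esub> (V j \<otimes>\<^bsub>group_ring G\<^esub> Q j)))"
    unfolding sigma2_sym_def additive.sum[OF additive_poly_diff] sum.distrib[symmetric]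
    by (intro sum.cong refl row)
  \<comment> \<open>Exchanging the summations over j < i lets the coefficient of x_j telescope in i,
    from \<open>U (Suc j)\<close> up to \<open>x\<close> itself.\<close>
  also have "(\<Sum>i\<in>{1..s}. \<Sum>j\<in>{1..<i}. ?S j ((U (Suc i) - U i) \<otimes>\<^bsub>group_ring G\<^esub> (V j \<otimes>\<^bsub>group_ring G\<^esub> Q j)))
      = (\<Sum>j\<in>{1..s}. \<Sum>i\<in>{Suc j..s}. ?S j ((U (Suc i) - U i) \<otimes>\<^bsub>group_ring G\<^esub> (V j \<otimes>\<^bsub>group_ring G\<^esub> Q j)))"
    unfolding sum.Sigma[OF finite_atLeastAtMost ballI[OF finite_atLeastLessThan]]
      sum.Sigma[OF finite_atLeastAtMost ballI[OF finite_atLeastAtMost]]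
    by (rule sum.reindex_bij_witness[of _ prod.swap prod.swap]) auto
  also have "\<dots> = (\<Sum>j\<in>{1..s}. ?S j ((frag_of x - U (Suc j)) \<otimes>\<^bsub>group_ring G\<^esub> (V j \<otimes>\<^bsub>group_ring G\<^esub> Q j)))"
  proof (intro sum.cong refl)
    fix j assume j: "j \<in> {1..s}"
    have "(\<Sum>i\<in>{Suc j..s}. U (Suc i) - U i) = frag_of x - U (Suc j)"
      using j x prefix_all[OF x] sum_Suc_diff[of "Suc j" s U] by (simp add: U_def)
    then show "(\<Sum>i\<in>{Suc j..s}. ?S j ((U (Suc i) - U i) \<otimes>\<^bsub>group_ring G\<^esub> (V j \<otimes>\<^bsub>group_ring G\<^esub> Q j)))
        = ?S j ((frag_of x - U (Suc j)) \<otimes>\<^bsub>group_ring G\<^esub> (V j \<otimes>\<^bsub>group_ring G\<^esub> Q j))"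
      by (simp only: gr_mult_sum[symmetric] additive.sum[OF additive_single, symmetric])
  qed
  also have "(\<Sum>i\<in>{1..s}. ?S i (T i) - ?S i ((V i - frag_of \<one>) \<otimes>\<^bsub>group_ring G\<^esub> (U i \<otimes>\<^bsub>group_ring G\<^esub> P i))) + \<dots>
      = (\<Sum>i\<in>{1..s}. ?S i (frag_of x \<otimes>\<^bsub>group_ring G\<^esub> (V i \<otimes>\<^bsub>group_ring G\<^esub> Q i))
          - ?S i (frag_of (prefix i (x \<otimes> y)) \<otimes>\<^bsub>group_ring G\<^esub> gr_geom G (a i) (xlog i (x \<otimes> y)))
          + ?S i (U i \<otimes>\<^bsub>group_ring G\<^esub> P i))"
    unfolding sum.distrib[symmetric]
  proof (intro sum.cong refl)
    fix i assume i: "i \<in> {1..s}"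
    define A where "A = frag_of (a i [^] xlog i x)"
    have A: "A \<in> carrier (group_ring G)" using i by (simp add: A_def)
    have U_Suc: "U (Suc i) = U i \<otimes>\<^bsub>group_ring G\<^esub> A"
      using i x by (simp add: U_def A_def prefix_Suc)
    have W: "frag_of (prefix i (x \<otimes> y)) = U i \<otimes>\<^bsub>group_ring G\<^esub> V i"
      using x y by (simp add: U_def V_def prefix_mult)
    have log: "xlog i (x \<otimes> y) = (xlog i x + xlog i y) mod od i"
      using i x y by (simp add: dlog_mult)
    \<comment> \<open>The geometric sum of length k + l is split at k on the one hand and reduced
      modulo the order on the other; comparing the two isolates the carry times the norm.\<close>
    have geom: "frag_cmul (int ((xlog i x + xlog i y) div od i)) (gr_geom G (a i) (od i))
        = P i + A \<otimes>\<^bsub>group_ring G\<^esub> Q i - gr_geom G (a i) (xlog i (x \<otimes> y))"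
      using gr_geom_eq_mod[OF a_closed[OF i] a_pow_od[OF i], of "xlog i x + xlog i y"]
        gr_geom_add[OF a_closed[OF i], of "xlog i x" "xlog i y"]
      unfolding log P_def Q_def A_def by (simp add: eq_diff_eq)
    have "T i - (V i - frag_of \<one>) \<otimes>\<^bsub>group_ring G\<^esub> (U i \<otimes>\<^bsub>group_ring G\<^esub> P i)
        + (frag_of x - U (Suc i)) \<otimes>\<^bsub>group_ring G\<^esub> (V i \<otimes>\<^bsub>group_ring G\<^esub> Q i)
      = frag_of x \<otimes>\<^bsub>group_ring G\<^esub> (V i \<otimes>\<^bsub>group_ring G\<^esub> Q i)
        - frag_of (prefix i (x \<otimes> y)) \<otimes>\<^bsub>group_ring G\<^esub> gr_geom G (a i) (xlog i (x \<otimes> y)) + U i \<otimes>\<^bsub>group_ring G\<^esub> P i"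
    proof -
      have 1: "U i \<otimes>\<^bsub>group_ring G\<^esub> A \<otimes>\<^bsub>group_ring G\<^esub> (V i \<otimes>\<^bsub>group_ring G\<^esub> Q i)
          = U i \<otimes>\<^bsub>group_ring G\<^esub> V i \<otimes>\<^bsub>group_ring G\<^esub> (A \<otimes>\<^bsub>group_ring G\<^esub> Q i)"
        using C C'[OF i] A by (simp only: R.m_ac R.m_closed)
      have 2: "V i \<otimes>\<^bsub>group_ring G\<^esub> (U i \<otimes>\<^bsub>group_ring G\<^esub> P i) = U i \<otimes>\<^bsub>group_ring G\<^esub> V i \<otimes>\<^bsub>group_ring G\<^esub> P i"
        using C C'[OF i] by (simp only: R.m_ac R.m_closed)
      have 3: "frag_of \<one> \<otimes>\<^bsub>group_ring G\<^esub> (U i \<otimes>\<^bsub>group_ring G\<^esub> P i) = U i \<otimes>\<^bsub>group_ring G\<^esub> P i"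
        using C C'[OF i] by (simp only: group_ring_l_one group_ring_m_closed)
      show ?thesis
        unfolding T_def geom U_Suc W by (simp only: gr_distribs 1 2 3) simp
    qed
    then show "?S i (T i) - ?S i ((V i - frag_of \<one>) \<otimes>\<^bsub>group_ring G\<^esub> (U i \<otimes>\<^bsub>group_ring G\<^esub> P i))
        + ?S i ((frag_of x - U (Suc i)) \<otimes>\<^bsub>group_ring G\<^esub> (V i \<otimes>\<^bsub>group_ring G\<^esub> Q i))
      = ?S i (frag_of x \<otimes>\<^bsub>group_ring G\<^esub> (V i \<otimes>\<^bsub>group_ring G\<^esub> Q i))
          - ?S i (frag_of (prefix i (x \<otimes> y)) \<otimes>\<^bsub>group_ring G\<^esub> gr_geom G (a i) (xlog i (x \<otimes> y)))
          + ?S i (U i \<otimes>\<^bsub>group_ring G\<^esub> P i)"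
      by (simp only: single_add[symmetric] single_diff[symmetric])
  qed
  also have "\<dots> = gr_scale G (frag_of x) (sigma1_sym y) - sigma1_sym (x \<otimes> y) + sigma1_sym x"
    unfolding sigma1_sym_eq[OF x] sigma1_sym_eq[OF y] sigma1_sym_eq[OF m_closed[OF x y]]
    by (simp only: sum.distrib sum_subtractf gr_scale_sum gr_scale_single U_def V_def P_def Q_def)
  finally show ?thesis .
qed

section \<open>The prescribed maps as a chain map in degrees at most two\<close>

definition sigma_low :: "nat \<Rightarrow> ((nat \<Rightarrow> 'a) list \<Rightarrow>\<^sub>0 (nat \<Rightarrow> 'a) \<Rightarrow>\<^sub>0 int)
    \<Rightarrow> ((nat \<Rightarrow>\<^sub>0 nat) \<Rightarrow>\<^sub>0 (nat \<Rightarrow> 'a) \<Rightarrow>\<^sub>0 int)" where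
  "sigma_low n = lin G (\<lambda>gs. if n = 0 then gr_basis G 0
     else if n = 1 then sigma1_sym (gs ! 0) else sigma2_sym (gs ! 0) (gs ! 1))"

lemma additive_sigma_low: "additive (sigma_low n)"
  by (simp add: sigma_low_def additive_lin)

lemma sigma_0_single: "r \<in> carrier (group_ring G) \<Longrightarrow> sigma_low 0 (Poly_Mapping.single [] r) = Poly_Mapping.single 0 r"
  by (simp add: sigma_low_def gr_scale_basis)

lemma sigma_1_sym:
  assumes "x \<in> carrier G"
  shows "sigma_low 1 (std_sym G [x]) = sigma1_sym x"
proof (cases "x = \<one>")
  case True
  then show ?thesis
    by (simp add: std_sym_def additive.zero[OF additive_sigma_low] sigma1_sym_one)
next
  case False
  have "lin G (\<lambda>gs. sigma1_sym (gs ! 0)) (gr_basis G [x]) = sigma1_sym x"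
    using sigma1_sym_closed[OF assms] lin_basis[of "\<lambda>gs. sigma1_sym (gs ! 0)" "[x]"]
    by (simp add: poly_mod_eq)
  with False show ?thesis by (auto simp: std_sym_def sigma_low_def)
qed

lemma sigma_2_sym:
  assumes "x \<in> carrier G" "y \<in> carrier G"
  shows "sigma_low 2 (std_sym G [x, y]) = sigma2_sym x y"
proof (cases "x = \<one> \<or> y = \<one>")
  case True
  then show ?thesis
    using sigma2_sym_one[OF assms True] by (auto simp: std_sym_def additive.zero[OF additive_sigma_low])
next
  case False
  have "lin G (\<lambda>gs. sigma2_sym (gs ! 0) (gs ! 1)) (gr_basis G [x, y]) = sigma2_sym x y"
    using sigma2_sym_closed[OF assms] lin_basis[of "\<lambda>gs. sigma2_sym (gs ! 0) (gs ! 1)" "[x, y]"]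
    by (simp add: poly_mod_eq)
  with False show ?thesis by (auto simp: std_sym_def sigma_low_def)
qed

lemma sigma_low_coeff_closed:
  assumes "n \<le> 2" "length gs = n" "set gs \<subseteq> carrier G - {\<one>}"
  shows "(if n = 0 then gr_basis G 0
     else if n = 1 then sigma1_sym (gs ! 0) else sigma2_sym (gs ! 0) (gs ! 1)) \<in> carrier (poly_mod G s n)"
proof -
  have "gs ! i \<in> carrier G" if "i < n" for i
    using that assms nth_mem[of i gs] by blast
  then show ?thesis
    using assms(1) sigma1_sym_closed[of "gs ! 0"] sigma2_sym_closed[of "gs ! 0" "gs ! 1"]
    by (auto simp: poly_mod_eq monomials_def le_Suc_eq numeral_2_eq_2 intro!: gr_basis_closed)
qed

lemma module_map_sigma_low:
  "n \<le> 2 \<Longrightarrow> module_map (group_ring G) (std_mod G n) (poly_mod G s n) (sigma_low n)"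
  unfolding sigma_low_def std_mod_def poly_mod_eq
  by (rule module_map_lin) (use sigma_low_coeff_closed in \<open>simp add: poly_mod_eq\<close>)

lemma module_map_scale:
  assumes "module_map (group_ring G) (std_mod G n) (poly_mod G s n) f"
    and "r \<in> carrier (group_ring G)" "x \<in> carrier (std_mod G n)"
  shows "f (gr_scale G r x) = gr_scale G r (f x)" "f x \<in> carrier (poly_mod G s n)"
  using assms by (auto simp: module_map_def hom_def std_mod_def poly_mod_eq)

lemma comparison_eqI:
  assumes f: "module_map (group_ring G) (std_mod G n) (poly_mod G s n) f" "additive f"
    and f': "module_map (group_ring G) (std_mod G (Suc n)) (poly_mod G s (Suc n)) f'" "additive f'"
    and eq: "\<And>gs. \<lbrakk>length gs = Suc n; set gs \<subseteq> carrier G - {\<one>}\<rbrakk> \<Longrightarrow>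
      poly_diff G s a od (Suc n) (f' (gr_basis G gs)) = f (std_diff G (Suc n) (gr_basis G gs))"
    and x: "x \<in> carrier (std_mod G (Suc n))"
  shows "poly_diff G s a od (Suc n) (f' x) = f (std_diff G (Suc n) x)"
proof (rule lin_eqI[OF x[unfolded std_mod_def]])
  show "additive (\<lambda>x. poly_diff G s a od (Suc n) (f' x))" "additive (\<lambda>x. f (std_diff G (Suc n) x))"
    by (rule additive_comp[OF additive_poly_diff f'(2)], rule additive_comp[OF f(2) additive_std_diff])
  fix r x assume r: "r \<in> carrier (group_ring G)"
    and "x \<in> carrier (free_mod G {gs. length gs = Suc n \<and> set gs \<subseteq> carrier G - {\<one>}})"
  then have x: "x \<in> carrier (std_mod G (Suc n))" by (simp add: std_mod_def)
  show "poly_diff G s a od (Suc n) (f' (gr_scale G r x)) = gr_scale G r (poly_diff G s a od (Suc n) (f' x))"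
    using module_map_scale[OF f'(1) r x] r by (simp add: poly_diff_scale)
  show "f (std_diff G (Suc n) (gr_scale G r x)) = gr_scale G r (f (std_diff G (Suc n) x))"
    using module_map_scale(1)[OF f(1) r std_diff_closed[OF x]] std_diff_scale[OF r x] by simp
qed (use eq in auto)

lemma sigma_low_comm:
  assumes n: "n < 2" and x: "x \<in> carrier (std_mod G (Suc n))"
  shows "poly_diff G s a od (Suc n) (sigma_low (Suc n) x) = sigma_low n (std_diff G (Suc n) x)"
proof (rule comparison_eqI[OF _ additive_sigma_low _ additive_sigma_low _ x])
  fix gs assume gs: "length gs = Suc n" "set gs \<subseteq> carrier G - {\<one>}"
  then have sym: "gr_basis G gs = std_sym G gs" by (auto simp: std_sym_def)
  have d: "std_diff G (Suc n) (std_sym G gs) = std_diff_sym G gs"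
    using gs unfolding sym[symmetric] by (intro std_diff_basis) auto
  consider "n = 0" | "n = 1" using n by linarith
  then show "poly_diff G s a od (Suc n) (sigma_low (Suc n) (gr_basis G gs)) = sigma_low n (std_diff G (Suc n) (gr_basis G gs))"
  proof cases
    case 1
    then obtain g where g: "gs = [g]" "g \<in> carrier G" using gs by (cases gs) auto
    then show ?thesis
      unfolding sym d using sigma_1_sym[OF g(2)] 1
      by (simp add: poly_diff_sigma1 std_diff_sym_singleton sigma_0_single)
  next
    case 2
    then obtain g h where g: "gs = [g, h]" "g \<in> carrier G" "h \<in> carrier G" "g \<noteq> \<one>" "h \<noteq> \<one>"
      using gs by (cases gs; cases "tl gs") auto
    have "std_diff_sym G [g, h] = gr_scale G (frag_of g) (std_sym G [h]) - std_sym G [g \<otimes> h] + std_sym G [g]"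
      by (simp add: std_diff_sym_def gr_scale_int_uminus gr_scale_int_1[OF std_sym_UNIV])
    moreover have "sigma_low 1 (gr_scale G (frag_of g) (std_sym G [h])) = gr_scale G (frag_of g) (sigma1_sym h)"
      using module_map_scale(1)[OF module_map_sigma_low[of 1], of "frag_of g" "std_sym G [h]"]
        std_sym_closed[of "[h]" 1] g by (simp add: sigma_1_sym[unfolded One_nat_def])
    ultimately show ?thesis
      unfolding sym d using 2 g sigma_2_sym[OF g(2,3)] sigma_1_sym[OF g(2)] sigma_1_sym[OF m_closed[OF g(2,3)]]
      by (simp add: g(1) numeral_2_eq_2 poly_diff_sigma2 additive.add[OF additive_sigma_low]
          additive.diff[OF additive_sigma_low])
  qed
qed (use n in \<open>auto intro!: module_map_sigma_low\<close>)


section \<open>The comparison map in all degrees\<close>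

text \<open>On each basis symbol the element to be lifted is a cycle by \<open>cyc\<close>, hence a
  boundary by \<open>poly_exact\<close>; chosen preimages extend linearly because the standard
  modules are free. The cycle condition is a hypothesis since the map below \<open>f\<close> is not
  at hand.\<close>

lemma comparison_step:
  assumes f: "module_map (group_ring G) (std_mod G (Suc n)) (poly_mod G s (Suc n)) f" "additive f"
    and cyc: "\<And>x. x \<in> carrier (std_mod G (Suc (Suc n))) \<Longrightarrow>
      poly_diff G s a od (Suc n) (f (std_diff G (Suc (Suc n)) x)) = 0"
  shows "\<exists>f'. module_map (group_ring G) (std_mod G (Suc (Suc n))) (poly_mod G s (Suc (Suc n))) f' \<and> additive f' \<and>
    (\<forall>x\<in>carrier (std_mod G (Suc (Suc n))).
      poly_diff G s a od (Suc (Suc n)) (f' x) = f (std_diff G (Suc (Suc n)) x))"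
proof -
  let ?B = "{gs. length gs = Suc (Suc n) \<and> set gs \<subseteq> carrier G - {\<one>}}"
  have "\<exists>y\<in>carrier (poly_mod G s (Suc (Suc n))).
      poly_diff G s a od (Suc (Suc n)) y = f (std_diff G (Suc (Suc n)) (gr_basis G gs))" if "gs \<in> ?B" for gs
  proof (rule poly_exact)
    have x: "gr_basis G gs \<in> carrier (std_mod G (Suc (Suc n)))"
      using that by (simp add: std_mod_def gr_basis_closed)
    show "f (std_diff G (Suc (Suc n)) (gr_basis G gs)) \<in> carrier (poly_mod G s (Suc n))"
      by (rule module_map_scale(2)[OF f(1) _ std_diff_closed[OF x], of 0]) simp
    show "poly_diff G s a od (Suc n) (f (std_diff G (Suc (Suc n)) (gr_basis G gs))) = 0"
      by (rule cyc[OF x])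
  qed
  then have "\<forall>gs\<in>?B. \<exists>y. y \<in> carrier (poly_mod G s (Suc (Suc n))) \<and>
      poly_diff G s a od (Suc (Suc n)) y = f (std_diff G (Suc (Suc n)) (gr_basis G gs))"
    by blast
  then obtain \<phi> where \<phi>: "\<And>gs. gs \<in> ?B \<Longrightarrow> \<phi> gs \<in> carrier (poly_mod G s (Suc (Suc n)))"
    "\<And>gs. gs \<in> ?B \<Longrightarrow> poly_diff G s a od (Suc (Suc n)) (\<phi> gs) = f (std_diff G (Suc (Suc n)) (gr_basis G gs))"
    using bchoice[of ?B "\<lambda>gs y. y \<in> carrier (poly_mod G s (Suc (Suc n))) \<and>
      poly_diff G s a od (Suc (Suc n)) y = f (std_diff G (Suc (Suc n)) (gr_basis G gs))"] by blast
  have mm: "module_map (group_ring G) (std_mod G (Suc (Suc n))) (poly_mod G s (Suc (Suc n))) (lin G \<phi>)"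
    unfolding std_mod_def poly_mod_eq by (rule module_map_lin) (use \<phi>(1) in \<open>simp add: poly_mod_eq\<close>)
  have "poly_diff G s a od (Suc (Suc n)) (lin G \<phi> x) = f (std_diff G (Suc (Suc n)) x)"
    if "x \<in> carrier (std_mod G (Suc (Suc n)))" for x
  proof (rule comparison_eqI[OF f mm additive_lin _ that])
    fix gs assume "length gs = Suc (Suc n)" "set gs \<subseteq> carrier G - {\<one>}"
    then have gs: "gs \<in> ?B" by simp
    then have "lin G \<phi> (gr_basis G gs) = \<phi> gs"
      using \<phi>(1)[OF gs] unfolding poly_mod_eq by (intro lin_basis)
    then show "poly_diff G s a od (Suc (Suc n)) (lin G \<phi> (gr_basis G gs)) = f (std_diff G (Suc (Suc n)) (gr_basis G gs))"
      using \<phi>(2)[OF gs] by simp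
  qed
  with mm show ?thesis
    by (intro exI[of _ "lin G \<phi>"]) (simp add: additive_lin)
qed

lemma comparison_exists:
  obtains \<sigma> where "chain_map (group_ring G) (std_mod G) (std_diff G) (poly_mod G s) (poly_diff G s a od) \<sigma>"
    "\<And>n. n \<le> 2 \<Longrightarrow> \<sigma> n = sigma_low n"
proof -
  let ?S = "\<lambda>n. carrier (std_mod G n)"
  \<comment> \<open>Index n stands for degree n + 2, so that the recursion starts at the prescribed
    \<sigma>_2. The cycle condition belongs to the invariant because the next map has to be
    constructible from \<open>f\<close> alone.\<close>
  let ?P = "\<lambda>n f. module_map (group_ring G) (std_mod G (Suc (Suc n))) (poly_mod G s (Suc (Suc n))) f \<and> additive f \<and>
    (\<forall>x\<in>?S (Suc (Suc (Suc n))). poly_diff G s a od (Suc (Suc n)) (f (std_diff G (Suc (Suc (Suc n))) x)) = 0)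
    \<and> (n = 0 \<longrightarrow> f = sigma_low 2)"
  let ?Q = "\<lambda>n f f'. \<forall>x\<in>?S (Suc (Suc (Suc n))).
    poly_diff G s a od (Suc (Suc (Suc n))) (f' x) = f (std_diff G (Suc (Suc (Suc n))) x)"
  have "\<exists>\<tau>. \<forall>n. ?P n (\<tau> n) \<and> ?Q n (\<tau> n) (\<tau> (Suc n))"
  proof (rule dependent_nat_choice)
    have "poly_diff G s a od (Suc (Suc 0)) (sigma_low (Suc (Suc 0)) (std_diff G (Suc (Suc (Suc 0))) x)) = 0"
      if "x \<in> ?S (Suc (Suc (Suc 0)))" for x
      using that std_diff_closed[OF that] std_diff_diff[OF that]
      by (subst sigma_low_comm) (auto simp: additive.zero[OF additive_sigma_low])
    then show "\<exists>f. ?P 0 f"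
      using module_map_sigma_low[of 2] additive_sigma_low[of 2]
      by (intro exI[of _ "sigma_low 2"]) (simp add: numeral_2_eq_2)
  next
    fix f n assume P: "?P n f"
    obtain f' where f': "module_map (group_ring G) (std_mod G (Suc (Suc (Suc n)))) (poly_mod G s (Suc (Suc (Suc n)))) f'"
      "additive f'" "?Q n f f'"
      using comparison_step[of "Suc n" f] P by blast
    \<comment> \<open>d f' d = f d d = 0 restores the cycle condition one degree higher.\<close>
    have "poly_diff G s a od (Suc (Suc (Suc n))) (f' (std_diff G (Suc (Suc (Suc (Suc n)))) x)) = 0"
      if x: "x \<in> ?S (Suc (Suc (Suc (Suc n))))" for x
      using f'(3) std_diff_closed[OF x, of "Suc (Suc (Suc (Suc n)))"] std_diff_diff[OF x] P
      by (simp add: additive.zero)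
    then show "\<exists>f'. ?P (Suc n) f' \<and> ?Q n f f'"
      using f' by (intro exI[of _ f']) simp
  qed
  then obtain \<tau> where \<tau>: "\<And>n. ?P n (\<tau> n)" "\<And>n. ?Q n (\<tau> n) (\<tau> (Suc n))" by blast
  define \<sigma> where "\<sigma> n = (if n < 2 then sigma_low n else \<tau> (n - 2))" for n
  have low: "\<sigma> n = sigma_low n" if "n \<le> 2" for n
    using that \<tau>(1)[of 0] by (auto simp: \<sigma>_def)
  have high: "\<sigma> (Suc (Suc n)) = \<tau> n" for n by (simp add: \<sigma>_def)
  have "module_map (group_ring G) (std_mod G n) (poly_mod G s n) (\<sigma> n)" for n
  proof (cases "n < 2")
    case False
    then obtain m where "n = Suc (Suc m)" by (metis add_2_eq_Suc le_Suc_ex not_less)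
    then show ?thesis using \<tau>(1)[of m] high by simp
  qed (simp add: low module_map_sigma_low)
  moreover have "poly_diff G s a od (Suc n) (\<sigma> (Suc n) x) = \<sigma> n (std_diff G (Suc n) x)"
    if x: "x \<in> ?S (Suc n)" for n x
  proof (cases "n < 2")
    case True
    then show ?thesis using sigma_low_comm[OF True x] by (simp add: low)
  next
    case False
    then obtain m where "n = Suc (Suc m)" by (metis add_2_eq_Suc le_Suc_ex not_less)
    then show ?thesis using \<tau>(2)[of m] high x by simp
  qed
  ultimately have "chain_map (group_ring G) (std_mod G) (std_diff G) (poly_mod G s) (poly_diff G s a od) \<sigma>"
    using chain_complex_std chain_complex_poly by (simp add: chain_map_def)
  with low show ?thesis using that by blast
qed

section \<open>Degree 0 and the isomorphism on homology\<close>

lemma std_mod_0_eq: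
  assumes "z \<in> carrier (std_mod G 0)"
  obtains r where "r \<in> carrier (group_ring G)" "z = Poly_Mapping.single [] r"
proof
  show "Poly_Mapping.lookup z [] \<in> carrier (group_ring G)"
    using assms by (simp add: carrier_std_mod carrier_free_mod)
  have "Poly_Mapping.lookup z gs = 0" if "gs \<noteq> []" for gs
    using assms that by (auto simp: carrier_std_mod carrier_free_mod in_keys_iff)
  then show "z = Poly_Mapping.single [] (Poly_Mapping.lookup z [])"
    by (intro poly_mapping_eqI) (auto simp: lookup_single when_def)
qed

lemma poly_mod_0_eq:
  assumes "z \<in> carrier (poly_mod G s 0)"
  obtains r where "r \<in> carrier (group_ring G)" "z = Poly_Mapping.single 0 r"
proof
  show "Poly_Mapping.lookup z 0 \<in> carrier (group_ring G)"
    using assms by (simp add: poly_mod_eq carrier_free_mod)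
  have "k = 0" if "k \<in> monomials 0" for k
    using that by (intro poly_mapping_eqI) (auto simp: monomials_def in_keys_iff)
  then have "Poly_Mapping.lookup z k = 0" if "k \<noteq> 0" for k
    using assms that by (auto simp: poly_mod_eq carrier_free_mod in_keys_iff)
  then show "z = Poly_Mapping.single 0 (Poly_Mapping.lookup z 0)"
    by (intro poly_mapping_eqI) (auto simp: lookup_single when_def)
qed

lemma monomials_1:
  assumes "k \<in> monomials (Suc 0)"
  shows "\<exists>i\<in>{1..s}. k = var_exp i"
proof -
  have "\<exists>i\<in>{1..s}. Poly_Mapping.lookup k i > 0"
  proof (rule ccontr)
    assume "\<not> ?thesis"
    then have "(\<Sum>i\<in>{1..s}. Poly_Mapping.lookup k i) = 0" by simp
    then show False using assms by (simp add: monomials_def)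
  qed
  then obtain i k' where i: "i \<in> {1..s}" "k = k' + var_exp i" using exponent_split by metis
  then have k': "k' \<in> monomials 0" using assms monomials_add_var_exp by simp
  have "k' = 0"
    using k' by (intro poly_mapping_eqI) (auto simp: monomials_def in_keys_iff)
  with i show ?thesis by auto
qed

text \<open>By additivity it suffices to lift r x_i, for which r [a_i] works. As \<sigma>_0 is
  injective, this yields injectivity on homology in degree 0.\<close>

lemma poly_boundary_0:
  assumes y: "y \<in> carrier (poly_mod G s (Suc 0))"
  shows "\<exists>x\<in>carrier (std_mod G (Suc 0)). poly_diff G s a od (Suc 0) y = sigma_low 0 (std_diff G (Suc 0) x)"
proof -
  have keys: "k \<in> monomials (Suc 0)" if "k \<in> Poly_Mapping.keys y" for k
    using y that by (auto simp: poly_mod_eq carrier_free_mod)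
  define idx where "idx k = (SOME i. i \<in> {1..s} \<and> k = var_exp i)" for k
  have idx: "idx k \<in> {1..s} \<and> var_exp (idx k) = k" if "k \<in> monomials (Suc 0)" for k
    using monomials_1[OF that] someI_ex[of "\<lambda>i. i \<in> {1..s} \<and> k = var_exp i"] unfolding idx_def by metis
  let ?r = "Poly_Mapping.lookup y"
  \<comment> \<open>\<open>std_sym\<close> instead of a basis element covers trivial factors: there
    a_i = 1, and both the symbol and a_i - 1 are 0.\<close>
  define X where "X k = gr_scale G (?r k) (std_sym G [a (idx k)])" for k
  have r: "?r k \<in> carrier (group_ring G)" for k
    using y by (simp add: poly_mod_eq carrier_free_mod)
  have X: "X k \<in> carrier (std_mod G (Suc 0))" if "k \<in> monomials (Suc 0)" for k
    using idx[OF that] std_sym_closed[of "[a (idx k)]" "Suc 0"] r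
    unfolding X_def std_mod_def by simp
  have dX: "poly_diff G s a od (Suc 0) (Poly_Mapping.single k (?r k)) = sigma_low 0 (std_diff G (Suc 0) (X k))"
    if k: "k \<in> monomials (Suc 0)" for k
  proof -
    define i where "i = idx k"
    have i: "i \<in> {1..s}" "k = var_exp i" using idx[OF k] by (auto simp: i_def)
    have ai: "a i \<in> carrier G" using i(1) by simp
    have "std_diff G (Suc 0) (X k) = gr_scale G (?r k) (std_diff G (Suc 0) (std_sym G [a i]))"
      unfolding X_def i_def[symmetric] using ai
      by (intro std_diff_scale[OF r] std_sym_closed) auto
    also have "\<dots> = Poly_Mapping.single [] (?r k \<otimes>\<^bsub>group_ring G\<^esub> (frag_of (a i) - frag_of \<one>))"
      using ai by (simp add: std_diff_sym_Cons_eq std_diff_sym_singleton)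
    finally show ?thesis
      using i ai r[of k] by (simp add: sigma_0_single poly_diff_single_var group_ring_m_comm)
  qed
  have "poly_diff G s a od (Suc 0) y
      = (\<Sum>k\<in>Poly_Mapping.keys y. poly_diff G s a od (Suc 0) (Poly_Mapping.single k (?r k)))"
    by (subst poly_mapping_expansion[of y]) (rule additive.sum[OF additive_poly_diff])
  also have "\<dots> = (\<Sum>k\<in>Poly_Mapping.keys y. sigma_low 0 (std_diff G (Suc 0) (X k)))"
    by (intro sum.cong refl dX keys)
  also have "\<dots> = sigma_low 0 (std_diff G (Suc 0) (\<Sum>k\<in>Poly_Mapping.keys y. X k))"
    by (simp only: additive.sum[OF additive_std_diff] additive.sum[OF additive_sigma_low])
  finally show ?thesis
    using X keys by (intro bexI) (auto simp: std_mod_def intro!: free_mod_sum_closed)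
qed

lemma quasi_isomorphism_comparison:
  assumes \<sigma>: "chain_map (group_ring G) (std_mod G) (std_diff G) (poly_mod G s) (poly_diff G s a od) \<sigma>"
    and \<sigma>0: "\<sigma> 0 = sigma_low 0"
  shows "quasi_isomorphism (group_ring G) (std_mod G) (std_diff G) (poly_mod G s) (poly_diff G s a od) \<sigma>"
proof (rule quasi_isomorphismI[OF \<sigma>])
  fix n z
  assume z: "z \<in> cycles (std_mod G) (std_diff G) n"
    and b: "\<sigma> n z \<in> boundaries (poly_mod G s) (poly_diff G s a od) n"
  show "z \<in> boundaries (std_mod G) (std_diff G) n"
  proof (cases n)
    case (Suc m)
    then show ?thesis using z std_exact by simp
  next
    case 0
    obtain r where r: "r \<in> carrier (group_ring G)" "z = Poly_Mapping.single [] r"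
      using z 0 by (auto simp: cycles_def elim: std_mod_0_eq)
    obtain y where y: "y \<in> carrier (poly_mod G s (Suc 0))" "\<sigma> 0 z = poly_diff G s a od (Suc 0) y"
      using b 0 by (auto simp: boundaries_def)
    obtain x where x: "x \<in> carrier (std_mod G (Suc 0))" "\<sigma> 0 z = sigma_low 0 (std_diff G (Suc 0) x)"
      using poly_boundary_0[OF y(1)] y(2) by auto
    obtain r' where r': "r' \<in> carrier (group_ring G)" "std_diff G (Suc 0) x = Poly_Mapping.single [] r'"
      using std_mod_0_eq[OF std_diff_closed[OF x(1)]] .
    \<comment> \<open>\<sigma>_0 identifies both modules in degree 0 with R, so equal images force
      equal coefficients.\<close>
    have "Poly_Mapping.single (0 :: nat \<Rightarrow>\<^sub>0 nat) r = Poly_Mapping.single 0 r'"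
      using x(2) r r' by (simp add: \<sigma>0 sigma_0_single)
    then have "r = r'" by (metis lookup_single_eq)
    then have "z = std_diff G (Suc 0) x" using r r' by simp
    with x(1) 0 show ?thesis by (auto simp: boundaries_def)
  qed
next
  fix n w assume w: "w \<in> cycles (poly_mod G s) (poly_diff G s a od) n"
  have B0: "0 \<in> boundaries (poly_mod G s) (poly_diff G s a od) k" for k
    unfolding boundaries_def
    by (rule image_eqI[of _ _ 0]) (simp_all add: additive.zero[OF additive_poly_diff] poly_mod_eq)
  show "\<exists>z\<in>cycles (std_mod G) (std_diff G) n. \<exists>y\<in>boundaries (poly_mod G s) (poly_diff G s a od) n.
      w = y \<oplus>\<^bsub>poly_mod G s n\<^esub> \<sigma> n z"
  proof (cases n)
    case (Suc m)
    have "w \<in> carrier (poly_mod G s (Suc m))" "poly_diff G s a od (Suc m) w = 0"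
      using w Suc by (auto simp: cycles_def poly_mod_eq)
    then have "w \<in> boundaries (poly_mod G s) (poly_diff G s a od) n"
      using poly_exact Suc by (force simp: boundaries_def)
    moreover have "module_map (group_ring G) (std_mod G n) (poly_mod G s n) (\<sigma> n)"
      using \<sigma> by (simp add: chain_map_def)
    then have "\<sigma> n 0 = 0"
      using module_map_scale(1)[of n "\<sigma> n" 0 0] by (simp add: std_mod_def)
    moreover have "0 \<in> cycles (std_mod G) (std_diff G) n"
      using Suc by (simp add: cycles_def std_mod_def additive.zero[OF additive_std_diff])
    \<comment> \<open>In positive degree \<open>w\<close> is itself a boundary, so the cycle 0 and
      the boundary \<open>w\<close> serve as witnesses.\<close>
    ultimately show ?thesis
      by (intro bexI[of _ 0] bexI[of _ w]) (auto simp: poly_mod_eq)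
  next
    case 0
    obtain r where r: "r \<in> carrier (group_ring G)" "w = Poly_Mapping.single 0 r"
      using w 0 by (auto simp: cycles_def elim: poly_mod_0_eq)
    have "Poly_Mapping.single [] r \<in> cycles (std_mod G) (std_diff G) 0"
      using r(1) by (auto simp: cycles_def std_mod_def intro!: single_closed)
    moreover have "w = 0 \<oplus>\<^bsub>poly_mod G s 0\<^esub> \<sigma> 0 (Poly_Mapping.single [] r)"
      using r by (simp add: \<sigma>0 sigma_0_single poly_mod_eq)
    ultimately show ?thesis unfolding 0 using B0[of 0] by blast
  qed
qed

section \<open>From coordinates back to products of powers of the generators\<close>

lemma finprod_a_coord:
  assumes "finite A" "A \<subseteq> {1..s}"
  shows "(\<Otimes>i\<in>A. a i [^] (k i :: nat)) = (\<lambda>j\<in>{1..s}. if j \<in> A then gpow j (k j) else \<one>\<^bsub>Gf j\<^esub>)"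
  using assms
proof (induction A rule: finite_induct)
  case empty
  then show ?case by (simp add: one_G)
next
  case (insert i A)
  then have "(\<Otimes>i\<in>insert i A. a i [^] k i) = a i [^] k i \<otimes> (\<Otimes>i\<in>A. a i [^] k i)"
    by (intro finprod_insert) auto
  also have "\<dots> = (\<lambda>j\<in>{1..s}. if j \<in> insert i A then gpow j (k j) else \<one>\<^bsub>Gf j\<^esub>)"
    unfolding mult_G using insert by (intro restrict_ext) (auto simp: a_pow_coord)
  finally show ?case .
qed

lemma finprod_a_closed [simp]: "A \<subseteq> {1..s} \<Longrightarrow> (\<Otimes>i\<in>A. a i [^] (k i :: nat)) \<in> carrier G"
  by (rule finprod_closed) auto

lemma prefix_finprod:
  assumes "i \<in> {1..s}"
  shows "prefix i (\<Otimes>i\<in>{1..s}. a i [^] k i) = (\<Otimes>j\<in>{1..<i}. a j [^] (k j :: nat))"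
proof -
  have sub: "{1..<i} \<subseteq> {1..s}" using assms by auto
  show ?thesis
  proof (rule G_eqI)
    fix j assume "j \<in> {1..s}"
    then show "prefix i (\<Otimes>i\<in>{1..s}. a i [^] k i) j = (\<Otimes>j\<in>{1..<i}. a j [^] k j) j"
      using sub by (simp add: prefix_coord finprod_a_coord)
  qed (use sub in simp_all)
qed

lemma xlog_finprod:
  assumes "i \<in> {1..s}" "k i < od i"
  shows "xlog i (\<Otimes>i\<in>{1..s}. a i [^] k i) = k i"
  using assms by (simp add: finprod_a_coord dlog_gpow)

lemma comparison:
  "\<exists>\<sigma>. quasi_isomorphism (group_ring G) (std_mod G) (std_diff G)
      (poly_mod G s) (poly_diff G s a od) \<sigma> \<and>
    (\<forall>r\<in>carrier (group_ring G).
       \<sigma> 0 (Poly_Mapping.single [] r) = Poly_Mapping.single 0 r) \<and>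
    (\<forall>k :: nat \<Rightarrow> nat. (\<forall>i\<in>{1..s}. k i < od i) \<longrightarrow>
       \<sigma> 1 (std_sym G [\<Otimes>i\<in>{1..s}. a i [^] k i]) =
       (\<Sum>i\<in>{1..s}.
          (frag_of (\<Otimes>j\<in>{1..<i}. a j [^] k j) \<otimes>\<^bsub>group_ring G\<^esub> gr_geom G (a i) (k i))
            \<odot>\<^bsub>poly_mod G s 1\<^esub> poly_var G i)) \<and>
    (\<forall>k l :: nat \<Rightarrow> nat. (\<forall>i\<in>{1..s}. k i < od i \<and> l i < od i) \<longrightarrow>
       \<sigma> 2 (std_sym G [\<Otimes>i\<in>{1..s}. a i [^] k i, \<Otimes>i\<in>{1..s}. a i [^] l i]) =
       (\<Sum>i\<in>{1..s}. \<Sum>j\<in>{1..i}.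
          frag_of ((\<Otimes>q\<in>{1..<i}. a q [^] k q) \<otimes> (\<Otimes>r\<in>{1..<j}. a r [^] l r))
            \<odot>\<^bsub>poly_mod G s 2\<^esub> \<sigma> 2 (std_sym G [a i [^] k i, a j [^] l j]))) \<and>
    (\<forall>i\<in>{1..s}. \<forall>j\<in>{1..s}. \<forall>k < od i. \<forall>l < od j.
       \<sigma> 2 (std_sym G [a i [^] k, a j [^] l]) =
       (if i = j then gr_int G (int ((k + l) div od i)) \<odot>\<^bsub>poly_mod G s 2\<^esub> poly_var2 G i i
        else if i < j then 0
        else - ((gr_geom G (a j) l \<otimes>\<^bsub>group_ring G\<^esub> gr_geom G (a i) k)
                  \<odot>\<^bsub>poly_mod G s 2\<^esub> poly_var2 G j i)))"
proof -
  obtain \<sigma> where cm: "chain_map (group_ring G) (std_mod G) (std_diff G) (poly_mod G s) (poly_diff G s a od) \<sigma>"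
    and low: "\<And>n. n \<le> 2 \<Longrightarrow> \<sigma> n = sigma_low n"
    using comparison_exists by blast
  have low': "\<sigma> 0 = sigma_low 0" "\<sigma> 1 = sigma_low 1" "\<sigma> 2 = sigma_low 2"
    by (simp_all add: low)
  have scale: "r \<odot>\<^bsub>poly_mod G s n\<^esub> f = gr_scale G r f" for r n f
    by (simp add: poly_mod_eq)
  \<comment> \<open>The theorem expresses the general value of \<sigma>_2 through its values on
    pairs of powers; here these are identified with \<open>sigma2_pow\<close>.\<close>
  have pw: "\<sigma> 2 (std_sym G [a i [^] k, a j [^] l]) = sigma2_pow i k j l"
    if "i \<in> {1..s}" "j \<in> {1..s}" "k < od i" "l < od j" for i j k l
    using that by (simp add: low' sigma_2_sym sigma2_sym_pow)
  show ?thesis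
  proof (intro exI[of _ \<sigma>] conjI ballI allI impI)
    show "quasi_isomorphism (group_ring G) (std_mod G) (std_diff G) (poly_mod G s) (poly_diff G s a od) \<sigma>"
      by (rule quasi_isomorphism_comparison[OF cm low'(1)])
    show "\<sigma> 0 (Poly_Mapping.single [] r) = Poly_Mapping.single 0 r" if "r \<in> carrier (group_ring G)" for r
      using that by (simp add: low' sigma_0_single)
  next
    fix k :: "nat \<Rightarrow> nat" assume k: "\<forall>i\<in>{1..s}. k i < od i"
    have "\<sigma> 1 (std_sym G [\<Otimes>i\<in>{1..s}. a i [^] k i]) = sigma1_sym (\<Otimes>i\<in>{1..s}. a i [^] k i)"
      unfolding low' by (rule sigma_1_sym) simp
    also have "\<dots> = (\<Sum>i\<in>{1..s}.
          (frag_of (\<Otimes>j\<in>{1..<i}. a j [^] k j) \<otimes>\<^bsub>group_ring G\<^esub> gr_geom G (a i) (k i))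
            \<odot>\<^bsub>poly_mod G s 1\<^esub> poly_var G i)"
      unfolding sigma1_sym_def scale
      by (intro sum.cong refl) (simp only: prefix_finprod xlog_finprod k)
    finally show "\<sigma> 1 (std_sym G [\<Otimes>i\<in>{1..s}. a i [^] k i]) = \<dots>" .
  next
    fix k l :: "nat \<Rightarrow> nat" assume kl: "\<forall>i\<in>{1..s}. k i < od i \<and> l i < od i"
    have "\<sigma> 2 (std_sym G [\<Otimes>i\<in>{1..s}. a i [^] k i, \<Otimes>i\<in>{1..s}. a i [^] l i])
        = sigma2_sym (\<Otimes>i\<in>{1..s}. a i [^] k i) (\<Otimes>i\<in>{1..s}. a i [^] l i)"
      unfolding low' by (rule sigma_2_sym) simp_all
    also have "\<dots> = (\<Sum>i\<in>{1..s}. \<Sum>j\<in>{1..i}.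
          frag_of ((\<Otimes>q\<in>{1..<i}. a q [^] k q) \<otimes> (\<Otimes>r\<in>{1..<j}. a r [^] l r))
            \<odot>\<^bsub>poly_mod G s 2\<^esub> \<sigma> 2 (std_sym G [a i [^] k i, a j [^] l j]))"
      unfolding sigma2_sym_def scale
    proof (intro sum.cong refl)
      fix i j assume i: "i \<in> {1..s}" and "j \<in> {1..i}"
      then have j: "j \<in> {1..s}" by auto
      show "gr_scale G (frag_of (prefix i (\<Otimes>i\<in>{1..s}. a i [^] k i) \<otimes> prefix j (\<Otimes>i\<in>{1..s}. a i [^] l i)))
          (sigma2_pow i (xlog i (\<Otimes>i\<in>{1..s}. a i [^] k i)) j (xlog j (\<Otimes>i\<in>{1..s}. a i [^] l i)))
        = gr_scale G (frag_of ((\<Otimes>q\<in>{1..<i}. a q [^] k q) \<otimes> (\<Otimes>r\<in>{1..<j}. a r [^] l r)))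
            (\<sigma> 2 (std_sym G [a i [^] k i, a j [^] l j]))"
        using i j kl by (simp only: prefix_finprod xlog_finprod pw)
    qed
    finally show "\<sigma> 2 (std_sym G [\<Otimes>i\<in>{1..s}. a i [^] k i, \<Otimes>i\<in>{1..s}. a i [^] l i]) = \<dots>" .
  next
    fix i j k l assume ij: "i \<in> {1..s}" "j \<in> {1..s}" and kl: "k < od i" "l < od j"
    show "\<sigma> 2 (std_sym G [a i [^] k, a j [^] l]) =
       (if i = j then gr_int G (int ((k + l) div od i)) \<odot>\<^bsub>poly_mod G s 2\<^esub> poly_var2 G i i
        else if i < j then 0
        else - ((gr_geom G (a j) l \<otimes>\<^bsub>group_ring G\<^esub> gr_geom G (a i) k)
                  \<odot>\<^bsub>poly_mod G s 2\<^esub> poly_var2 G j i))"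
      unfolding pw[OF ij kl] scale sigma2_pow_def by (rule refl)
  qed
qed

end

theorem theorem2p1:
  fixes s :: nat
    and Gf :: "nat \<Rightarrow> 'a monoid"
    and b :: "nat \<Rightarrow> 'a"
    and ord :: "nat \<Rightarrow> nat"
    and G :: "(nat \<Rightarrow> 'a) monoid"
    and a :: "nat \<Rightarrow> (nat \<Rightarrow> 'a)"
  assumes factor_group: "\<And>i. i \<in> {1..s} \<Longrightarrow> group (Gf i)"
    and factor_gen: "\<And>i. i \<in> {1..s} \<Longrightarrow> b i \<in> carrier (Gf i)"
    and factor_cyclic: "\<And>i. i \<in> {1..s} \<Longrightarrow> carrier (Gf i) = generate (Gf i) {b i}"
    and factor_finite: "\<And>i. i \<in> {1..s} \<Longrightarrow> finite (carrier (Gf i))"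
    and factor_order: "\<And>i. i \<in> {1..s} \<Longrightarrow> order (Gf i) = ord i"
    and G_eq: "G = product_group {1..s} Gf"
    and a_eq: "\<And>i. i \<in> {1..s} \<Longrightarrow>
                 a i = (\<lambda>j\<in>{1..s}. if j = i then b i else \<one>\<^bsub>Gf j\<^esub>)"
  shows "\<exists>\<sigma> :: nat \<Rightarrow> ((nat \<Rightarrow> 'a) list \<Rightarrow>\<^sub>0 (nat \<Rightarrow> 'a) \<Rightarrow>\<^sub>0 int)
                   \<Rightarrow> ((nat \<Rightarrow>\<^sub>0 nat) \<Rightarrow>\<^sub>0 (nat \<Rightarrow> 'a) \<Rightarrow>\<^sub>0 int).
    quasi_isomorphism (group_ring G) (std_mod G) (std_diff G)
      (poly_mod G s) (poly_diff G s a ord) \<sigma> \<and>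
    (\<forall>r\<in>carrier (group_ring G).
       \<sigma> 0 (Poly_Mapping.single [] r) = Poly_Mapping.single 0 r) \<and>
    (\<forall>k :: nat \<Rightarrow> nat. (\<forall>i\<in>{1..s}. k i < ord i) \<longrightarrow>
       \<sigma> 1 (std_sym G [\<Otimes>\<^bsub>G\<^esub>i\<in>{1..s}. a i [^]\<^bsub>G\<^esub> k i]) =
       (\<Sum>i\<in>{1..s}.
          (frag_of (\<Otimes>\<^bsub>G\<^esub>j\<in>{1..<i}. a j [^]\<^bsub>G\<^esub> k j) \<otimes>\<^bsub>group_ring G\<^esub> gr_geom G (a i) (k i))
            \<odot>\<^bsub>poly_mod G s 1\<^esub> poly_var G i)) \<and>
    (\<forall>k l :: nat \<Rightarrow> nat. (\<forall>i\<in>{1..s}. k i < ord i \<and> l i < ord i) \<longrightarrow>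
       \<sigma> 2 (std_sym G [\<Otimes>\<^bsub>G\<^esub>i\<in>{1..s}. a i [^]\<^bsub>G\<^esub> k i, \<Otimes>\<^bsub>G\<^esub>i\<in>{1..s}. a i [^]\<^bsub>G\<^esub> l i]) =
       (\<Sum>i\<in>{1..s}. \<Sum>j\<in>{1..i}.
          frag_of ((\<Otimes>\<^bsub>G\<^esub>q\<in>{1..<i}. a q [^]\<^bsub>G\<^esub> k q) \<otimes>\<^bsub>G\<^esub> (\<Otimes>\<^bsub>G\<^esub>r\<in>{1..<j}. a r [^]\<^bsub>G\<^esub> l r))
            \<odot>\<^bsub>poly_mod G s 2\<^esub> \<sigma> 2 (std_sym G [a i [^]\<^bsub>G\<^esub> k i, a j [^]\<^bsub>G\<^esub> l j]))) \<and>
    (\<forall>i\<in>{1..s}. \<forall>j\<in>{1..s}. \<forall>k < ord i. \<forall>l < ord j.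
       \<sigma> 2 (std_sym G [a i [^]\<^bsub>G\<^esub> k, a j [^]\<^bsub>G\<^esub> l]) =
       (if i = j then gr_int G (int ((k + l) div ord i)) \<odot>\<^bsub>poly_mod G s 2\<^esub> poly_var2 G i i
        else if i < j then 0
        else - ((gr_geom G (a j) l \<otimes>\<^bsub>group_ring G\<^esub> gr_geom G (a i) k)
                  \<odot>\<^bsub>poly_mod G s 2\<^esub> poly_var2 G j i)))"
proof -
  interpret cyclic_product s Gf b ord G a
    by (rule cyclic_product.intro) (fact assms)+
  show ?thesis by (rule comparison)
qed

end
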